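(* Let $F$ satisfy assumptions (A) and (B) stated in the context, and let $u\in C^1(\Omega)$ be an $e_n$-minimizer for the energy $\mathcal{E}$. Suppose there exists $C>0$ such that for all large $R$ $$\int_{\Omega\cap B_R}|F_{pp}(\nabla u,u,x')|\,|\nabla u|^2\,dx\le CR^2 .$$ Then $u$ is monotone on each line in the $e_n$-direction, i.e. for every $\bar x\in\Omega$, either $u_n(\bar x+te_n)\ge 0$ for all $t\in\mathbb{R}$, or $u_n(\bar x+te_n)\le 0$ for all $t\in\mathbb{R}$.
   Context: Setting: $\Omega=\mathcal{U}\times\mathbb{R}\subseteq\mathbb{R}^n$ is a domain with $\mathcal{U}\subseteq\mathbb{R}^{n-1}$; points are $x=(x',x_n)\in\mathcal{U}\times\mathbb{R}$; $e_n$ is the $n$-th coordinate unit vector; $B_R$ is the ball of radius $R$ centered at $0$ in $\mathbb{R}^n$; subscript $n$ denotes $\partial/\partial x_n$ (so $u_n=\partial u/\partial x_n$). $F=F(p,z,x')$ does not depend on $x_n$, and $F_{pp}=D^2_pF$. Assumption (A): $F\in C(\mathbb{R}^n\times\mathbb{R}\times\mathcal{U})$ is convex in $p$ and, for any $(z,x')\in\mathbb{R}\times\mathcal{U}$, $F$ is $C^2$ and uniformly convex in $p$ at all $p$ with $p_n\neq 0$. Assumption (B): there is $C>0$ such that $|F_{pp}(p+q,z,x')|\le C|F_{pp}(p,z,x')|$ for all $p,q\in\mathbb{R}^n$ with $|q|\le |p_n|/2$ (and all $(z,x')$). Energy: $\mathcal{E}_R(u):=\int_{\Omega\cap B_R}F(\nabla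 u(x),u(x),x')\,dx$ for $R>0$. Definitions. $v$ is an $e_n$-Lipschitz deformation of $u$ in $B_R$ if there is a Lipschitz function $\psi$ with compact support in $B_R$ and $\|\psi_n\|_{L^\infty(\mathbb{R}^n)}<1$ such that $v(x)=u(x+\psi(x)e_n)$ for all $x\in\Omega$. For $u\in C^{0,1}(\Omega)$, $D_R(u)$ is the set of all $v\in C^{0,1}(\Omega)$ (piecewise $e_n$-Lipschitz deformations of $u$ in $B_R$) for which there are finitely many $e_n$-Lipschitz deformations $v^{(1)},\dots,v^{(m)}$ of $u$ in $B_R$ such that for each $x\in\Omega$, $v(x)=v^{(i)}(x)$ for some $i$ depending on $x$. A function $u\in C^{0,1}(\Omega)$ is an $e_n$-minimizer for $\mathcal{E}$ if for every $R>0$, $\mathcal{E}_R(u)$ is finite and $\mathcal{E}_R(u)\le\mathcal{E}_R(v)$ for all $v\in D_R(u)$. *)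

theory Defs
  imports "HOL-Analysis.Analysis" "HOL-Probability.Essential_Supremum"
begin

text \<open>
  Space \<open>\<real>\<^sup>n\<close> with \<open>n = CARD('m) + 1\<close> is represented as \<open>(real^'m) \<times> real\<close>, whose product norm and
  inner product are the Euclidean ones; a point is \<open>x = (x', x\<^sub>n) = (fst x, snd x)\<close>.  Functions on
  the domain are total HOL functions of which only the values on the (open) domain matter.
\<close>

type_synonym 'm pt = "(real^'m) \<times> real"

type_synonym 'm integrand = "'m pt \<Rightarrow> real \<Rightarrow> real^'m \<Rightarrow> real"

definition is_domain :: "'a::topological_space set \<Rightarrow> bool" where
  "is_domain S \<longleftrightarrow> open S \<and> connected S \<and> S \<noteq> {}"

definition cylinder :: "(real^'m) set \<Rightarrow> 'm::finite pt set" where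
  "cylinder U = U \<times> UNIV"

definition e_n :: "'m::finite pt" where
  "e_n = (0, 1)"

definition partial_n :: "('m::finite pt \<Rightarrow> real) \<Rightarrow> 'm pt \<Rightarrow> real" where
  "partial_n f x = deriv (\<lambda>t. f (x + t *\<^sub>R e_n)) 0"

text \<open>
  The gradient is an unspecified constant where the function is not differentiable.  For a locally
  Lipschitz function this is a null set (Rademacher), so the integrals below do not see it.
\<close>

definition grad :: "('a::real_inner \<Rightarrow> real) \<Rightarrow> 'a \<Rightarrow> 'a" where
  "grad f x = (THE D. GDERIV f x :> D)"

text \<open>
  The Hessian, as a linear operator.  It is set to zero where the second derivative does not exist.
\<close>

definition hess :: "('a::real_inner \<Rightarrow> real) \<Rightarrow> 'a \<Rightarrow> 'a \<Rightarrow> 'a" where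
  "hess f x =
     (if (\<forall>\<^sub>F y in nhds x. f differentiable (at y)) \<and> grad f differentiable (at x)
      then frechet_derivative (grad f) (at x) else (\<lambda>_. 0))"

definition C1_on :: "'a::real_inner set \<Rightarrow> ('a \<Rightarrow> real) \<Rightarrow> bool" where
  "C1_on S f \<longleftrightarrow> (\<forall>x\<in>S. f differentiable (at x)) \<and> continuous_on S (grad f)"

text \<open>Only used for open \<open>S\<close>, in finite dimension.\<close>

definition C2_on :: "'a::euclidean_space set \<Rightarrow> ('a \<Rightarrow> real) \<Rightarrow> bool" where
  "C2_on S f \<longleftrightarrow>
     (\<forall>x\<in>S. f differentiable (at x)) \<and> (\<forall>x\<in>S. grad f differentiable (at x)) \<and>
     (\<forall>\<xi>. continuous_on S (\<lambda>x. hess f x \<xi>))"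

text \<open>\<open>C\<^sup>0\<^sup>,\<^sup>1\<close> of an open set, in the usual local sense (so that it contains \<open>C\<^sup>1\<close>).\<close>

definition C01_on :: "'a::metric_space set \<Rightarrow> ('a \<Rightarrow> real) \<Rightarrow> bool" where
  "C01_on S f \<longleftrightarrow> (\<forall>x\<in>S. \<exists>r>0. \<exists>L. L-lipschitz_on (ball x r \<inter> S) f)"

definition F_pp :: "'m::finite integrand \<Rightarrow> 'm pt \<Rightarrow> real \<Rightarrow> real^'m \<Rightarrow> 'm pt \<Rightarrow> 'm pt" where
  "F_pp F p z x' = hess (\<lambda>q. F q z x') p"

definition uniformly_convex_at :: "('a::real_inner \<Rightarrow> real) \<Rightarrow> 'a \<Rightarrow> bool" where
  "uniformly_convex_at f p \<longleftrightarrow> (\<exists>l>0. \<forall>\<xi>. l * (norm \<xi>)\<^sup>2 \<le> \<xi> \<bullet> hess f p \<xi>)"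

definition assumption_A :: "(real^'m) set \<Rightarrow> 'm::finite integrand \<Rightarrow> bool" where
  "assumption_A U F \<longleftrightarrow>
     continuous_on (UNIV \<times> UNIV \<times> U) (\<lambda>(p, z, x'). F p z x') \<and>
     (\<forall>z. \<forall>x'\<in>U.
        convex_on UNIV (\<lambda>p. F p z x') \<and>
        C2_on {p. snd p \<noteq> 0} (\<lambda>p. F p z x') \<and>
        (\<forall>p. snd p \<noteq> 0 \<longrightarrow> uniformly_convex_at (\<lambda>p. F p z x') p))"

text \<open>For \<open>p\<^sub>n = 0\<close> the condition forces \<open>q = 0\<close>, and the inequality holds as soon as \<open>C \<ge> 1\<close>.\<close>

definition assumption_B :: "(real^'m) set \<Rightarrow> 'm::finite integrand \<Rightarrow> bool" where
  "assumption_B U F \<longleftrightarrow>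
     (\<exists>C>0. \<forall>z. \<forall>x'\<in>U. \<forall>p q. norm q \<le> \<bar>snd p\<bar> / 2 \<longrightarrow>
        onorm (F_pp F (p + q) z x') \<le> C * onorm (F_pp F p z x'))"

definition lagrangian :: "'m::finite integrand \<Rightarrow> ('m pt \<Rightarrow> real) \<Rightarrow> 'm pt \<Rightarrow> real" where
  "lagrangian F u x = F (grad u x) (u x) (fst x)"

text \<open>
  The energy is an extended real, the difference of the integrals of the positive and the negative
  part of the integrand (\<open>ennreal\<close> maps negative reals to zero).  It is meaningful only if these are
  not both infinite: in \<^typ>\<open>ereal\<close>, \<open>\<infinity> - \<infinity> = \<infinity>\<close>.  No lower bound on the integrand is assumed,
  so this has to be required where energies are compared.
\<close>

definition energy_pos :: "(real^'m) set \<Rightarrow> 'm::finite integrand \<Rightarrow> real \<Rightarrow> ('m pt \<Rightarrow> real) \<Rightarrow> ennreal" where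
  "energy_pos U F R u = (\<integral>\<^sup>+x\<in>cylinder U \<inter> ball 0 R. ennreal (lagrangian F u x) \<partial>lebesgue)"

definition energy_neg :: "(real^'m) set \<Rightarrow> 'm::finite integrand \<Rightarrow> real \<Rightarrow> ('m pt \<Rightarrow> real) \<Rightarrow> ennreal" where
  "energy_neg U F R u = (\<integral>\<^sup>+x\<in>cylinder U \<inter> ball 0 R. ennreal (- lagrangian F u x) \<partial>lebesgue)"

definition energy_exists :: "(real^'m) set \<Rightarrow> 'm::finite integrand \<Rightarrow> real \<Rightarrow> ('m pt \<Rightarrow> real) \<Rightarrow> bool" where
  "energy_exists U F R u \<longleftrightarrow> energy_pos U F R u \<noteq> \<infinity> \<or> energy_neg U F R u \<noteq> \<infinity>"

definition energy :: "(real^'m) set \<Rightarrow> 'm::finite integrand \<Rightarrow> real \<Rightarrow> ('m pt \<Rightarrow> real) \<Rightarrow> ereal" where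
  "energy U F R u = enn2ereal (energy_pos U F R u) - enn2ereal (energy_neg U F R u)"

definition lipschitz_deformation ::
    "(real^'m) set \<Rightarrow> real \<Rightarrow> ('m::finite pt \<Rightarrow> real) \<Rightarrow> ('m pt \<Rightarrow> real) \<Rightarrow> bool" where
  "lipschitz_deformation U R u v \<longleftrightarrow>
     (\<exists>\<psi> :: 'm pt \<Rightarrow> real.
        (\<exists>L. L-lipschitz_on UNIV \<psi>) \<and>
        compact (closure {x. \<psi> x \<noteq> 0}) \<and> closure {x. \<psi> x \<noteq> 0} \<subseteq> ball 0 R \<and>
        esssup lebesgue (\<lambda>x. ereal \<bar>partial_n \<psi> x\<bar>) < 1 \<and>
        (\<forall>x\<in>cylinder U. v x = u (x + \<psi> x *\<^sub>R e_n)))"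

definition piecewise_deformations ::
    "(real^'m) set \<Rightarrow> real \<Rightarrow> ('m::finite pt \<Rightarrow> real) \<Rightarrow> ('m pt \<Rightarrow> real) set" where
  "piecewise_deformations U R u =
     {v. C01_on (cylinder U) v \<and>
         (\<exists>V. finite V \<and> (\<forall>w\<in>V. lipschitz_deformation U R u w) \<and>
              (\<forall>x\<in>cylinder U. \<exists>w\<in>V. v x = w x))}"

definition e_n_minimizer ::
    "(real^'m) set \<Rightarrow> 'm::finite integrand \<Rightarrow> ('m pt \<Rightarrow> real) \<Rightarrow> bool" where
  "e_n_minimizer U F u \<longleftrightarrow>
     C01_on (cylinder U) u \<and>
     (\<forall>R>0. energy_exists U F R u \<and> \<bar>energy U F R u\<bar> \<noteq> \<infinity> \<and>
        (\<forall>v\<in>piecewise_deformations U R u.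
           energy_exists U F R v \<and> energy U F R u \<le> energy U F R v))"

end

theory Submission
  imports Defs
begin

text \<open>
  Suppose that \<open>u\<close> is not monotone on some vertical line.  An argument in one variable (\<open>line_crossing\<close>)
  gives points \<open>x0\<close> and \<open>x0 + t e_n\<close> of that line at which \<open>u\<close> has the same value, at which the vertical
  derivatives do not have the same sign, and with a nonzero vertical derivative at \<open>x0\<close>.  The functions
  \<open>u\<close> and \<open>u(\<cdot> + t e_n)\<close> then cross transversally at \<open>x0\<close>, so their minimum has a true edge there.  Two
  facts about this minimum contradict each other.
  
  The minimum is almost minimizing (\<open>almost_translation\<close>, \<open>min_max_energy\<close>).  Cut the translation off at
  infinity: let \<open>w\<close> be the composition of \<open>u\<close> with the inverse of \<open>y \<mapsto> y - t \<psi>(y) e_n\<close>, where \<open>\<psi> = 1\<close> on a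
  large ball.  Changing variables turns the energy of \<open>w\<close> into an integral over the same domain, of an
  integrand whose terms of first order are exactly linear in \<open>t\<close>.  Adding the energies for \<open>t\<close> and \<open>-t\<close> and
  subtracting twice the energy of \<open>u\<close> leaves at most a constant times
  \<open>t\<^sup>2 \<integral> |F_pp(\<nabla>u)| |\<nabla>u|\<^sup>2 |\<nabla>\<psi>|\<^sup>2\<close>.  Quadratic growth of \<open>\<integral> |F_pp| |\<nabla>u|\<^sup>2\<close> is exactly what makes this small when
  \<open>\<psi>\<close> decays logarithmically: over \<open>N\<close> dyadic annuli the integral is \<open>O(1/N)\<close>.  As the deformation for \<open>-t\<close>
  costs at least as much as \<open>u\<close>, the energy of \<open>w\<close> exceeds that of \<open>u\<close> by at most \<open>\<epsilon>\<close>.  The energies of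
  \<open>min u w\<close> and \<open>max u w\<close> add up to those of \<open>u\<close> and \<open>w\<close>, and \<open>max u w\<close> is a competitor; hence the energy of
  \<open>min u w\<close> also exceeds that of \<open>u\<close> by at most \<open>\<epsilon>\<close>.
  
  The edge can be cut off with a gain that does not depend on \<open>\<epsilon>\<close> (\<open>cut_corner_energy\<close>, \<open>corner_gain\<close>).  Near
  \<open>x0\<close> the minimum looks like the minimum of two affine functions with slopes \<open>p\<close> and \<open>q\<close>.  A third small
  deformation of \<open>u\<close> is nearly affine with a slope \<open>r0\<close> strictly between \<open>p\<close> and \<open>q\<close>, and passes below the edge.
  This is possible because \<open>p_n \<noteq> 0\<close>: a vertical deformation can then add any small vector to the slope.  Since \<open>F\<close>
  lies strictly above its tangent plane at \<open>r0\<close>, taking the minimum with this deformation lowers the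
  energy by some \<open>\<delta> > 0\<close> that depends only on \<open>F\<close> and on \<open>u\<close> near the two points.  For \<open>\<epsilon> < \<delta>\<close> the result is a piecewise
  deformation of \<open>u\<close> with less energy than \<open>u\<close>.
\<close>

section \<open>Gradients of minima, and null sets\<close>

lemma GDERIV_unique: "GDERIV f x :> D \<Longrightarrow> GDERIV f x :> E \<Longrightarrow> D = E"
  unfolding gderiv_def
  by (metis has_derivative_unique inner_commute vector_eq_rdot)

lemma grad_eq: "GDERIV f x :> D \<Longrightarrow> grad f x = D"
  unfolding grad_def by (rule the_equality) (auto dest: GDERIV_unique)

lemma GDERIV_grad:
  fixes f :: "'a::euclidean_space \<Rightarrow> real"
  assumes "f differentiable (at x)"
  shows "GDERIV f x :> grad f x"
proof -
  obtain f' where f': "(f has_derivative f') (at x)"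
    using assms unfolding differentiable_def by blast
  then have "linear f'" by (rule has_derivative_linear)
  then have "f' = (\<lambda>h. h \<bullet> adjoint f' 1)"
    using adjoint_works[of f'] by (auto simp: fun_eq_iff)
  with f' have "GDERIV f x :> adjoint f' 1" unfolding gderiv_def by metis
  then show ?thesis using grad_eq by metis
qed

lemma GDERIV_imp_differentiable: "GDERIV f x :> D \<Longrightarrow> f differentiable (at x)"
  unfolding gderiv_def differentiable_def by blast

lemma GDERIV_imp_isCont: "GDERIV f x :> D \<Longrightarrow> isCont f x"
  unfolding gderiv_def using has_derivative_continuous by blast

text \<open>
  At a point where both functions have the same value and the same gradient, the difference quotient of
  the minimum is the minimum of the two difference quotients; elsewhere only one of the functions is seen.
\<close>

lemma GDERIV_min:
  fixes f g :: "'a::real_inner \<Rightarrow> real"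
  assumes f: "GDERIV f x :> A" and g: "GDERIV g x :> B" and eq: "f x = g x \<Longrightarrow> A = B"
  shows "GDERIV (\<lambda>y. min (f y) (g y)) x :> (if f x \<le> g x then A else B)"
proof (cases "f x = g x")
  case False
  have t: "((\<lambda>y. f y - g y) \<longlongrightarrow> f x - g x) (at x)"
    using f g by (auto dest!: GDERIV_imp_isCont simp: isCont_def intro: tendsto_diff)
  have ev: "\<forall>\<^sub>F y in at x. (f y < g y) = (f x < g x)"
  proof (cases "f x < g x")
    case True
    then show ?thesis using order_tendstoD(2)[OF t, of 0] by (auto elim!: eventually_mono)
  next
    case c: False
    then show ?thesis using order_tendstoD(1)[OF t, of 0] False by (auto elim!: eventually_mono)
  qed
  show ?thesis
  proof (cases "f x < g x")
    case True
    with ev have "\<forall>\<^sub>F y in at x. f y = min (f y) (g y)" by (auto elim: eventually_mono)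
    with f True show ?thesis unfolding gderiv_def
      by (auto intro: has_derivative_transform_eventually[of f _ x UNIV] elim: eventually_mono)
  next
    case c: False
    with ev have "\<forall>\<^sub>F y in at x. g y = min (f y) (g y)" by (auto elim: eventually_mono)
    with g False c show ?thesis unfolding gderiv_def
      by (auto intro: has_derivative_transform_eventually[of g _ x UNIV] elim: eventually_mono)
  qed
next
  case True
  with eq have [simp]: "B = A" by simp
  define F where "F y = (f y - f x - (y - x) \<bullet> A) /\<^sub>R norm (y - x)" for y
  define G where "G y = (g y - g x - (y - x) \<bullet> A) /\<^sub>R norm (y - x)" for y
  have "(F \<longlongrightarrow> 0) (at x)" "(G \<longlongrightarrow> 0) (at x)"
    using f g unfolding gderiv_def has_derivative_at_within F_def G_def by (simp_all add: algebra_simps)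
  then have "((\<lambda>y. min (F y) (G y)) \<longlongrightarrow> min 0 0) (at x)" by (rule tendsto_min)
  moreover have "(min (f y) (g y) - min (f x) (g x) - (y - x) \<bullet> A) /\<^sub>R norm (y - x) = min (F y) (G y)" for y
    using True by (cases "f y \<le> g y") (simp_all add: F_def G_def min_absorb1 min_absorb2 mult_left_mono)
  ultimately have "((\<lambda>y. (min (f y) (g y) - min (f x) (g x) - (y - x) \<bullet> A) /\<^sub>R norm (y - x)) \<longlongrightarrow> 0) (at x)"
    by simp
  then show ?thesis
    unfolding gderiv_def has_derivative_at_within using True bounded_linear_inner_left by simp
qed

text \<open>
  Differentiability at such a zero confines the zeros near it to a thin slab around a hyperplane, which
  fills an arbitrarily small fraction of a small ball.  So no such zero is a density point.  Together with
  \<open>GDERIV_min\<close> this makes minima of finitely many differentiable functions differentiable almost everywhere.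
\<close>

lemma negligible_zeros_with_nonzero_gradient:
  fixes g :: "'a::euclidean_space \<Rightarrow> real"
  assumes zero: "\<And>x. x \<in> S \<Longrightarrow> g x = 0"
    and der: "\<And>x. x \<in> S \<Longrightarrow> \<exists>D. D \<noteq> 0 \<and> GDERIV g x :> D"
  shows "negligible S"
  unfolding negligible_eq_zero_density
proof (intro ballI allI impI)
  fix x and r e :: real
  assume xS: "x \<in> S" and r: "r > 0" and e: "e > 0"
  obtain D where D0: "D \<noteq> 0" and D: "GDERIV g x :> D" using der[OF xS] by blast
  \<comment> \<open>Slabs in the unit ball, decreasing to a piece of a hyperplane.\<close>
  define T where "T k = {y \<in> ball 0 1. \<bar>y \<bullet> D\<bar> \<le> 1 / Suc k}" for k :: nat
  have Tset: "T k \<in> sets borel" for k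
  proof -
    have "T k = ball 0 1 \<inter> {y. \<bar>y \<bullet> D\<bar> \<le> 1 / Suc k}" by (auto simp: T_def)
    moreover have "closed {y. \<bar>y \<bullet> D\<bar> \<le> 1 / Suc k}"
      by (intro closed_Collect_le continuous_intros)
    ultimately show ?thesis by auto
  qed
  have Tl: "T k \<in> lmeasurable" for k
    using Tset[of k] by (intro bounded_set_imp_lmeasurable) (auto simp: T_def intro: bounded_subset[OF bounded_ball[of 0 1]])
  have "(\<lambda>k. measure lebesgue (T k)) \<longlonglongrightarrow> measure lebesgue (\<Inter>k. T k)"
  proof (rule Lim_measure_decseq)
    show "range T \<subseteq> sets lebesgue" using Tset by auto
    show "decseq T"
      by (rule decseq_SucI) (auto simp: T_def field_simps intro: order_trans)
    show "emeasure lebesgue (T i) \<noteq> \<infinity>" for i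
      using fmeasurableD2[OF Tl[of i]] by simp
  qed
  moreover have "negligible (\<Inter>k. T k)"
  proof (rule negligible_subset)
    show "negligible {y. D \<bullet> y = 0}" using D0 by (rule negligible_hyperplane[OF disjI1])
    show "(\<Inter>k. T k) \<subseteq> {y. D \<bullet> y = 0}"
    proof safe
      fix y assume "y \<in> (\<Inter>k. T k)"
      then have le: "\<bar>y \<bullet> D\<bar> \<le> 1 / Suc k" for k by (auto simp: T_def)
      have "\<bar>y \<bullet> D\<bar> \<le> 0"
      proof (rule ccontr)
        assume "\<not> ?thesis"
        then obtain k where "inverse (of_nat (Suc k)) < \<bar>y \<bullet> D\<bar>"
          using reals_Archimedean[of "\<bar>y \<bullet> D\<bar>"] by auto
        then show False using le[of k] by (simp add: inverse_eq_divide)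
      qed
      then show "D \<bullet> y = 0" by (simp add: inner_commute)
    qed
  qed
  ultimately have "(\<lambda>k. measure lebesgue (T k)) \<longlonglongrightarrow> 0"
    by (simp add: negligible_imp_measure0)
  moreover have "0 < e * measure lebesgue (ball (0::'a) 1)" using e by (simp add: content_ball_pos)
  ultimately obtain k where k: "measure lebesgue (T k) < e * measure lebesgue (ball (0::'a) 1)"
    using order_tendstoD(2) eventually_happens'[OF sequentially_bot] by metis
  define \<epsilon> where "\<epsilon> = 1 / real (Suc k)"
  have \<epsilon>: "\<epsilon> > 0" by (simp add: \<epsilon>_def)
  obtain d0 where d0: "d0 > 0"
    "\<And>y. norm (y - x) < d0 \<Longrightarrow> \<bar>g y - g x - (y - x) \<bullet> D\<bar> \<le> \<epsilon> * norm (y - x)"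
    using D \<epsilon> unfolding gderiv_def has_derivative_at_alt by (metis real_norm_def)
  define d where "d = min d0 r"
  have d: "d > 0" "d \<le> r" "d \<le> d0" using d0 r by (auto simp: d_def)
  define U where "U = (\<lambda>y. d *\<^sub>R y + x) ` T k"
  have "U = (\<lambda>y. (y - x) /\<^sub>R d) -` T k"
  proof safe
    fix y assume "(y - x) /\<^sub>R d \<in> T k"
    moreover have "y = d *\<^sub>R ((y - x) /\<^sub>R d) + x" using d by simp
    ultimately show "y \<in> U" unfolding U_def by blast
  qed (use d in \<open>auto simp: U_def\<close>)
  moreover have "(\<lambda>y. (y - x) /\<^sub>R d) \<in> borel_measurable borel" by measurable
  ultimately have "U \<in> sets borel" using measurable_sets_borel Tset by metis
  moreover have "bounded U" unfolding U_def
  proof (rule bounded_subset[OF bounded_ball[of x d]], safe)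
    fix y assume "y \<in> T k" then show "d *\<^sub>R y + x \<in> ball x d" using d by (auto simp: T_def dist_norm)
  qed
  ultimately have Ul: "U \<in> lmeasurable" by (intro bounded_set_imp_lmeasurable) auto
  have "measure lebesgue U = d ^ DIM('a) * measure lebesgue (T k)"
    unfolding U_def using measure_lebesgue_affine[of d x "T k"] d by simp
  moreover have "measure lebesgue (ball x d) = d ^ DIM('a) * measure lebesgue (ball (0::'a) 1)"
    using d content_ball_conv_unit_ball[of d x] by simp
  ultimately have "measure lebesgue U < e * measure lebesgue (ball x d)"
    using k d by (simp add: mult.left_commute)
  moreover have "S \<inter> ball x d \<subseteq> U"
  proof
    fix y assume y: "y \<in> S \<inter> ball x d"
    then have "\<bar>(y - x) \<bullet> D\<bar> \<le> \<epsilon> * norm (y - x)"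
      using d0(2)[of y] zero xS d by (auto simp: dist_norm norm_minus_commute)
    also have "\<dots> \<le> \<epsilon> * d" using y \<epsilon> by (auto simp: dist_norm norm_minus_commute)
    finally have "\<bar>((y - x) /\<^sub>R d) \<bullet> D\<bar> \<le> 1 / Suc k"
      using d by (simp add: \<epsilon>_def abs_mult divide_simps del: of_nat_Suc)
    moreover have "norm ((y - x) /\<^sub>R d) < 1"
      using y d by (simp add: dist_norm norm_minus_commute divide_simps)
    ultimately have "(y - x) /\<^sub>R d \<in> T k" by (simp add: T_def)
    moreover have "y = d *\<^sub>R ((y - x) /\<^sub>R d) + x" using d by simp
    ultimately show "y \<in> U" unfolding U_def by blast
  qed
  ultimately show "\<exists>d>0. d \<le> r \<and> (\<exists>U. S \<inter> ball x d \<subseteq> U \<and> U \<in> lmeasurable \<and> measure lebesgue U < e * measure lebesgue (ball x d))"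
    using Ul d by blast
qed

text \<open>
  The difference quotients in direction \<open>\<zeta>\<close> have integral zero by translation invariance, and they
  converge boundedly.  The Lipschitz bound is only required at small distances, which is what one has for a
  function that is Lipschitz near its support and is extended by zero.
\<close>

lemma integral_gradient_eq_0:
  fixes f :: "'a::euclidean_space \<Rightarrow> real"
  assumes h0: "h0 > 0" and lip: "\<And>x y. norm (y - x) < h0 \<Longrightarrow> \<bar>f y - f x\<bar> \<le> L * norm (y - x)"
    and supp: "\<And>x. x \<notin> ball c r \<Longrightarrow> f x = 0"
    and N: "negligible N" and der: "\<And>x. x \<notin> N \<Longrightarrow> GDERIV f x :> g x" and gN: "\<And>x. x \<in> N \<Longrightarrow> g x = 0"
  shows "integrable lebesgue (\<lambda>x. \<zeta> \<bullet> g x)" "(\<integral>x. \<zeta> \<bullet> g x \<partial>lebesgue) = 0"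
proof -
  have cont: "continuous_on UNIV f"
  proof (simp add: continuous_on_eq_continuous_at, rule)
    fix x
    show "isCont f x"
      unfolding isCont_def LIM_def
    proof safe
      fix e :: real assume e: "e > 0"
      define d where "d = min h0 (e / (\<bar>L\<bar> + 1))"
      have "d > 0" using e h0 by (auto simp: d_def)
      moreover have "dist (f y) (f x) < e" if "dist y x < d" for y
      proof -
        have "\<bar>f y - f x\<bar> \<le> L * norm (y - x)" using lip that by (auto simp: d_def dist_norm)
        also have "\<dots> \<le> \<bar>L\<bar> * norm (y - x)" by (intro mult_right_mono) auto
        also have "\<dots> \<le> \<bar>L\<bar> * (e / (\<bar>L\<bar> + 1))"
          using that by (intro mult_left_mono) (auto simp: d_def dist_norm)
        also have "\<dots> < e" using e by (simp add: field_simps)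
        finally show ?thesis by (simp add: dist_norm)
      qed
      ultimately show "\<exists>s>0. \<forall>y. y \<noteq> x \<and> dist y x < s \<longrightarrow> dist (f y) (f x) < e" by blast
    qed
  qed
  then have fm[measurable]: "f \<in> borel_measurable borel" by (rule borel_measurable_continuous_onI)
  have fint: "integrable lborel f"
  proof -
    have "compact (f ` cball c r)"
      using cont by (intro compact_continuous_image) (auto intro: continuous_on_subset)
    then obtain B where B: "\<forall>y\<in>f ` cball c r. norm y \<le> B"
      using compact_imp_bounded bounded_iff by metis
    show ?thesis
    proof (rule integrableI_bounded_set[where A = "ball c r" and B = B])
      show "emeasure lborel (ball c r) < \<infinity>" using emeasure_lborel_ball_finite[of c r] by simp
      show "AE x in lborel. x \<in> ball c r \<longrightarrow> norm (f x) \<le> B"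
        using B by (intro AE_I2 impI) (simp add: less_imp_le)
    qed (use supp in simp_all)
  qed
  have shift: "integrable lborel (\<lambda>x. f (a + x))" "(\<integral>x. f (a + x) \<partial>lborel) = (\<integral>x. f x \<partial>lborel)" for a
  proof -
    have "integrable (distr lborel borel ((+) a)) f" using fint by (simp add: lborel_distr_plus)
    then show "integrable lborel (\<lambda>x. f (a + x))" by (subst (asm) integrable_distr_eq) auto
    have "(\<integral>x. f x \<partial>lborel) = (\<integral>x. f x \<partial>distr lborel borel ((+) a))" by (simp add: lborel_distr_plus)
    also have "\<dots> = (\<integral>x. f (a + x) \<partial>lborel)" by (rule integral_distr) auto
    finally show "(\<integral>x. f (a + x) \<partial>lborel) = (\<integral>x. f x \<partial>lborel)" by simp
  qed
  define \<delta> where "\<delta> = min h0 1 / (norm \<zeta> + 1)"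
  have d0: "\<delta> > 0" using h0 by (auto simp: \<delta>_def intro!: divide_pos_pos add_nonneg_pos)
  define h where "h n = \<delta> / real (Suc n)" for n
  have h: "h n > 0" "h n * norm \<zeta> < h0" "h n * norm \<zeta> < 1" for n
  proof -
    show "h n > 0" using d0 by (simp add: h_def)
    have "h n \<le> \<delta>" using d0 by (simp add: h_def field_simps)
    then have "h n * norm \<zeta> \<le> \<delta> * norm \<zeta>" by (rule mult_right_mono) simp
    also have "\<dots> < min h0 1"
    proof -
      have "\<delta> * norm \<zeta> < \<delta> * (norm \<zeta> + 1)" using d0 by simp
      also have "\<dots> = min h0 1" by (simp add: \<delta>_def add_nonneg_eq_0_iff)
      finally show ?thesis .
    qed
    finally show "h n * norm \<zeta> < h0" "h n * norm \<zeta> < 1" by auto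
  qed
  have hlim: "h \<longlonglongrightarrow> 0"
    unfolding h_def using LIMSEQ_Suc[OF lim_const_over_n[of \<delta>]] by simp
  define s where "s n x = (f (h n *\<^sub>R \<zeta> + x) - f x) / h n" for n x
  have sm[measurable]: "s n \<in> borel_measurable borel" for n unfolding s_def by measurable
  have Ns: "N \<in> sets lebesgue" using N by (simp add: negligible_iff_null_sets null_setsD2)
  have slim: "(\<lambda>n. s n x) \<longlonglongrightarrow> \<zeta> \<bullet> g x" if "x \<notin> N" for x
  proof -
    have "(f has_derivative (\<lambda>v. v \<bullet> g x)) (at x)" using der[OF that] by (simp add: gderiv_def)
    then have 1: "(f has_derivative (\<lambda>v. v \<bullet> g x)) (at (0 *\<^sub>R \<zeta> + x))" by simp
    have 2: "((\<lambda>t. t *\<^sub>R \<zeta> + x) has_derivative (\<lambda>t. t *\<^sub>R \<zeta>)) (at 0)"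
      by (auto intro!: derivative_eq_intros)
    have "((\<lambda>t. f (t *\<^sub>R \<zeta> + x)) has_derivative (\<lambda>t. (t *\<^sub>R \<zeta>) \<bullet> g x)) (at 0)"
      by (rule has_derivative_compose[OF 2 1])
    then have "((\<lambda>t. f (t *\<^sub>R \<zeta> + x)) has_real_derivative (\<zeta> \<bullet> g x)) (at 0)"
      unfolding has_field_derivative_def by (simp add: mult_commute_abs)
    then have "((\<lambda>t. (f (t *\<^sub>R \<zeta> + x) - f x) / t) \<longlongrightarrow> \<zeta> \<bullet> g x) (at 0)"
      unfolding has_field_derivative_iff by simp
    moreover have "filterlim h (at 0) sequentially"
      unfolding filterlim_at using hlim h(1) by (simp add: less_imp_neq[THEN not_sym])
    ultimately show ?thesis unfolding s_def by (rule filterlim_compose)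
  qed
  define G where "G x = (if x \<in> N then 0 else \<zeta> \<bullet> g x)" for x
  define s' where "s' n x = s n x * indicator (- N) x" for n x
  have s'm[measurable]: "s' n \<in> borel_measurable lebesgue" for n
  proof -
    have "s n \<in> borel_measurable lebesgue" by (rule measurable_completion) simp
    moreover have "- N \<in> sets lebesgue" using Ns by (simp add: Compl_eq_Diff_UNIV sets.Diff)
    ultimately show ?thesis unfolding s'_def by (intro borel_measurable_times borel_measurable_indicator)
  qed
  have s'lim: "(\<lambda>n. s' n x) \<longlonglongrightarrow> G x" for x
    using slim[of x] by (auto simp: s'_def G_def)
  have Gm: "G \<in> borel_measurable lebesgue"
    by (rule borel_measurable_LIMSEQ_real[where u = s']) (use s'lim s'm in auto)
  define w where "w x = \<bar>L\<bar> * norm \<zeta> * indicator (ball c (r + 1)) x" for x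
  have "emeasure lebesgue (ball c (r + 1)) < \<infinity>"
    using emeasure_lborel_ball_finite[of c "r + 1"] by simp
  then have w: "integrable lebesgue w"
    unfolding w_def by (intro integrable_mult_right integrable_real_indicator) simp_all
  have bound: "AE x in lebesgue. norm (s' n x) \<le> w x" for n
  proof (rule AE_I2)
    fix x
    show "norm (s' n x) \<le> w x"
    proof (cases "x \<in> ball c (r + 1)")
      case True
      have "\<bar>f (h n *\<^sub>R \<zeta> + x) - f x\<bar> \<le> L * norm (h n *\<^sub>R \<zeta>)"
        using lip[of "h n *\<^sub>R \<zeta> + x" x] h[of n] by simp
      also have "\<dots> \<le> \<bar>L\<bar> * norm \<zeta> * h n" using h(1)[of n] by (simp add: mult_right_mono)
      finally have "\<bar>s n x\<bar> \<le> \<bar>L\<bar> * norm \<zeta>" using h(1)[of n] by (simp add: s_def field_simps)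
      then show ?thesis using True by (auto simp: s'_def w_def indicator_def)
    next
      case False
      have "h n *\<^sub>R \<zeta> + x \<notin> ball c r"
      proof
        assume "h n *\<^sub>R \<zeta> + x \<in> ball c r"
        moreover have "dist c x \<le> dist c (h n *\<^sub>R \<zeta> + x) + dist (h n *\<^sub>R \<zeta> + x) x" by (rule dist_triangle)
        ultimately show False using False h[of n] by (auto simp: dist_norm)
      qed
      moreover have "x \<notin> ball c r" using False by auto
      ultimately have "s n x = 0" using supp by (simp add: s_def)
      then show ?thesis using False by (simp add: s'_def w_def)
    qed
  qed
  have AElim: "AE x in lebesgue. (\<lambda>n. s' n x) \<longlonglongrightarrow> G x" using s'lim by simp
  have lims: "(\<lambda>n. integral\<^sup>L lebesgue (s' n)) \<longlonglongrightarrow> integral\<^sup>L lebesgue G"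
    by (rule integral_dominated_convergence[OF Gm s'm w AElim bound])
  have Gi: "integrable lebesgue G"
    by (rule integrable_dominated_convergence[OF Gm s'm w AElim bound])
  have "integral\<^sup>L lebesgue (s' n) = 0" for n
  proof -
    have "AE x in lebesgue. x \<notin> N" using N by (simp add: negligible_iff_null_sets AE_not_in)
    then have "AE x in lebesgue. s' n x = s n x" by (rule eventually_mono) (simp add: s'_def)
    moreover have "s n \<in> borel_measurable lebesgue" by (rule measurable_completion) simp
    ultimately have "integral\<^sup>L lebesgue (s' n) = integral\<^sup>L lebesgue (s n)"
      by (intro integral_cong_AE s'm)
    also have "\<dots> = integral\<^sup>L lborel (s n)" by (rule integral_completion) simp
    also have "\<dots> = 0" unfolding s_def using shift fint by simp
    finally show ?thesis .
  qed
  with lims have "integral\<^sup>L lebesgue G = 0" by (simp add: LIMSEQ_const_iff)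
  moreover have "G = (\<lambda>x. \<zeta> \<bullet> g x)" using gN by (auto simp: G_def fun_eq_iff)
  ultimately show "integrable lebesgue (\<lambda>x. \<zeta> \<bullet> g x)" "(\<integral>x. \<zeta> \<bullet> g x \<partial>lebesgue) = 0"
    using Gi by auto
qed

section \<open>Vertical deformations\<close>

lemma e_n_simps [simp]: "fst e_n = 0" "snd e_n = 1" "norm e_n = 1" "e_n \<bullet> x = snd x" "x \<bullet> e_n = snd x"
  by (simp_all add: e_n_def norm_Pair inner_prod_def)

lemma abs_snd_le_norm: "\<bar>snd x\<bar> \<le> norm (x :: 'm::finite pt)"
  using norm_snd_le[of "snd x" "fst x"] by simp

text \<open>
  Completeness of Lebesgue measure.  It is needed because \<open>partial_n\<close> and \<open>grad\<close> take unspecified values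
  where a function is not differentiable.
\<close>

lemma lebesgue_measurable_off_negligible:
  fixes f g :: "'a::euclidean_space \<Rightarrow> 'b::topological_space"
  assumes g: "g \<in> borel_measurable lebesgue" and N: "negligible N" and eq: "\<And>x. x \<notin> N \<Longrightarrow> f x = g x"
  shows "f \<in> borel_measurable lebesgue"
proof (rule measurableI)
  fix A :: "'b set" assume A: "A \<in> sets borel"
  have split: "f -` A = (g -` A - N) \<union> (f -` A \<inter> N)" using eq by auto
  have "g -` A \<in> sets lebesgue" using measurable_sets[OF g A] by simp
  moreover have "N \<in> sets lebesgue" "f -` A \<inter> N \<in> sets lebesgue"
    using N negligible_subset[of N "f -` A \<inter> N"] by (auto simp: negligible_iff_null_sets null_setsD2)
  then have "(g -` A - N) \<union> (f -` A \<inter> N) \<in> sets lebesgue"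
    using \<open>g -` A \<in> sets lebesgue\<close> by (intro sets.Un sets.Diff)
  with split have "f -` A \<in> sets lebesgue" by (rule ssubst)
  then show "f -` A \<inter> space lebesgue \<in> sets lebesgue" by simp
qed simp

lemma partial_n_eq:
  assumes "GDERIV f x :> D"
  shows "partial_n f x = snd D"
proof -
  have l: "((\<lambda>t. x + t *\<^sub>R e_n) has_derivative (\<lambda>t. t *\<^sub>R e_n)) (at 0)"
    by (auto intro!: derivative_eq_intros)
  have "(f has_derivative (\<lambda>h. h \<bullet> D)) (at (x + 0 *\<^sub>R e_n))" using assms by (simp add: gderiv_def)
  from has_derivative_compose[OF l this]
  have "((\<lambda>t. f (x + t *\<^sub>R e_n)) has_real_derivative snd D) (at 0)"
    unfolding has_field_derivative_def by (simp add: mult_commute_abs)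
  then show ?thesis unfolding partial_n_def by (rule DERIV_imp_deriv)
qed

lemma lipschitz_deformationI:
  fixes \<psi> :: "'m::finite pt \<Rightarrow> real"
  assumes lip: "K-lipschitz_on UNIV \<psi>" and supp: "\<And>x. \<psi> x \<noteq> 0 \<Longrightarrow> x \<in> cball c r" and sub: "cball c r \<subseteq> ball 0 R"
    and N: "negligible N" "closed N" and D: "\<And>x. x \<notin> N \<Longrightarrow> GDERIV \<psi> x :> D x" "continuous_on (- N) D"
    and bd: "\<And>x. x \<notin> N \<Longrightarrow> \<bar>snd (D x)\<bar> \<le> b" "b < 1"
    and v: "\<And>x. x \<in> cylinder U \<Longrightarrow> v x = u (x + \<psi> x *\<^sub>R e_n)"
  shows "lipschitz_deformation U R u v"
  unfolding lipschitz_deformation_def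
proof (intro exI[of _ \<psi>] conjI ballI)
  show "\<exists>L. L-lipschitz_on UNIV \<psi>" using lip by blast
  have "closure {x. \<psi> x \<noteq> 0} \<subseteq> cball c r" using supp by (intro closure_minimal) auto
  then show "compact (closure {x. \<psi> x \<noteq> 0})" "closure {x. \<psi> x \<noteq> 0} \<subseteq> ball 0 R"
    using sub by (auto simp: compact_eq_bounded_closed intro: bounded_subset[OF bounded_cball[of c r]])
  have pn: "partial_n \<psi> x = snd (D x)" if "x \<notin> N" for x using partial_n_eq D(1)[OF that] by blast
  have "(\<lambda>x. indicator (- N) x *\<^sub>R snd (D x)) \<in> borel_measurable borel"
    using N D(2) by (intro borel_measurable_continuous_on_indicator continuous_on_snd) auto
  then have "(\<lambda>x. indicator (- N) x *\<^sub>R snd (D x)) \<in> borel_measurable lebesgue"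
    by (intro measurable_completion) simp
  then have "partial_n \<psi> \<in> borel_measurable lebesgue"
    using N(1) by (rule lebesgue_measurable_off_negligible) (simp add: pn)
  then have "(\<lambda>x. ereal \<bar>partial_n \<psi> x\<bar>) \<in> borel_measurable lebesgue" by measurable
  moreover have "AE x in lebesgue. x \<notin> N" using N by (simp add: negligible_iff_null_sets AE_not_in)
  then have "AE x in lebesgue. ereal \<bar>partial_n \<psi> x\<bar> \<le> ereal b"
    by (rule eventually_mono) (simp add: pn bd)
  ultimately have "esssup lebesgue (\<lambda>x. ereal \<bar>partial_n \<psi> x\<bar>) \<le> ereal b" by (rule esssup_I)
  also have "\<dots> < 1" using bd(2) by (simp add: one_ereal_def)
  finally show "esssup lebesgue (\<lambda>x. ereal \<bar>partial_n \<psi> x\<bar>) < 1" .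
qed (use v in auto)

text \<open>
  The deformation is the composition with \<open>shift\<close>, the inverse of the explicit map
  \<open>unshift y = y - \<eta>(y) e_n\<close>.  In the variable \<open>y\<close> the deformed integrand is explicit, the Jacobian \<open>jac\<close> is
  affine in \<open>D\<eta>\<close>, and so the change of sign of \<open>\<eta>\<close> cancels the first-order terms of the energy exactly;
  composing with \<open>x + \<eta>(x) e_n\<close> directly would leave terms of second order.  The bound \<open>1/4\<close> makes
  \<open>x + \<eta>(\<cdot>) e_n\<close> a contraction, whose fixed point is \<open>shift x\<close>, and makes the displacement of the gradient small
  enough for the doubling condition on \<open>F_pp\<close>.
\<close>

locale vertical_shift =
  fixes \<eta> :: "'m::finite pt \<Rightarrow> real" and D\<eta> :: "'m pt \<Rightarrow> 'm pt" and r :: real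
  assumes der: "\<And>y. GDERIV \<eta> y :> D\<eta> y"
    and cont_der: "continuous_on UNIV D\<eta>"
    and small: "\<And>y. norm (D\<eta> y) \<le> 1 / 4"
    and supp: "\<And>y. y \<notin> cball 0 r \<Longrightarrow> \<eta> y = 0"
begin

definition unshift :: "'m pt \<Rightarrow> 'm pt" where "unshift y = y - \<eta> y *\<^sub>R e_n"

definition shift :: "'m pt \<Rightarrow> 'm pt" where "shift x = (THE y. x + \<eta> y *\<^sub>R e_n = y)"

definition jac :: "'m pt \<Rightarrow> real" where "jac y = 1 - snd (D\<eta> y)"

lemma eta_lipschitz: "\<bar>\<eta> x - \<eta> y\<bar> \<le> norm (x - y) / 4"
proof -
  have "norm (\<eta> x - \<eta> y) \<le> (1/4) * norm (x - y)"
  proof (rule differentiable_bound[where S = UNIV and f' = "\<lambda>x h. h \<bullet> D\<eta> x"])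
    show "onorm (\<lambda>h. h \<bullet> D\<eta> z) \<le> 1/4" for z
    proof (rule onorm_bound)
      show "norm (h \<bullet> D\<eta> z) \<le> 1/4 * norm h" for h
        using Cauchy_Schwarz_ineq2[of h "D\<eta> z"] mult_left_mono[OF small[of z] norm_ge_zero[of h]] by simp
    qed simp
  qed (use der in \<open>auto simp: gderiv_def\<close>)
  then show ?thesis by simp
qed

lemma continuous_eta: "continuous_on S \<eta>"
  using der by (intro continuous_at_imp_continuous_on ballI GDERIV_imp_isCont)

lemma jac_bounds: "3/4 \<le> jac y" "jac y \<le> 5/4"
  using small[of y] abs_snd_le_norm[of "D\<eta> y"] by (auto simp: jac_def)

lemma jac_pos: "0 < jac y" using jac_bounds(1)[of y] by linarith

lemma shift_ex1: "\<exists>!y. x + \<eta> y *\<^sub>R e_n = y"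
proof (rule banach_fix_type[of "1/4"])
  show "\<forall>a b. dist (x + \<eta> a *\<^sub>R e_n) (x + \<eta> b *\<^sub>R e_n) \<le> 1/4 * dist a b"
    using eta_lipschitz by (simp add: dist_norm flip: scaleR_diff_left)
qed auto

lemma shift: "x + \<eta> (shift x) *\<^sub>R e_n = shift x"
  unfolding shift_def by (rule theI'[OF shift_ex1])

lemma shift_unique: "x + \<eta> y *\<^sub>R e_n = y \<Longrightarrow> shift x = y"
  using shift shift_ex1 by blast

lemma unshift_shift [simp]: "unshift (shift x) = x"
  unfolding unshift_def using shift[of x] by (simp add: algebra_simps)

lemma shift_unshift [simp]: "shift (unshift y) = y"
  by (rule shift_unique) (simp add: unshift_def)

lemma fst_shift [simp]: "fst (shift x) = fst x"
  by (subst shift[symmetric]) simp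

lemma fst_unshift [simp]: "fst (unshift x) = fst x"
  by (simp add: unshift_def)

lemma shift_cylinder [simp]: "shift x \<in> cylinder U \<longleftrightarrow> x \<in> cylinder U"
  by (cases "shift x"; cases x) (use fst_shift[of x] in \<open>auto simp: cylinder_def\<close>)

lemma shift_lipschitz: "norm (shift x - shift y) \<le> 4/3 * norm (x - y)"
proof -
  have "norm (shift x - shift y) = norm ((x - y) + (\<eta> (shift x) - \<eta> (shift y)) *\<^sub>R e_n)"
    by (subst (1 2) shift[symmetric]) (simp add: algebra_simps)
  also have "\<dots> \<le> norm (x - y) + \<bar>\<eta> (shift x) - \<eta> (shift y)\<bar>"
    by (rule order_trans[OF norm_triangle_ineq]) simp
  also have "\<dots> \<le> norm (x - y) + norm (shift x - shift y) / 4"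
    using eta_lipschitz by (intro add_left_mono)
  finally show ?thesis by simp
qed

lemma continuous_shift: "continuous_on S shift"
proof -
  have "(4/3)-lipschitz_on UNIV shift"
    using shift_lipschitz by (auto simp: lipschitz_on_def dist_norm)
  then show ?thesis using lipschitz_on_continuous_on continuous_on_subset by blast
qed

lemma shift_outside: "x \<notin> cball 0 r \<Longrightarrow> shift x = x"
  by (rule shift_unique) (simp add: supp)

lemma unshift_outside: "x \<notin> cball 0 r \<Longrightarrow> unshift x = x"
  by (simp add: unshift_def supp)

lemma shift_in_ball: "r \<le> R \<Longrightarrow> shift x \<in> cball 0 R \<longleftrightarrow> x \<in> cball 0 R"
proof -
  assume "r \<le> R"
  then have sub: "cball 0 r \<subseteq> cball (0::'m pt) R" by auto
  show ?thesis
  proof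
    assume "x \<in> cball 0 R"
    show "shift x \<in> cball 0 R"
    proof (rule ccontr)
      assume n: "shift x \<notin> cball 0 R"
      then have "unshift (shift x) = shift x" using sub by (intro unshift_outside) auto
      then show False using n \<open>x \<in> cball 0 R\<close> by simp
    qed
  next
    assume "shift x \<in> cball 0 R" then show "x \<in> cball 0 R"
      using shift_outside[of x] sub by (cases "x \<in> cball 0 r") auto
  qed
qed

lemma shift_in_open_ball: "r < R \<Longrightarrow> shift x \<in> ball 0 R \<longleftrightarrow> x \<in> ball 0 R"
  using shift_in_ball[of r x] shift_outside[of x] by (cases "x \<in> cball 0 r") auto

lemma shift_has_derivative:
  "(shift has_derivative (\<lambda>h. h + ((h \<bullet> D\<eta> (shift x)) / jac (shift x)) *\<^sub>R e_n)) (at x)"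
proof (rule has_derivative_inverse_basic[where f = unshift and T = UNIV])
  let ?D = "D\<eta> (shift x)"
  have "(\<eta> has_derivative (\<lambda>h. h \<bullet> ?D)) (at (shift x))" using der by (simp add: gderiv_def)
  then show "(unshift has_derivative (\<lambda>h. h - (h \<bullet> ?D) *\<^sub>R e_n)) (at (shift x))"
    unfolding unshift_def by (auto intro!: derivative_eq_intros)
  show "bounded_linear (\<lambda>h. h + (h \<bullet> ?D / jac (shift x)) *\<^sub>R e_n)"
    by (intro bounded_linear_add bounded_linear_ident bounded_linear_scaleR_left[THEN bounded_linear_compose]
        bounded_linear_compose[OF bounded_linear_divide] bounded_linear_inner_left)
  show "(\<lambda>h. h + (h \<bullet> ?D / jac (shift x)) *\<^sub>R e_n) \<circ> (\<lambda>h. h - (h \<bullet> ?D) *\<^sub>R e_n) = id"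
  proof
    fix h
    have "((h - (h \<bullet> ?D) *\<^sub>R e_n) \<bullet> ?D) = (h \<bullet> ?D) * jac (shift x)"
      by (simp add: inner_diff_left jac_def algebra_simps)
    then show "((\<lambda>h. h + (h \<bullet> ?D / jac (shift x)) *\<^sub>R e_n) \<circ> (\<lambda>h. h - (h \<bullet> ?D) *\<^sub>R e_n)) h = id h"
      using jac_pos[of "shift x"] by simp
  qed
  show "isCont shift x" using continuous_shift[of UNIV] by (simp only: continuous_on_eq_continuous_at[OF open_UNIV] UNIV_I ball_UNIV)
qed auto

lemma GDERIV_comp_shift:
  assumes "GDERIV u (shift x) :> p"
  shows "GDERIV (\<lambda>x. u (shift x)) x :> p + (snd p / jac (shift x)) *\<^sub>R D\<eta> (shift x)"
proof -
  have "((\<lambda>x. u (shift x)) has_derivative (\<lambda>h. (h + ((h \<bullet> D\<eta> (shift x)) / jac (shift x)) *\<^sub>R e_n) \<bullet> p)) (at x)"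
    using assms unfolding gderiv_def by (rule has_derivative_compose[OF shift_has_derivative])
  then show ?thesis unfolding gderiv_def by (simp add: algebra_simps inner_add_left inner_add_right)
qed

lemma GDERIV_eta_shift: "GDERIV (\<lambda>x. \<eta> (shift x)) x :> (1 / jac (shift x)) *\<^sub>R D\<eta> (shift x)"
proof -
  let ?y = "shift x"
  have "D\<eta> ?y + (snd (D\<eta> ?y) / jac ?y) *\<^sub>R D\<eta> ?y = (1 + snd (D\<eta> ?y) / jac ?y) *\<^sub>R D\<eta> ?y"
    by (simp add: scaleR_add_left)
  also have "1 + snd (D\<eta> ?y) / jac ?y = 1 / jac ?y"
    using jac_pos[of ?y] by (simp add: field_simps) (simp add: jac_def)
  finally show ?thesis using GDERIV_comp_shift[OF der, of x] by simp
qed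

lemma continuous_jac: "continuous_on S jac"
  unfolding jac_def by (intro continuous_intros continuous_on_subset[OF cont_der]) auto

text \<open>
  The displacement is the function \<open>\<eta>(shift x)\<close>, with vertical derivative \<open>D\<eta>_n / (1 - D\<eta>_n)\<close>, at most \<open>1/3\<close> in absolute value.
\<close>

lemma comp_shift_lipschitz_deformation:
  assumes "r < R"
  shows "lipschitz_deformation U R u (\<lambda>x. u (shift x))"
proof (rule lipschitz_deformationI[where \<psi> = "\<lambda>x. \<eta> (shift x)" and N = "{}" and K = "1/3" and b = "1/3"])
  show "(1/3)-lipschitz_on UNIV (\<lambda>x. \<eta> (shift x))"
    unfolding lipschitz_on_def
  proof (intro conjI ballI)
    fix x y
    have "\<bar>\<eta> (shift x) - \<eta> (shift y)\<bar> \<le> norm (shift x - shift y) / 4" by (rule eta_lipschitz)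
    also have "\<dots> \<le> 1/3 * norm (x - y)" using shift_lipschitz[of x y] by simp
    finally show "dist (\<eta> (shift x)) (\<eta> (shift y)) \<le> 1/3 * dist x y" by (simp add: dist_norm)
  qed simp
  show "x \<in> cball 0 r" if "\<eta> (shift x) \<noteq> 0" for x
    using that supp[of "shift x"] shift_in_ball[of r x] by auto
  show "cball 0 r \<subseteq> ball (0::'m pt) R" using assms by auto
  show "GDERIV (\<lambda>x. \<eta> (shift x)) x :> (1 / jac (shift x)) *\<^sub>R D\<eta> (shift x)" for x by (rule GDERIV_eta_shift)
  show "continuous_on (- {}) (\<lambda>x. (1 / jac (shift x)) *\<^sub>R D\<eta> (shift x))"
    using jac_pos[THEN less_imp_neq, THEN not_sym]
    by (intro continuous_intros continuous_on_compose2[OF continuous_jac[of UNIV] continuous_shift]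
        continuous_on_compose2[OF cont_der continuous_shift]) auto
  show "\<bar>snd ((1 / jac (shift x)) *\<^sub>R D\<eta> (shift x))\<bar> \<le> 1/3" for x
    using small[of "shift x"] abs_snd_le_norm[of "D\<eta> (shift x)"] jac_bounds(1)[of "shift x"]
    by (simp add: abs_mult field_simps)
  show "u (shift x) = u (x + \<eta> (shift x) *\<^sub>R e_n)" for x by (simp add: shift)
qed auto

text \<open>
  On each vertical line \<open>unshift\<close> is an increasing change of variable in one dimension that fixes the end
  points of a long interval; Fubini puts the lines together.
\<close>

lemma nn_integral_unshift:
  fixes h :: "'m pt \<Rightarrow> ennreal"
  assumes h[measurable]: "h \<in> borel_measurable borel" and R: "r < R" and hs: "\<And>x. x \<notin> ball 0 R \<Longrightarrow> h x = 0"
  shows "(\<integral>\<^sup>+x. h x \<partial>lborel) = (\<integral>\<^sup>+y. h (unshift y) * ennreal (jac y) \<partial>lborel)"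
proof (cases "R > 0")
  case False
  then have "ball (0 :: 'm pt) R = {}" by simp
  then have "h x = 0" for x using hs[of x] by (metis empty_iff)
  then show ?thesis by simp
next
  case R0: True
  have jm[measurable]: "jac \<in> borel_measurable borel"
    by (rule borel_measurable_continuous_onI[OF continuous_jac])
  have bm[measurable]: "unshift \<in> borel_measurable borel"
    unfolding unshift_def using continuous_eta by (intro borel_measurable_continuous_onI continuous_intros)
  have fiber: "(\<integral>\<^sup>+s. h (x, s) \<partial>lborel) = (\<integral>\<^sup>+s. h (unshift (x, s)) * ennreal (jac (x, s)) \<partial>lborel)" for x
  proof -
    define g where "g s = s - \<eta> (x, s)" for s
    have gb: "unshift (x, s) = (x, g s)" for s by (simp add: unshift_def g_def e_n_def)
    have out: "(x, s) \<notin> ball 0 R" if "R \<le> \<bar>s\<bar>" for s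
      using that abs_snd_le_norm[of "(x, s)"] by auto
    have out': "(x, s) \<notin> cball 0 r" if "R \<le> \<bar>s\<bar>" for s
      using that R abs_snd_le_norm[of "(x, s)"] by auto
    have dg: "(g has_real_derivative jac (x, s)) (at s)" for s
    proof -
      have "(\<eta> has_derivative (\<lambda>h. h \<bullet> D\<eta> (x, s))) (at (x, s))" using der by (simp add: gderiv_def)
      moreover have "((\<lambda>s. (x, s)) has_derivative (\<lambda>t. (0, t))) (at s)"
        by (auto intro!: derivative_eq_intros)
      ultimately have "((\<lambda>s. \<eta> (x, s)) has_derivative (\<lambda>t. (0, t) \<bullet> D\<eta> (x, s))) (at s)"
        using has_derivative_compose by blast
      then have "((\<lambda>s. \<eta> (x, s)) has_real_derivative snd (D\<eta> (x, s))) (at s)"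
        unfolding has_field_derivative_def by (simp add: inner_prod_def mult_commute_abs)
      then show ?thesis unfolding g_def jac_def by (auto intro!: derivative_eq_intros)
    qed
    have m1: "(\<lambda>s. h (x, s)) \<in> borel_measurable borel" by measurable
    have gR: "g R = R" "g (- R) = - R" using out'[of R] out'[of "- R"] supp R0 by (auto simp: g_def)
    have "(\<integral>\<^sup>+s. h (x, s) \<partial>lborel) = (\<integral>\<^sup>+s. h (x, s) * indicator {g (- R)..g R} s \<partial>lborel)"
      using out hs by (intro nn_integral_cong) (auto simp: gR indicator_def)
    also have "\<dots> = (\<integral>\<^sup>+s. h (x, g s) * ennreal (jac (x, s)) * indicator {- R..R} s \<partial>lborel)"
    proof (rule nn_integral_substitution_aux[OF m1])
      show "continuous_on {- R..R} (\<lambda>s. jac (x, s))"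
        by (intro continuous_on_compose2[OF continuous_jac[of UNIV]] continuous_intros) auto
    qed (use dg jac_pos R0 in \<open>auto intro: less_imp_le\<close>)
    also have "\<dots> = (\<integral>\<^sup>+s. h (unshift (x, s)) * ennreal (jac (x, s)) \<partial>lborel)"
    proof (rule nn_integral_cong)
      fix s
      show "h (x, g s) * ennreal (jac (x, s)) * indicator {- R..R} s = h (unshift (x, s)) * ennreal (jac (x, s))"
      proof (cases "s \<in> {- R..R}")
        case False
        then have "R \<le> \<bar>s\<bar>" by auto
        then have "unshift (x, s) = (x, s)" "h (x, s) = 0" using out out' hs unshift_outside by auto
        then show ?thesis using False by simp
      qed (simp add: gb)
    qed
    finally show ?thesis .
  qed
  have "(\<integral>\<^sup>+x. h x \<partial>lborel) = (\<integral>\<^sup>+x. \<integral>\<^sup>+s. h (x, s) \<partial>lborel \<partial>lborel)"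
    using lborel.nn_integral_fst[of h lborel] by (simp add: lborel_prod)
  also have "\<dots> = (\<integral>\<^sup>+x. \<integral>\<^sup>+s. h (unshift (x, s)) * ennreal (jac (x, s)) \<partial>lborel \<partial>lborel)"
    by (simp add: fiber)
  also have "\<dots> = (\<integral>\<^sup>+y. h (unshift y) * ennreal (jac y) \<partial>lborel)"
    using lborel.nn_integral_fst[of "\<lambda>y. h (unshift y) * ennreal (jac y)" lborel] by (simp add: lborel_prod)
  finally show ?thesis .
qed

end

section \<open>Convex integrands, and crossings on a line\<close>

lemma C2_on_line_derivatives:
  fixes f :: "'a::euclidean_space \<Rightarrow> real"
  assumes S: "open S" and C2: "C2_on S f" and x: "p + s *\<^sub>R q \<in> S"
  shows "((\<lambda>s. f (p + s *\<^sub>R q)) has_real_derivative q \<bullet> grad f (p + s *\<^sub>R q)) (at s)"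
    and "((\<lambda>s. q \<bullet> grad f (p + s *\<^sub>R q)) has_real_derivative q \<bullet> hess f (p + s *\<^sub>R q) q) (at s)"
    and "bounded_linear (hess f (p + s *\<^sub>R q))"
proof -
  let ?x = "p + s *\<^sub>R q"
  have l: "((\<lambda>s. p + s *\<^sub>R q) has_derivative (\<lambda>t. t *\<^sub>R q)) (at s)"
    by (auto intro!: derivative_eq_intros)
  have "GDERIV f ?x :> grad f ?x" using C2 x by (intro GDERIV_grad) (auto simp: C2_on_def)
  then have "(f has_derivative (\<lambda>h. h \<bullet> grad f ?x)) (at ?x)" by (simp add: gderiv_def)
  from has_derivative_compose[OF l this]
  show "((\<lambda>s. f (p + s *\<^sub>R q)) has_real_derivative q \<bullet> grad f ?x) (at s)"
    unfolding has_field_derivative_def by (simp add: mult_commute_abs)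
  have "\<forall>\<^sub>F y in nhds ?x. f differentiable (at y)"
    using eventually_nhds_in_open[OF S x] C2 by (auto simp: C2_on_def elim: eventually_mono)
  moreover have d: "grad f differentiable (at ?x)" using C2 x by (auto simp: C2_on_def)
  ultimately have "hess f ?x = frechet_derivative (grad f) (at ?x)" by (simp add: hess_def)
  with d have h: "(grad f has_derivative hess f ?x) (at ?x)" by (simp add: frechet_derivative_works)
  then show bl: "bounded_linear (hess f ?x)" by (rule has_derivative_bounded_linear)
  have "((\<lambda>s. q \<bullet> grad f (p + s *\<^sub>R q)) has_derivative (\<lambda>t. q \<bullet> hess f ?x (t *\<^sub>R q))) (at s)"
    by (intro has_derivative_inner_right has_derivative_compose[OF l h])
  then show "((\<lambda>s. q \<bullet> grad f (p + s *\<^sub>R q)) has_real_derivative q \<bullet> hess f ?x q) (at s)"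
    unfolding has_field_derivative_def
    using linear_cmul[OF bounded_linear.linear[OF bl]] by (simp add: mult_commute_abs)
qed

lemma C2_on_quadratic_upper_bound:
  fixes f :: "'a::euclidean_space \<Rightarrow> real"
  assumes S: "open S" and C2: "C2_on S f"
    and seg: "\<And>s. 0 \<le> s \<Longrightarrow> s \<le> 1 \<Longrightarrow> p + s *\<^sub>R q \<in> S \<and> onorm (hess f (p + s *\<^sub>R q)) \<le> B"
  shows "f (p + q) \<le> f p + q \<bullet> grad f p + B * (norm q)\<^sup>2 / 2"
proof -
  define diff where "diff m s = (if m = 0 then f (p + s *\<^sub>R q) else if m = 1 then q \<bullet> grad f (p + s *\<^sub>R q)
      else q \<bullet> hess f (p + s *\<^sub>R q) q)" for m :: nat and s :: real
  have d: "\<forall>m t. m < 2 \<and> 0 \<le> t \<and> t \<le> 1 \<longrightarrow> DERIV (diff m) t :> diff (Suc m) t"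
  proof (intro allI impI)
    fix m :: nat and t :: real assume mt: "m < 2 \<and> 0 \<le> t \<and> t \<le> 1"
    then have "p + t *\<^sub>R q \<in> S" using seg by blast
    note D = C2_on_line_derivatives(1,2)[OF S C2 this]
    have e: "diff 0 = (\<lambda>s. f (p + s *\<^sub>R q))" "diff (Suc 0) = (\<lambda>s. q \<bullet> grad f (p + s *\<^sub>R q))"
      "diff (Suc (Suc 0)) = (\<lambda>s. q \<bullet> hess f (p + s *\<^sub>R q) q)"
      by (simp_all add: diff_def fun_eq_iff)
    have "m = 0 \<or> m = Suc 0" using mt by linarith
    then show "DERIV (diff m) t :> diff (Suc m) t"
    proof
      assume "m = 0" show ?thesis unfolding \<open>m = 0\<close> e by (rule D(1))
    next
      assume "m = Suc 0" show ?thesis unfolding \<open>m = Suc 0\<close> e by (rule D(2))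
    qed
  qed
  obtain t where t: "0 < t" "t < 1"
    "diff 0 1 = (\<Sum>m<2. diff m 0 / fact m * 1 ^ m) + diff 2 t / fact 2 * 1 ^ 2"
    using Maclaurin[OF _ _ _ d, of "diff 0"] by auto
  have "q \<bullet> hess f (p + t *\<^sub>R q) q \<le> norm q * norm (hess f (p + t *\<^sub>R q) q)"
    by (rule norm_cauchy_schwarz)
  also have "\<dots> \<le> norm q * (onorm (hess f (p + t *\<^sub>R q)) * norm q)"
    using C2_on_line_derivatives(3)[OF S C2, of p t q] seg[of t] t by (intro mult_left_mono onorm) auto
  also have "\<dots> \<le> norm q * (B * norm q)"
    using seg[of t] t by (intro mult_left_mono mult_right_mono) auto
  finally have "diff 2 t \<le> B * (norm q)\<^sup>2" by (simp add: diff_def power2_eq_square mult_ac)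
  with t(3) show ?thesis by (simp add: diff_def numeral_2_eq_2)
qed

text \<open>
  Uniform convexity at \<open>r\<close> gives the strict inequality at points near \<open>r\<close> on the segment
  to \<open>y\<close>, and convexity would force equality there if it held at \<open>y\<close>.
\<close>

lemma convex_strictly_above_tangent:
  fixes f :: "'a::euclidean_space \<Rightarrow> real"
  assumes S: "open S" and C2: "C2_on S f" and cvx: "convex_on UNIV f"
    and r: "r \<in> S" and uc: "uniformly_convex_at f r" and y: "y \<noteq> r"
  shows "f r + (y - r) \<bullet> grad f r < f y"
proof (rule ccontr)
  assume "\<not> ?thesis"
  then have le: "f y \<le> f r + (y - r) \<bullet> grad f r" by simp
  define q where "q = y - r"
  have q0: "q \<noteq> 0" using y by (simp add: q_def)
  have "open ((\<lambda>s. r + s *\<^sub>R q) -` S)" using S by (intro open_vimage continuous_intros)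
  moreover have "0 \<in> (\<lambda>s. r + s *\<^sub>R q) -` S" using r by simp
  ultimately obtain \<delta> where "\<delta> > 0" and sub: "ball 0 \<delta> \<subseteq> (\<lambda>s. r + s *\<^sub>R q) -` S"
    using open_contains_ball by metis
  have \<delta>: "\<delta> > 0" "r + s *\<^sub>R q \<in> S" if "\<bar>s\<bar> < \<delta>" for s
    using \<open>\<delta> > 0\<close> subsetD[OF sub, of s] that by simp_all
  obtain l where "l > 0" "l * (norm q)\<^sup>2 \<le> q \<bullet> hess f r q"
    using uc unfolding uniformly_convex_at_def by blast
  moreover have "0 < l * (norm q)\<^sup>2" using q0 \<open>l > 0\<close> by simp
  ultimately have pos: "0 < q \<bullet> hess f r q" by linarith
  define k' where "k' s = q \<bullet> grad f (r + s *\<^sub>R q)" for s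
  have "DERIV k' 0 :> q \<bullet> hess f r q"
    unfolding k'_def using C2_on_line_derivatives(2)[OF S C2, of r 0 q] r by simp
  from DERIV_pos_inc_right[OF this pos]
  obtain d where d: "d > 0" "\<And>h. 0 < h \<Longrightarrow> h < d \<Longrightarrow> k' 0 < k' h" by auto
  define s where "s = min (min \<delta> d) 1 / 2"
  have s: "0 < s" "s < \<delta>" "s < d" "s < 1" using \<open>\<delta> > 0\<close> d(1) by (auto simp: s_def)
  have "((\<lambda>s. f (r + s *\<^sub>R q)) has_real_derivative k' x) (at x)" if "0 \<le> x" "x \<le> s" for x
    unfolding k'_def by (rule C2_on_line_derivatives(1)[OF S C2 \<delta>(2)]) (use that s in simp)
  from MVT2[OF s(1) this]
  obtain z where z: "0 < z" "z < s" and z3: "f (r + s *\<^sub>R q) - f r = s * k' z" by auto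
  have "f (r + s *\<^sub>R q) = f ((1 - s) *\<^sub>R r + s *\<^sub>R y)" by (simp add: q_def algebra_simps)
  also have "\<dots> \<le> (1 - s) * f r + s * f y" using convex_onD[OF cvx, of s r y] s by simp
  also have "\<dots> \<le> (1 - s) * f r + s * (f r + k' 0)"
    using le s by (intro add_left_mono mult_left_mono) (auto simp: k'_def q_def)
  finally have "f (r + s *\<^sub>R q) \<le> f r + s * k' 0" by (simp add: algebra_simps)
  moreover have "s * k' 0 < s * k' z" by (rule mult_strict_left_mono[OF d(2)]) (use z s in simp_all)
  ultimately show False using z3 by linarith
qed

text \<open>
  The first return to the level \<open>f a\<close> comes from above.
\<close>

text \<open>
  Reflections of the line and of the values reduce every configuration to \<open>line_crossing_aux\<close>, started
  at whichever of \<open>a\<close> and \<open>b\<close> has the level to which the function returns.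
\<close>

lemma line_crossing_aux:
  fixes f :: "real \<Rightarrow> real"
  assumes der: "\<And>x. (f has_real_derivative f' x) (at x)"
    and ab: "a < b" "f b \<le> f a" and pos: "f' a > 0"
  shows "\<exists>c>a. f c = f a \<and> f' c \<le> 0"
proof -
  have cont: "continuous_on S f" for S
    using der by (meson DERIV_continuous continuous_at_imp_continuous_on)
  obtain d where d: "d > 0" "\<And>h. 0 < h \<Longrightarrow> h < d \<Longrightarrow> f a < f (a + h)"
    using DERIV_pos_inc_right[OF der pos] by auto
  \<comment> \<open>A point past which returns to the level are looked for, so that \<open>a\<close> itself is excluded.\<close>
  define a1 where "a1 = a + min d (b - a) / 2"
  have a1: "a < a1" "a1 < a + d" "a1 < b" "f a < f a1"
    using d ab d(2)[of "a1 - a"] by (auto simp: a1_def min_def field_simps)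
  define Z where "Z = {x \<in> {a1..b}. f x = f a}"
  have "closed Z" unfolding Z_def
    using continuous_closed_preimage_constant[OF cont[of "{a1..b}"]] by simp
  moreover have "Z \<subseteq> {a1..b}" by (auto simp: Z_def)
  then have "bounded Z" by (rule bounded_subset[OF bounded_closed_interval])
  ultimately have "compact Z" by (simp add: compact_eq_bounded_closed)
  obtain z where "a1 \<le> z" "z \<le> b" "f z = f a"
    using IVT2'[OF ab(2) less_imp_le[OF a1(4)] less_imp_le[OF a1(3)] cont] by blast
  then have "Z \<noteq> {}" by (auto simp: Z_def)
  with \<open>compact Z\<close> obtain c where c: "c \<in> Z" "\<And>z. z \<in> Z \<Longrightarrow> c \<le> z"
    using compact_attains_inf by metis
  have above: "f a < f x" if "a < x" "x < c" for x
  proof (rule ccontr)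
    assume n: "\<not> f a < f x"
    have "a1 < x"
    proof (rule ccontr)
      assume "\<not> a1 < x"
      then show False using n d(2)[of "x - a"] that a1 by auto
    qed
    have "f x \<le> f a" using n by simp
    from IVT2'[OF this less_imp_le[OF a1(4)] less_imp_le[OF \<open>a1 < x\<close>] cont]
    obtain z where z: "a1 \<le> z" "z \<le> x" "f z = f a" by blast
    moreover have "c \<le> b" using c(1) by (simp add: Z_def)
    ultimately have "z \<in> Z" using that by (simp add: Z_def)
    then show False using c(2)[of z] z that by simp
  qed
  have "f' c \<le> 0"
  proof (rule ccontr)
    assume "\<not> ?thesis"
    then obtain e where e: "e > 0" "\<And>h. 0 < h \<Longrightarrow> h < e \<Longrightarrow> f (c - h) < f c"
      using DERIV_pos_inc_left[OF der, of c] by auto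
    have "c > a" using c a1 by (auto simp: Z_def)
    define h where "h = min e (c - a) / 2"
    have "0 < h" "h < e" "a < c - h" using e \<open>c > a\<close> by (auto simp: h_def min_def field_simps)
    then show False using e(2)[of h] above[of "c - h"] c by (auto simp: Z_def)
  qed
  then show ?thesis using c a1 by (intro exI[of _ c]) (auto simp: Z_def)
qed

lemma line_crossing:
  fixes f :: "real \<Rightarrow> real"
  assumes der: "\<And>x. (f has_real_derivative f' x) (at x)" and pos: "f' a > 0" and neg: "f' b < 0"
  shows "\<exists>s s'. f s = f s' \<and> f' s \<noteq> 0 \<and> f' s * f' s' \<le> 0"
proof -
  have main: "\<exists>s s'. f s = f s' \<and> f' s \<noteq> 0 \<and> f' s * f' s' \<le> 0"
    if der: "\<And>x. (f has_real_derivative f' x) (at x)" and pos: "f' a > 0" and neg: "f' b < 0" and ab: "a < b"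
    for f f' :: "real \<Rightarrow> real" and a b
  proof (cases "f b \<le> f a")
    case True
    from line_crossing_aux[OF der ab True pos] obtain c where "f c = f a" "f' c \<le> 0" by blast
    then show ?thesis using pos
      by (intro exI[of _ a] exI[of _ c]) (auto simp: mult_nonneg_nonpos)
  next
    case False
    have "((\<lambda>x. f (- x)) has_real_derivative - f' (- x)) (at x)" for x
      using DERIV_chain2[OF der[of "- x"] DERIV_minus[OF DERIV_ident]] by simp
    from line_crossing_aux[of "\<lambda>x. f (- x)" "\<lambda>x. - f' (- x)" "- b" "- a", OF this]
    obtain c where "f (- c) = f b" "- f' (- c) \<le> 0" using ab False neg by auto
    then show ?thesis using neg
      by (intro exI[of _ b] exI[of _ "- c"]) (auto simp: mult_nonpos_nonneg)
  qed
  have "a \<noteq> b" using pos neg by auto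
  then consider "a < b" | "b < a" by linarith
  then show ?thesis
  proof cases
    case 1
    then show ?thesis using main[of f f' a b, OF der pos neg] by simp
  next
    case 2
    have "((\<lambda>x. - f x) has_real_derivative - f' x) (at x)" for x using DERIV_minus[OF der] .
    from main[of "\<lambda>x. - f x" "\<lambda>x. - f' x" b a, OF this] pos neg 2 show ?thesis by auto
  qed
qed

section \<open>A logarithmic cutoff\<close>

definition pos_sq :: "real \<Rightarrow> real" where "pos_sq y = (max 0 y)\<^sup>2"

text \<open>
  The error of the first-order expansion is at most quadratic, whatever the signs of the two points.
\<close>

lemma pos_sq_deriv: "(pos_sq has_real_derivative 2 * max 0 y) (at y)"
proof -
  have *: "\<bar>pos_sq z - pos_sq y - 2 * max 0 y * (z - y)\<bar> \<le> (z - y)\<^sup>2" for z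
  proof -
    consider "0 \<le> y" "0 \<le> z" | "0 \<le> y" "z < 0" | "y < 0" "0 \<le> z" | "y < 0" "z < 0" by linarith
    then show ?thesis
    proof cases
      case 1
      then have "pos_sq z - pos_sq y - 2 * max 0 y * (z - y) = (z - y)\<^sup>2"
        by (simp add: pos_sq_def power2_eq_square algebra_simps)
      then show ?thesis by simp
    next
      case 2
      then have "max 0 z = 0" "max 0 y = y" by auto
      then have "pos_sq z - pos_sq y - 2 * max 0 y * (z - y) = (z - y)\<^sup>2 - z\<^sup>2"
        unfolding pos_sq_def by (simp only:) (simp add: power2_eq_square algebra_simps)
      moreover have "z\<^sup>2 \<le> (z - y)\<^sup>2" using 2 by (intro abs_le_square_iff[THEN iffD1]) auto
      ultimately show ?thesis by simp
    next
      case 3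
      then have "z\<^sup>2 \<le> (z - y)\<^sup>2" by (intro power2_le_iff_abs_le[THEN iffD2]) auto
      then show ?thesis using 3 by (simp add: pos_sq_def)
    next
      case 4
      then show ?thesis by (simp add: pos_sq_def)
    qed
  qed
  have "(pos_sq has_derivative (\<lambda>h. 2 * max 0 y * h)) (at y)"
    unfolding has_derivative_at_alt
  proof (intro conjI allI impI)
    fix e :: real assume e: "e > 0"
    show "\<exists>d>0. \<forall>z. norm (z - y) < d \<longrightarrow>
        norm (pos_sq z - pos_sq y - 2 * max 0 y * (z - y)) \<le> e * norm (z - y)"
    proof (intro exI[of _ e] conjI e allI impI)
      fix z assume "norm (z - y) < e"
      then have "norm (z - y) * norm (z - y) \<le> e * norm (z - y)" by (intro mult_right_mono) auto
      then have "(z - y)\<^sup>2 \<le> e * norm (z - y)" by (simp add: power2_eq_square)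
      with *[of z] show "norm (pos_sq z - pos_sq y - 2 * max 0 y * (z - y)) \<le> e * norm (z - y)"
        unfolding real_norm_def by linarith
    qed
  qed (rule bounded_linear_mult_right)
  then show ?thesis by (simp add: has_field_derivative_def)
qed

text \<open>
  A continuously differentiable cutoff, equal to \<open>1\<close> on \<open>s \<le> 1\<close> and to \<open>0\<close> on \<open>s \<ge> 2\<close>, to be evaluated at the squared norm divided by the squared scale.
\<close>

definition plateau :: "real \<Rightarrow> real" where "plateau s = pos_sq (1 - pos_sq (s - 1))"

definition plateau' :: "real \<Rightarrow> real" where
  "plateau' s = - (4 * max 0 (1 - pos_sq (s - 1)) * max 0 (s - 1))"

lemma plateau_deriv: "(plateau has_real_derivative plateau' s) (at s)"
proof -
  have "((\<lambda>s. pos_sq (s - 1)) has_real_derivative 2 * max 0 (s - 1) * 1) (at s)"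
    by (rule DERIV_chain2[OF pos_sq_deriv]) (auto intro!: derivative_eq_intros)
  then have "((\<lambda>s. 1 - pos_sq (s - 1)) has_real_derivative - (2 * max 0 (s - 1))) (at s)"
    by (auto intro!: derivative_eq_intros)
  from DERIV_chain2[OF pos_sq_deriv this] show ?thesis
    unfolding plateau_def plateau'_def by (simp add: algebra_simps)
qed

lemma continuous_plateau': "continuous_on S plateau'"
  unfolding plateau'_def pos_sq_def by (intro continuous_intros)

lemma plateau_eq_1: "s \<le> 1 \<Longrightarrow> plateau s = 1"
  by (simp add: plateau_def pos_sq_def)

lemma pos_sq_ge_1: "2 \<le> s \<Longrightarrow> 1 \<le> pos_sq (s - 1)"
  using power_mono[of 1 "s - 1" 2] by (simp add: pos_sq_def)

lemma plateau_eq_0: "2 \<le> s \<Longrightarrow> plateau s = 0"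
  using pos_sq_ge_1[of s] by (simp add: plateau_def pos_sq_def[of "1 - _"])

lemma plateau'_nonzero: "plateau' s \<noteq> 0 \<Longrightarrow> 1 < s \<and> s < 2"
  using pos_sq_ge_1[of s] by (cases "s \<le> 1"; cases "2 \<le> s") (auto simp: plateau'_def)

lemma abs_plateau'_le: "\<bar>plateau' s\<bar> \<le> 4"
proof (cases "plateau' s = 0")
  case False
  then have s: "1 < s" "s < 2" using plateau'_nonzero by auto
  have "max 0 (1 - pos_sq (s - 1)) * max 0 (s - 1) \<le> 1 * 1"
    using s by (intro mult_mono) (auto simp: pos_sq_def)
  then show ?thesis by (simp add: plateau'_def abs_mult)
qed simp

text \<open>
  The average of the cutoffs at the scales \<open>2 ^ k\<close>, \<open>k0 \<le> k < k0 + N\<close>.  Their transition annuli are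
  disjoint, so at each point at most one of them has a gradient, of size \<open>O(2 ^ -k)\<close>; averaging divides it
  by \<open>N\<close>.  The square of the gradient thus gains a factor \<open>1/N\<^sup>2\<close> on only \<open>N\<close> annuli.
\<close>

lemma log_cutoff_exists:
  fixes k0 N :: nat
  assumes N: "N > 0"
  shows "\<exists>(\<psi> :: 'a::euclidean_space \<Rightarrow> real) D.
    (\<forall>y. GDERIV \<psi> y :> D y) \<and> continuous_on UNIV D \<and>
    (\<forall>y. y \<notin> cball 0 (2 * 2 ^ (k0 + N)) \<longrightarrow> \<psi> y = 0) \<and> (\<forall>y \<in> cball 0 (2 ^ k0). \<psi> y = 1) \<and>
    (\<forall>y. D y \<noteq> 0 \<longrightarrow> (\<exists>k\<in>{k0..<k0 + N}. 2 ^ k < norm y \<and> norm y < 2 * 2 ^ k \<and> norm (D y) \<le> 16 / (real N * 2 ^ k)))"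
proof -
  define s where "s k y = (y \<bullet> y) / (2 ^ k)\<^sup>2" for k :: nat and y :: 'a
  define d where "d k y = (plateau' (s k y) * (2 / (2 ^ k)\<^sup>2)) *\<^sub>R y" for k y
  define \<psi> where "\<psi> y = (\<Sum>k\<in>{k0..<k0 + N}. plateau (s k y)) / N" for y
  define D where "D y = (1 / N) *\<^sub>R (\<Sum>k\<in>{k0..<k0 + N}. d k y)" for y
  have s_le: "s k y \<le> c\<^sup>2 \<longleftrightarrow> norm y \<le> c * 2 ^ k" "s k y < c\<^sup>2 \<longleftrightarrow> norm y < c * 2 ^ k" if "c \<ge> 0" for k y c
  proof -
    have "s k y \<le> c\<^sup>2 \<longleftrightarrow> (norm y)\<^sup>2 \<le> (c * 2 ^ k)\<^sup>2" "s k y < c\<^sup>2 \<longleftrightarrow> (norm y)\<^sup>2 < (c * 2 ^ k)\<^sup>2"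
      by (simp_all add: s_def power_mult_distrib pos_divide_le_eq pos_divide_less_eq power2_norm_eq_inner)
    moreover have "(norm y)\<^sup>2 \<le> (c * 2 ^ k)\<^sup>2 \<longleftrightarrow> norm y \<le> c * 2 ^ k"
      using that by (intro power_mono_iff) auto
    moreover have "(norm y)\<^sup>2 < (c * 2 ^ k)\<^sup>2 \<longleftrightarrow> norm y < c * 2 ^ k"
      using that power_mono_iff[of "c * 2 ^ k" "norm y" 2] unfolding not_le[symmetric] by simp
    ultimately show "s k y \<le> c\<^sup>2 \<longleftrightarrow> norm y \<le> c * 2 ^ k" "s k y < c\<^sup>2 \<longleftrightarrow> norm y < c * 2 ^ k" by simp_all
  qed
  have gd: "GDERIV (\<lambda>y. plateau (s k y)) y :> d k y" for k y
  proof -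
    have "GDERIV (s k) y :> (2 / (2 ^ k)\<^sup>2) *\<^sub>R y"
      unfolding gderiv_def s_def
      by (auto intro!: derivative_eq_intros simp: inner_commute field_simps)
    from GDERIV_DERIV_compose[OF this plateau_deriv] show ?thesis by (simp add: d_def)
  qed
  have "GDERIV \<psi> y :> D y" for y
  proof -
    have "(\<psi> has_derivative (\<lambda>h. (\<Sum>k\<in>{k0..<k0 + N}. h \<bullet> d k y) / N)) (at y)"
      unfolding \<psi>_def using gd unfolding gderiv_def
      by (intro bounded_linear.has_derivative[OF bounded_linear_divide] has_derivative_sum)
    then show ?thesis unfolding gderiv_def D_def by (simp add: inner_sum_right divide_inverse mult.commute)
  qed
  moreover have "continuous_on UNIV D"
    unfolding D_def d_def s_def
    by (intro continuous_intros continuous_on_compose2[OF continuous_plateau'[of UNIV]]) auto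
  moreover have "\<psi> y = 0" if "y \<notin> cball 0 (2 * 2 ^ (k0 + N))" for y
  proof -
    have "plateau (s k y) = 0" if k: "k < k0 + N" for k
    proof (rule plateau_eq_0)
      have "(2::real) ^ k \<le> 2 ^ (k0 + N)" using k by (intro power_increasing) auto
      moreover have "2 * 2 ^ (k0 + N) < norm y" using \<open>y \<notin> cball 0 (2 * 2 ^ (k0 + N))\<close> by (simp add: not_le)
      ultimately have "\<not> norm y \<le> 2 * 2 ^ k" by linarith
      then show "2 \<le> s k y" using s_le(1)[of 2 k y] by simp
    qed
    then show ?thesis by (simp add: \<psi>_def)
  qed
  moreover have "\<psi> y = 1" if "y \<in> cball 0 (2 ^ k0)" for y
  proof -
    have "plateau (s k y) = 1" if k: "k0 \<le> k" for k
    proof (rule plateau_eq_1)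
      have "(2::real) ^ k0 \<le> 2 ^ k" using k by (intro power_increasing) auto
      moreover have "norm y \<le> 2 ^ k0" using \<open>y \<in> cball 0 (2 ^ k0)\<close> by simp
      ultimately have "norm y \<le> 1 * 2 ^ k" by linarith
      then show "s k y \<le> 1" using s_le(1)[of 1 k y] by simp
    qed
    then show ?thesis using N by (simp add: \<psi>_def)
  qed
  moreover have "\<exists>k\<in>{k0..<k0 + N}. 2 ^ k < norm y \<and> norm y < 2 * 2 ^ k \<and> norm (D y) \<le> 16 / (real N * 2 ^ k)"
    if "D y \<noteq> 0" for y
  proof -
    have ann: "2 ^ k < norm y \<and> norm y < 2 * 2 ^ k" if "d k y \<noteq> 0" for k
    proof -
      have "1 < s k y" "s k y < 2" using that plateau'_nonzero[of "s k y"] by (auto simp: d_def)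
      then show ?thesis using s_le(1)[of 1 k y] s_le(2)[of 2 k y] by simp
    qed
    from that have "(\<Sum>k\<in>{k0..<k0 + N}. d k y) \<noteq> 0" by (auto simp: D_def)
    then obtain k where k: "k \<in> {k0..<k0 + N}" "d k y \<noteq> 0" using sum.not_neutral_contains_not_neutral by metis
    have "d j y = 0" if "j \<noteq> k" for j
    proof (rule ccontr)
      assume "d j y \<noteq> 0"
      from ann[OF this] ann[OF k(2)] have "(2::real) ^ j < 2 ^ Suc k" "(2::real) ^ k < 2 ^ Suc j" by auto
      then have "j < Suc k" "k < Suc j" by (simp_all only: power_strict_increasing_iff one_less_numeral_iff rel_simps)
      then show False using that by simp
    qed
    then have "(\<Sum>j\<in>{k0..<k0 + N}. d j y) = (\<Sum>j\<in>{k}. d j y)" using k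
      by (intro sum.mono_neutral_right) auto
    then have Dy: "D y = (1 / N) *\<^sub>R d k y" by (simp add: D_def)
    have "norm (d k y) = \<bar>plateau' (s k y)\<bar> * (2 / (2 ^ k)\<^sup>2) * norm y" by (simp add: d_def abs_mult)
    also have "\<dots> \<le> 4 * (2 / (2 ^ k)\<^sup>2) * (2 * 2 ^ k)"
      using ann[OF k(2)] abs_plateau'_le[of "s k y"] by (intro mult_mono) auto
    also have "\<dots> = 16 / 2 ^ k" by (simp add: power2_eq_square)
    finally have "norm (D y) \<le> 16 / (real N * 2 ^ k)" using N by (simp add: Dy divide_simps mult.commute)
    then show ?thesis using k ann[OF k(2)] by blast
  qed
  ultimately show ?thesis by blast
qed

section \<open>The second difference of the integrand\<close>

text \<open>
  Taylor's formula for \<open>F\<close> in the direction \<open>q = (p_n / J) D\<close>, with \<open>J = 1 - D_n\<close>.  Because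
  \<open>|q| \<le> |p_n|/3\<close>, the segment stays where \<open>F\<close> is twice differentiable and its Hessian is controlled by the one
  at \<open>p\<close>.  After multiplication by \<open>J\<close> the first-order term is linear in \<open>D\<close>.
\<close>

lemma shifted_integrand_upper_bound:
  fixes F :: "'m::finite integrand"
  assumes A: "assumption_A U F" and x': "x' \<in> U" and C: "C > 0"
    and B: "\<And>q. norm q \<le> \<bar>snd p\<bar> / 2 \<Longrightarrow> onorm (F_pp F (p + q) z x') \<le> C * onorm (F_pp F p z x')"
    and D: "norm D \<le> 1 / 4" and p: "snd p \<noteq> 0"
  shows "(1 - snd D) * F (p + (snd p / (1 - snd D)) *\<^sub>R D) z x'
    \<le> (1 - snd D) * F p z x' + snd p * (D \<bullet> grad (\<lambda>p. F p z x') p)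
       + 2 / 3 * C * (norm D)\<^sup>2 * (onorm (F_pp F p z x') * (norm p)\<^sup>2)"
proof -
  define J where "J = 1 - snd D"
  have J: "3/4 \<le> J" using D abs_snd_le_norm[of D] by (auto simp: J_def)
  define q where "q = (snd p / J) *\<^sub>R D"
  define S where "S = {p :: 'm pt. snd p \<noteq> 0}"
  define f where "f p = F p z x'" for p
  define \<Lambda> where "\<Lambda> = onorm (F_pp F p z x')"
  have S: "open S" unfolding S_def by (intro open_Collect_neq continuous_intros)
  have C2: "C2_on S f" using A x' unfolding assumption_A_def S_def f_def by blast
  have nq: "norm q = \<bar>snd p\<bar> * norm D / J" using J by (simp add: q_def)
  also have "\<dots> \<le> \<bar>snd p\<bar> * (1/4) / (3/4)" using D J by (intro frac_le mult_left_mono) auto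
  also have "\<dots> = \<bar>snd p\<bar> / 3" by simp
  finally have q3: "norm q \<le> \<bar>snd p\<bar> / 3" .
  have "p + 0 *\<^sub>R q \<in> S" using p by (simp add: S_def)
  then have "bounded_linear (hess f p)" using C2_on_line_derivatives(3)[OF S C2] by fastforce
  then have \<Lambda>0: "0 \<le> \<Lambda>" unfolding \<Lambda>_def F_pp_def f_def[abs_def, symmetric] by (rule onorm_pos_le)
  have "f (p + q) \<le> f p + q \<bullet> grad f p + (C * \<Lambda>) * (norm q)\<^sup>2 / 2"
  proof (rule C2_on_quadratic_upper_bound[OF S C2])
    fix s :: real assume s: "0 \<le> s" "s \<le> 1"
    have n: "norm (s *\<^sub>R q) \<le> \<bar>snd p\<bar> / 3" using s q3 mult_mono[of s 1 "norm q" "\<bar>snd p\<bar> / 3"] by simp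
    then have "\<bar>snd (s *\<^sub>R q)\<bar> < \<bar>snd p\<bar>" using abs_snd_le_norm[of "s *\<^sub>R q"] p by linarith
    then have "p + s *\<^sub>R q \<in> S" by (auto simp: S_def)
    moreover have "norm (s *\<^sub>R q) \<le> \<bar>snd p\<bar> / 2" using n by linarith
    then have "onorm (hess f (p + s *\<^sub>R q)) \<le> C * \<Lambda>"
      using B[of "s *\<^sub>R q"] unfolding \<Lambda>_def F_pp_def f_def[abs_def] by blast
    ultimately show "p + s *\<^sub>R q \<in> S \<and> onorm (hess f (p + s *\<^sub>R q)) \<le> C * \<Lambda>" by simp
  qed
  then have "J * f (p + q) \<le> J * (f p + q \<bullet> grad f p + (C * \<Lambda>) * (norm q)\<^sup>2 / 2)"
    using J by (intro mult_left_mono) auto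
  also have "\<dots> = J * f p + J * (q \<bullet> grad f p) + C * \<Lambda> * (J * (norm q)\<^sup>2 / 2)"
    by (simp add: algebra_simps)
  also have "J * (q \<bullet> grad f p) = snd p * (D \<bullet> grad f p)" using J by (simp add: q_def)
  also have "J * (norm q)\<^sup>2 / 2 \<le> 2 / 3 * (norm D)\<^sup>2 * (norm p)\<^sup>2"
  proof -
    have "J * (norm q)\<^sup>2 / 2 = ((snd p)\<^sup>2 * (norm D)\<^sup>2) / (2 * J)"
      using J by (simp add: nq power_divide power_mult_distrib) (simp add: power2_eq_square[of J])
    also have "\<dots> \<le> ((norm p)\<^sup>2 * (norm D)\<^sup>2) / (2 * (3/4))"
      using J abs_snd_le_norm[of p] by (intro frac_le mult_right_mono power2_le_iff_abs_le[THEN iffD2]) auto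
    finally show ?thesis by (simp add: mult_ac)
  qed
  then have "C * \<Lambda> * (J * (norm q)\<^sup>2 / 2) \<le> C * \<Lambda> * (2 / 3 * (norm D)\<^sup>2 * (norm p)\<^sup>2)"
    using \<Lambda>0 C by (intro mult_left_mono) auto
  finally have "J * f (p + q) \<le> J * f p + snd p * (D \<bullet> grad f p) + C * \<Lambda> * (2 / 3 * (norm D)\<^sup>2 * (norm p)\<^sup>2)"
    by simp
  then show ?thesis unfolding J_def q_def f_def \<Lambda>_def by (simp add: mult_ac)
qed

text \<open>
  The terms linear in \<open>D\<close> cancel.  If \<open>p_n = 0\<close>, where \<open>F\<close> need not be differentiable, the deformation does
  not change the gradient and the left-hand side vanishes.  The maximum with \<open>0\<close> covers this case, in
  which nothing is known about \<open>F_pp\<close>.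
\<close>

lemma symmetric_shift_second_order:
  fixes F :: "'m::finite integrand"
  assumes A: "assumption_A U F" and x': "x' \<in> U" and C: "C > 0"
    and B: "\<And>q. norm q \<le> \<bar>snd p\<bar> / 2 \<Longrightarrow> onorm (F_pp F (p + q) z x') \<le> C * onorm (F_pp F p z x')"
    and D: "norm D \<le> 1 / 4"
  shows "(1 - snd D) * F (p + (snd p / (1 - snd D)) *\<^sub>R D) z x'
       + (1 - snd (- D)) * F (p + (snd p / (1 - snd (- D))) *\<^sub>R (- D)) z x' - 2 * F p z x'
    \<le> max 0 (4 / 3 * C * (norm D)\<^sup>2 * (onorm (F_pp F p z x') * (norm p)\<^sup>2))"
proof (cases "snd p = 0")
  case True
  then show ?thesis by (simp add: algebra_simps)
next
  case False
  have "norm (- D) \<le> 1/4" using D by simp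
  from shifted_integrand_upper_bound[OF A x' C B D False]
    shifted_integrand_upper_bound[OF A x' C B this False]
  show ?thesis by (simp add: algebra_simps)
qed

section \<open>Energies of deformed functions\<close>

lemma C1_on_GDERIV:
  fixes f :: "'a::euclidean_space \<Rightarrow> real"
  shows "C1_on S f \<Longrightarrow> x \<in> S \<Longrightarrow> GDERIV f x :> grad f x"
  unfolding C1_on_def by (blast intro: GDERIV_grad)

lemma C1_onI:
  assumes "\<And>x. x \<in> S \<Longrightarrow> GDERIV f x :> D x" "continuous_on S D"
  shows "C1_on S f"
  unfolding C1_on_def
proof (intro conjI ballI)
  show "f differentiable (at x)" if "x \<in> S" for x using assms(1)[OF that] by (rule GDERIV_imp_differentiable)
  show "continuous_on S (grad f)"
    using assms(2) by (rule continuous_on_eq) (use assms(1) grad_eq in metis)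
qed

lemma C1_on_continuous: "C1_on S f \<Longrightarrow> continuous_on S f"
  unfolding C1_on_def
  by (intro continuous_at_imp_continuous_on ballI differentiable_imp_continuous_within) auto

lemma GDERIV_lipschitz_convex:
  fixes f :: "'a::euclidean_space \<Rightarrow> real"
  assumes "convex S" "\<And>x. x \<in> S \<Longrightarrow> GDERIV f x :> D x" "\<And>x. x \<in> S \<Longrightarrow> norm (D x) \<le> B"
    and "x \<in> S" "y \<in> S"
  shows "\<bar>f x - f y\<bar> \<le> B * norm (x - y)"
proof -
  have "norm (f x - f y) \<le> B * norm (x - y)"
  proof (rule differentiable_bound[OF assms(1)])
    show "(f has_derivative (\<lambda>h. h \<bullet> D z)) (at z within S)" if "z \<in> S" for z
      using assms(2)[OF that] unfolding gderiv_def by (rule has_derivative_at_withinI)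
    show "onorm (\<lambda>h. h \<bullet> D z) \<le> B" if "z \<in> S" for z
    proof (rule onorm_bound)
      show "0 \<le> B" using assms(3)[OF that] norm_ge_zero[of "D z"] by linarith
      show "norm (h \<bullet> D z) \<le> B * norm h" for h
        using Cauchy_Schwarz_ineq2[of h "D z"] mult_left_mono[OF assms(3)[OF that] norm_ge_zero[of h]]
        by (simp add: mult.commute)
    qed
  qed (use assms in auto)
  then show ?thesis by simp
qed

lemma C1_on_locally_lipschitz:
  fixes f :: "'a::euclidean_space \<Rightarrow> real"
  assumes S: "open S" and C1: "C1_on S f"
  shows "C01_on S f"
  unfolding C01_on_def
proof
  fix x assume "x \<in> S"
  then obtain r where r: "r > 0" "cball x r \<subseteq> S" using S open_contains_cball by metis
  have "compact (grad f ` cball x r)"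
    using C1 r by (intro compact_continuous_image) (auto simp: C1_on_def intro: continuous_on_subset)
  then obtain B where B: "\<forall>y\<in>grad f ` cball x r. norm y \<le> B" using compact_imp_bounded bounded_iff by metis
  have "\<bar>B\<bar>-lipschitz_on (ball x r \<inter> S) f"
    unfolding lipschitz_on_def
  proof (intro conjI ballI)
    fix y z assume yz: "y \<in> ball x r \<inter> S" "z \<in> ball x r \<inter> S"
    have "\<bar>f y - f z\<bar> \<le> B * norm (y - z)"
      by (rule GDERIV_lipschitz_convex[of "cball x r" f "grad f"])
        (use yz B r C1_on_GDERIV[OF C1] in auto)
    also have "\<dots> \<le> \<bar>B\<bar> * norm (y - z)" by (intro mult_right_mono) auto
    finally show "dist (f y) (f z) \<le> \<bar>B\<bar> * dist y z" by (simp add: dist_norm)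
  qed simp
  then show "\<exists>r>0. \<exists>L. L-lipschitz_on (ball x r \<inter> S) f" using r by blast
qed

lemma C01_on_min:
  assumes f: "C01_on S f" and g: "C01_on S g"
  shows "C01_on S (\<lambda>x. min (f x) (g x))"
  unfolding C01_on_def
proof
  fix x assume x: "x \<in> S"
  obtain r L where r: "r > 0" "L-lipschitz_on (ball x r \<inter> S) f" using f x unfolding C01_on_def by blast
  obtain r' L' where r': "r' > 0" "L'-lipschitz_on (ball x r' \<inter> S) g" using g x unfolding C01_on_def by blast
  have "(max L L')-lipschitz_on (ball x (min r r') \<inter> S) (\<lambda>x. min (f x) (g x))"
    unfolding lipschitz_on_def
  proof (intro conjI ballI)
    show "0 \<le> max L L'" using lipschitz_on_nonneg[OF r(2)] by simp
    fix y z assume yz: "y \<in> ball x (min r r') \<inter> S" "z \<in> ball x (min r r') \<inter> S"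
    have "dist (f y) (f z) \<le> L * dist y z" "dist (g y) (g z) \<le> L' * dist y z"
      using lipschitz_onD[OF r(2)] lipschitz_onD[OF r'(2)] yz by auto
    moreover have "L * dist y z \<le> max L L' * dist y z" "L' * dist y z \<le> max L L' * dist y z"
      by (intro mult_right_mono; simp)+
    ultimately show "dist (min (f y) (g y)) (min (f z) (g z)) \<le> max L L' * dist y z"
      unfolding dist_real_def by linarith
  qed
  then show "\<exists>r>0. \<exists>L. L-lipschitz_on (ball x r \<inter> S) (\<lambda>x. min (f x) (g x))"
    using r(1) r'(1) by (intro exI[of _ "min r r'"]) auto
qed

lemma C01_on_uminus: "C01_on S f \<Longrightarrow> C01_on S (\<lambda>x. - f x)"
  unfolding C01_on_def by (metis lipschitz_on_minus)

lemma C01_on_max: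
  assumes "C01_on S f" "C01_on S g"
  shows "C01_on S (\<lambda>x. max (f x) (g x))"
proof -
  have "max (f x) (g x) = - min (- f x) (- g x)" for x by (simp add: max_def min_def)
  then show ?thesis using C01_on_uminus[OF C01_on_min[OF C01_on_uminus[OF assms(1)] C01_on_uminus[OF assms(2)]]] by simp
qed

lemma mem_cylinder: "x \<in> cylinder U \<longleftrightarrow> fst x \<in> U"
  by (cases x) (simp add: cylinder_def)

lemma continuous_on_lagrangian:
  fixes F :: "'m::finite integrand"
  assumes A: "assumption_A U F" and w: "C1_on (cylinder U) w"
  shows "continuous_on (cylinder U) (lagrangian F w)"
proof -
  have "continuous_on (UNIV \<times> UNIV \<times> U) (\<lambda>(p, z, x'). F p z x')" using A unfolding assumption_A_def by blast
  moreover have "continuous_on (cylinder U) (\<lambda>x. (grad w x, w x, fst x))"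
    using w C1_on_continuous[OF w] unfolding C1_on_def by (intro continuous_intros) auto
  ultimately have "continuous_on (cylinder U) (\<lambda>x. (\<lambda>(p, z, x'). F p z x') (grad w x, w x, fst x))"
    by (rule continuous_on_compose2) (auto simp: mem_cylinder)
  then show ?thesis by (simp add: lagrangian_def[abs_def])
qed

abbreviation finite_energy ::
    "(real^'m) set \<Rightarrow> 'm::finite integrand \<Rightarrow> real \<Rightarrow> ('m pt \<Rightarrow> real) \<Rightarrow> bool" where
  "finite_energy U F R v \<equiv> set_integrable lebesgue (cylinder U \<inter> ball 0 R) (lagrangian F v)"

abbreviation real_energy ::
    "(real^'m) set \<Rightarrow> 'm::finite integrand \<Rightarrow> real \<Rightarrow> ('m pt \<Rightarrow> real) \<Rightarrow> real" where
  "real_energy U F R v \<equiv> LINT x:cylinder U \<inter> ball 0 R|lebesgue. lagrangian F v x"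

lemma set_integrable_lagrangian_iff:
  assumes m: "(\<lambda>x. indicator (cylinder U \<inter> ball 0 R) x *\<^sub>R lagrangian F v x) \<in> borel_measurable lebesgue"
  shows "finite_energy U F R v
    \<longleftrightarrow> energy_pos U F R v < \<infinity> \<and> energy_neg U F R v < \<infinity>"
    and "finite_energy U F R v \<Longrightarrow>
      energy U F R v = ereal (real_energy U F R v)"
proof -
  let ?f = "\<lambda>x. indicator (cylinder U \<inter> ball 0 R) x *\<^sub>R lagrangian F v x"
  have p: "energy_pos U F R v = (\<integral>\<^sup>+x. ennreal (?f x) \<partial>lebesgue)"
    unfolding energy_pos_def by (intro nn_integral_cong) (auto simp: indicator_def)
  have n: "energy_neg U F R v = (\<integral>\<^sup>+x. ennreal (- ?f x) \<partial>lebesgue)"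
    unfolding energy_neg_def by (intro nn_integral_cong) (auto simp: indicator_def)
  show iff: "finite_energy U F R v
    \<longleftrightarrow> energy_pos U F R v < \<infinity> \<and> energy_neg U F R v < \<infinity>"
    unfolding set_integrable_def p n real_integrable_def using m by (auto simp: less_top)
  assume i: "finite_energy U F R v"
  then have fin: "energy_pos U F R v < \<infinity>" "energy_neg U F R v < \<infinity>" using iff by auto
  have "(real_energy U F R v) = enn2real (energy_pos U F R v) - enn2real (energy_neg U F R v)"
    unfolding set_lebesgue_integral_def p n
    by (rule real_lebesgue_integral_def) (use i in \<open>simp add: set_integrable_def\<close>)
  moreover have "enn2ereal a = ereal (enn2real a)" if "a < \<infinity>" for a
    using that by (cases a) (auto simp: enn2ereal_ennreal)
  ultimately show "energy U F R v = ereal (real_energy U F R v)"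
    using fin unfolding energy_def by simp
qed

lemma borel_measurable_lagrangian:
  fixes F :: "'m::finite integrand"
  assumes "open (cylinder U)" "assumption_A U F" "C1_on (cylinder U) w"
  shows "(\<lambda>x. indicator (cylinder U \<inter> ball 0 R) x *\<^sub>R lagrangian F w x) \<in> borel_measurable borel"
proof (rule borel_measurable_continuous_on_indicator)
  show "cylinder U \<inter> ball 0 R \<in> sets borel" using assms(1) by auto
  show "continuous_on (cylinder U \<inter> ball 0 R) (lagrangian F w)"
    by (rule continuous_on_subset[OF continuous_on_lagrangian[OF assms(2,3)]]) auto
qed

lemma self_deformation:
  assumes "R > 0"
  shows "lipschitz_deformation U R u u"
  by (rule lipschitz_deformationI[where \<psi> = "\<lambda>_. 0" and K = 0 and c = 0 and r = 0 and N = "{}" and D = "\<lambda>_. 0" and b = 0])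
    (use assms in \<open>auto intro: GDERIV_const lipschitz_on_constant\<close>)

lemma minimizer_integrable:
  fixes F :: "'m::finite integrand"
  assumes "open (cylinder U)" "assumption_A U F" "C1_on (cylinder U) u" and min: "e_n_minimizer U F u" and R: "R > 0"
  shows "finite_energy U F R u"
proof -
  have ex: "energy_exists U F R u" "\<bar>energy U F R u\<bar> \<noteq> \<infinity>" using min R unfolding e_n_minimizer_def by auto
  have "energy_pos U F R u < \<infinity> \<and> energy_neg U F R u < \<infinity>"
    using ex unfolding energy_exists_def energy_def
    by (cases "energy_pos U F R u"; cases "energy_neg U F R u") (auto simp: enn2ereal_ennreal)
  moreover have "(\<lambda>x. indicator (cylinder U \<inter> ball 0 R) x *\<^sub>R lagrangian F u x) \<in> borel_measurable lebesgue"
    by (rule measurable_completion) (use borel_measurable_lagrangian[OF assms(1-3)] in simp)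
  ultimately show ?thesis using set_integrable_lagrangian_iff(1) by blast
qed

lemma minimizer_integral_le:
  fixes F :: "'m::finite integrand"
  assumes "open (cylinder U)" "assumption_A U F" "C1_on (cylinder U) u" and min: "e_n_minimizer U F u" and R: "R > 0"
    and v: "v \<in> piecewise_deformations U R u"
    and i: "finite_energy U F R v"
  shows "(real_energy U F R u)
    \<le> (real_energy U F R v)"
proof -
  have iu: "finite_energy U F R u"
    using assms(1-5) by (rule minimizer_integrable)
  have m: "(\<lambda>x. indicator (cylinder U \<inter> ball 0 R) x *\<^sub>R lagrangian F w x) \<in> borel_measurable lebesgue"
    if "finite_energy U F R w" for w
    using that unfolding set_integrable_def by (rule borel_measurable_integrable)
  have "energy U F R u \<le> energy U F R v" using min R v unfolding e_n_minimizer_def by blast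
  then show ?thesis
    using set_integrable_lagrangian_iff(2)[OF m[OF i] i] set_integrable_lagrangian_iff(2)[OF m[OF iu] iu] by simp
qed

text \<open>
  The energy of a competitor may be \<open>\<infinity>\<close> but not \<open>-\<infinity>\<close>, as it is at least the finite energy of \<open>u\<close>.
\<close>

lemma minimizer_energy_neg_finite:
  assumes min: "e_n_minimizer U F u" and R: "R > 0" and v: "v \<in> piecewise_deformations U R u"
  shows "energy_neg U F R v < \<infinity>"
proof -
  have ex: "energy_exists U F R v" "\<bar>energy U F R u\<bar> \<noteq> \<infinity>" "energy U F R u \<le> energy U F R v"
    using min R v unfolding e_n_minimizer_def by auto
  show ?thesis
    using ex unfolding energy_exists_def energy_def[of _ _ _ v]
    by (cases "energy_pos U F R v"; cases "energy_neg U F R v") (auto simp: enn2ereal_ennreal)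
qed

lemma C1_deformation_mem:
  assumes "open (cylinder U)" "C1_on (cylinder U) w" "lipschitz_deformation U R u w"
  shows "w \<in> piecewise_deformations U R u"
  unfolding piecewise_deformations_def
  using C1_on_locally_lipschitz[OF assms(1,2)] assms(3) by (intro CollectI conjI exI[of _ "{w}"]) auto

context vertical_shift
begin

text \<open>
  The Lagrangian of the deformed function at \<open>unshift y\<close>, times the Jacobian.
\<close>

definition shifted_lagrangian :: "'m integrand \<Rightarrow> ('m pt \<Rightarrow> real) \<Rightarrow> 'm pt \<Rightarrow> real" where
  "shifted_lagrangian F u y = jac y * F (grad u y + (snd (grad u y) / jac y) *\<^sub>R D\<eta> y) (u y) (fst y)"

lemma C1_on_comp_shift:
  assumes C1: "C1_on (cylinder U) u"
  shows "C1_on (cylinder U) (\<lambda>x. u (shift x))"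
proof (rule C1_onI)
  show "GDERIV (\<lambda>x. u (shift x)) x :>
      grad u (shift x) + (snd (grad u (shift x)) / jac (shift x)) *\<^sub>R D\<eta> (shift x)"
    if "x \<in> cylinder U" for x
    using that by (intro GDERIV_comp_shift C1_on_GDERIV[OF C1]) simp
  have g: "continuous_on (cylinder U) (\<lambda>x. grad u (shift x))"
    using C1 by (intro continuous_on_compose2[OF _ continuous_shift]) (auto simp: C1_on_def)
  show "continuous_on (cylinder U) (\<lambda>x. grad u (shift x) + (snd (grad u (shift x)) / jac (shift x)) *\<^sub>R D\<eta> (shift x))"
    using jac_pos[THEN less_imp_neq, THEN not_sym]
    by (intro continuous_intros g continuous_on_compose2[OF continuous_jac[of UNIV] continuous_shift]
        continuous_on_compose2[OF cont_der continuous_shift]) auto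
qed

lemma lagrangian_comp_shift:
  assumes C1: "C1_on (cylinder U) u" and y: "y \<in> cylinder U"
  shows "jac y * lagrangian F (\<lambda>x. u (shift x)) (unshift y) = shifted_lagrangian F u y"
proof -
  have "GDERIV u (shift (unshift y)) :> grad u y" using C1_on_GDERIV[OF C1 y] by simp
  from grad_eq[OF GDERIV_comp_shift[OF this]]
  have "grad (\<lambda>x. u (shift x)) (unshift y) = grad u y + (snd (grad u y) / jac y) *\<^sub>R D\<eta> y" by simp
  then show ?thesis by (simp add: lagrangian_def shifted_lagrangian_def)
qed

text \<open>
  For \<open>c = 1\<close> and \<open>c = -1\<close> these are the positive and the negative part of the energy.
\<close>

lemma nn_integral_comp_shift:
  assumes op: "open (cylinder U)" and A: "assumption_A U F" and C1: "C1_on (cylinder U) u" and R: "r < R"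
  shows "(\<integral>\<^sup>+x\<in>cylinder U \<inter> ball 0 R. ennreal (c * lagrangian F (\<lambda>x. u (shift x)) x) \<partial>lebesgue)
    = (\<integral>\<^sup>+y\<in>cylinder U \<inter> ball 0 R. ennreal (c * shifted_lagrangian F u y) \<partial>lborel)"
proof -
  let ?A = "cylinder U \<inter> ball 0 R" and ?w = "\<lambda>x. u (shift x)"
  let ?h = "\<lambda>x. ennreal (c * (indicator ?A x *\<^sub>R lagrangian F ?w x))"
  have hm: "?h \<in> borel_measurable borel"
    using borel_measurable_lagrangian[OF op A C1_on_comp_shift[OF C1], of R] by measurable
  have "(\<integral>\<^sup>+x\<in>?A. ennreal (c * lagrangian F ?w x) \<partial>lebesgue) = (\<integral>\<^sup>+x. ?h x \<partial>lebesgue)"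
    by (intro nn_integral_cong) (auto simp: indicator_def)
  also have "\<dots> = (\<integral>\<^sup>+x. ?h x \<partial>lborel)" by (rule nn_integral_completion)
  also have "\<dots> = (\<integral>\<^sup>+y. ?h (unshift y) * ennreal (jac y) \<partial>lborel)"
    by (rule nn_integral_unshift[OF hm R]) simp
  also have "\<dots> = (\<integral>\<^sup>+y\<in>?A. ennreal (c * shifted_lagrangian F u y) \<partial>lborel)"
  proof (rule nn_integral_cong)
    fix y
    have "unshift y \<in> ?A \<longleftrightarrow> y \<in> ?A"
      using shift_in_open_ball[OF R, of "unshift y"] by (simp add: mem_cylinder)
    moreover have "ennreal (c * lagrangian F ?w (unshift y)) * ennreal (jac y) = ennreal (c * shifted_lagrangian F u y)"
      if "y \<in> cylinder U"
    proof -
      have "ennreal (c * lagrangian F ?w (unshift y)) * ennreal (jac y)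
          = ennreal (c * lagrangian F ?w (unshift y) * jac y)"
        using jac_pos[of y] by (intro ennreal_mult''[symmetric]) simp
      also have "c * lagrangian F ?w (unshift y) * jac y = c * shifted_lagrangian F u y"
        using lagrangian_comp_shift[OF C1 that, of F] by (simp add: mult_ac)
      finally show ?thesis .
    qed
    ultimately show "?h (unshift y) * ennreal (jac y) = ennreal (c * shifted_lagrangian F u y) * indicator ?A y"
      by (cases "y \<in> ?A") auto
  qed
  finally show ?thesis .
qed

lemma borel_measurable_shifted_lagrangian:
  assumes op: "open (cylinder U)" and A: "assumption_A U F" and C1: "C1_on (cylinder U) u"
  shows "(\<lambda>y. indicator (cylinder U \<inter> ball 0 R) y *\<^sub>R shifted_lagrangian F u y) \<in> borel_measurable borel"
proof (rule borel_measurable_continuous_on_indicator)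
  show "cylinder U \<inter> ball 0 R \<in> sets borel" using op by auto
  have un: "continuous_on UNIV unshift"
    unfolding unshift_def using continuous_eta by (intro continuous_intros)
  have "continuous_on (cylinder U) (\<lambda>y. jac y * lagrangian F (\<lambda>x. u (shift x)) (unshift y))"
    by (intro continuous_intros continuous_jac continuous_on_compose2[OF continuous_on_lagrangian[OF A C1_on_comp_shift[OF C1]]]
      continuous_on_subset[OF un]) (auto simp: mem_cylinder)
  then have "continuous_on (cylinder U) (shifted_lagrangian F u)"
    by (rule continuous_on_eq) (simp add: lagrangian_comp_shift[OF C1])
  then show "continuous_on (cylinder U \<inter> ball 0 R) (shifted_lagrangian F u)"
    by (rule continuous_on_subset) auto
qed

lemma energy_comp_shift:
  assumes op: "open (cylinder U)" and A: "assumption_A U F" and C1: "C1_on (cylinder U) u" and R: "r < R"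
  shows "energy_pos U F R (\<lambda>x. u (shift x)) = (\<integral>\<^sup>+y. ennreal (indicator (cylinder U \<inter> ball 0 R) y *\<^sub>R shifted_lagrangian F u y) \<partial>lborel)"
    "energy_neg U F R (\<lambda>x. u (shift x)) = (\<integral>\<^sup>+y. ennreal (- (indicator (cylinder U \<inter> ball 0 R) y *\<^sub>R shifted_lagrangian F u y)) \<partial>lborel)"
  unfolding energy_pos_def energy_neg_def
  using nn_integral_comp_shift[OF op A C1 R, of 1] nn_integral_comp_shift[OF op A C1 R, of "- 1"]
  by (auto intro!: nn_integral_cong simp: indicator_def)

end

section \<open>Translations cut off at infinity\<close>

lemma ennreal_add_le: "ennreal (a + b) \<le> ennreal a + ennreal b"
proof (cases "0 \<le> a \<and> 0 \<le> b")
  case True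
  then show ?thesis by simp
next
  case False
  then consider "a < 0" | "b < 0" by linarith
  then show ?thesis
  proof cases
    case 1
    then have "ennreal (a + b) \<le> ennreal b" by (intro ennreal_leI) simp
    then show ?thesis using 1 by (simp add: ennreal_neg)
  next
    case 2
    then have "ennreal (a + b) \<le> ennreal a" by (intro ennreal_leI) simp
    then show ?thesis using 2 by (simp add: ennreal_neg)
  qed
qed

text \<open>
  The function \<open>g\<close> may fail to be measurable.  It will contain the Hessian \<open>F_pp\<close> along \<open>u\<close>, whose dependence on
  \<open>u\<close> and \<open>x'\<close> is not controlled; only measurable functions below it are ever split or summed.
\<close>

lemma nn_integral_le_cmult:
  assumes f: "f \<in> borel_measurable M" and c: "c > 0" and le: "\<And>x. f x \<le> ennreal c * g x"
  shows "(\<integral>\<^sup>+x. f x \<partial>M) \<le> ennreal c * (\<integral>\<^sup>+x. g x \<partial>M)"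
proof -
  have 1: "ennreal c * ennreal (1 / c) = 1"
    using c by (subst ennreal_mult''[symmetric]) auto
  have "ennreal (1 / c) * f x \<le> g x" for x
  proof -
    have "ennreal (1 / c) * f x \<le> ennreal (1 / c) * (ennreal c * g x)" by (intro mult_left_mono le) simp
    also have "\<dots> = g x" using 1 by (simp add: mult.assoc[symmetric] mult.commute)
    finally show ?thesis .
  qed
  then have "(\<integral>\<^sup>+x. ennreal (1 / c) * f x \<partial>M) \<le> (\<integral>\<^sup>+x. g x \<partial>M)" by (intro nn_integral_mono)
  moreover have "(\<integral>\<^sup>+x. ennreal (1 / c) * f x \<partial>M) = ennreal (1 / c) * (\<integral>\<^sup>+x. f x \<partial>M)"
    by (rule nn_integral_cmult[OF f])
  ultimately have "ennreal c * (ennreal (1 / c) * (\<integral>\<^sup>+x. f x \<partial>M)) \<le> ennreal c * (\<integral>\<^sup>+x. g x \<partial>M)"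
    by (intro mult_left_mono) auto
  then show ?thesis using 1 by (simp add: mult.assoc[symmetric])
qed

text \<open>
  Each of \<open>f1\<close>, \<open>f2\<close> is bounded above by the second difference, \<open>2 f\<close> and the negative part of the other one.
\<close>

lemma integrable_pair_of_second_difference:
  fixes f f1 f2 :: "'a \<Rightarrow> real"
  assumes f: "integrable M f" and m1[measurable]: "f1 \<in> borel_measurable M" and m2[measurable]: "f2 \<in> borel_measurable M"
    and n1: "(\<integral>\<^sup>+x. ennreal (- f1 x) \<partial>M) < \<infinity>" and n2: "(\<integral>\<^sup>+x. ennreal (- f2 x) \<partial>M) < \<infinity>"
    and e: "0 \<le> \<epsilon>" "(\<integral>\<^sup>+x. ennreal (f1 x + f2 x - 2 * f x) \<partial>M) \<le> ennreal \<epsilon>"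
  shows "integrable M f1" "integrable M f2"
    "integral\<^sup>L M f1 + integral\<^sup>L M f2 \<le> 2 * integral\<^sup>L M f + \<epsilon>"
proof -
  have [measurable]: "f \<in> borel_measurable M" using f by (rule borel_measurable_integrable)
  have fin2f: "(\<integral>\<^sup>+x. ennreal (2 * f x) \<partial>M) < \<infinity>"
    using iffD1[OF real_integrable_def integrable_mult_right[OF f, of 2]] by (simp add: less_top)
  have fine: "(\<integral>\<^sup>+x. ennreal (f1 x + f2 x - 2 * f x) \<partial>M) < \<infinity>" using e(2) by (rule le_less_trans) simp
  have main: "integrable M a"
    if [measurable]: "a \<in> borel_measurable M" "b \<in> borel_measurable M"
      and na: "(\<integral>\<^sup>+x. ennreal (- a x) \<partial>M) < \<infinity>" and nb: "(\<integral>\<^sup>+x. ennreal (- b x) \<partial>M) < \<infinity>"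
      and ab: "\<And>x. a x + b x = f1 x + f2 x" for a b
  proof -
    have "(\<integral>\<^sup>+x. ennreal (a x) \<partial>M)
        \<le> (\<integral>\<^sup>+x. ennreal (f1 x + f2 x - 2 * f x) + (ennreal (- b x) + ennreal (2 * f x)) \<partial>M)"
    proof (rule nn_integral_mono)
      fix x
      have "ennreal (a x) = ennreal ((f1 x + f2 x - 2 * f x) + (- b x + 2 * f x))"
        using ab[of x] by (intro arg_cong[of _ _ ennreal]) linarith
      also have "\<dots> \<le> ennreal (f1 x + f2 x - 2 * f x) + ennreal (- b x + 2 * f x)" by (rule ennreal_add_le)
      also have "\<dots> \<le> ennreal (f1 x + f2 x - 2 * f x) + (ennreal (- b x) + ennreal (2 * f x))"
        by (intro add_left_mono ennreal_add_le)
      finally show "ennreal (a x) \<le> \<dots>" .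
    qed
    also have "\<dots> = (\<integral>\<^sup>+x. ennreal (f1 x + f2 x - 2 * f x) \<partial>M)
        + ((\<integral>\<^sup>+x. ennreal (- b x) \<partial>M) + (\<integral>\<^sup>+x. ennreal (2 * f x) \<partial>M))"
      by (subst nn_integral_add; (subst nn_integral_add)?; simp)
    also have "\<dots> < \<infinity>" using fine nb fin2f by (simp add: less_top[symmetric])
    finally show ?thesis using na by (simp add: real_integrable_def less_top)
  qed
  show i1: "integrable M f1" using main[OF m1 m2 n1 n2] by simp
  show i2: "integrable M f2" using main[OF m2 m1 n2 n1] by (simp add: add.commute)
  have "integral\<^sup>L M (\<lambda>x. f1 x + f2 x - 2 * f x) \<le> \<epsilon>" using e by (rule integral_real_bounded)
  then show "integral\<^sup>L M f1 + integral\<^sup>L M f2 \<le> 2 * integral\<^sup>L M f + \<epsilon>" using i1 i2 f by simp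
qed

lemma real_energy_eqI:
  assumes m: "(\<lambda>x. indicator (cylinder U \<inter> ball 0 R) x *\<^sub>R lagrangian F v x) \<in> borel_measurable lebesgue"
    and e: "energy_pos U F R v = (\<integral>\<^sup>+y. ennreal (f y) \<partial>lebesgue)" "energy_neg U F R v = (\<integral>\<^sup>+y. ennreal (- f y) \<partial>lebesgue)"
    and f: "integrable lebesgue f"
  shows "finite_energy U F R v"
    and "(real_energy U F R v) = integral\<^sup>L lebesgue f"
proof -
  show i: "finite_energy U F R v"
    unfolding set_integrable_lagrangian_iff(1)[OF m] e using f by (simp add: real_integrable_def less_top)
  have "ereal (real_energy U F R v) = energy U F R v"
    using set_integrable_lagrangian_iff(2)[OF m i] by simp
  also have "\<dots> = ereal (integral\<^sup>L lebesgue f)"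
    using f unfolding energy_def e real_integrable_def
    by (subst real_lebesgue_integral_def[OF f])
       (cases "\<integral>\<^sup>+y. ennreal (f y) \<partial>lebesgue"; cases "\<integral>\<^sup>+y. ennreal (- f y) \<partial>lebesgue"; simp add: enn2ereal_ennreal)
  finally show "(real_energy U F R v) = integral\<^sup>L lebesgue f" by simp
qed

text \<open>
  With density \<open>c / 4 ^ k\<close> on the annulus of radius \<open>2 ^ k\<close>, quadratic growth makes each annulus contribute
  the same amount.
\<close>

lemma nn_integral_dyadic_annuli:
  fixes e :: "'a::euclidean_space \<Rightarrow> ennreal"
  assumes e: "e \<in> borel_measurable lebesgue" and c: "c > 0" and K: "K \<ge> 0"
    and cover: "\<And>y. e y \<noteq> 0 \<Longrightarrow> \<exists>k\<in>{m..<m + N}. 2 ^ k < norm y \<and> norm y < 2 * 2 ^ k"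
    and le: "\<And>k y. m \<le> k \<Longrightarrow> 2 ^ k < norm y \<Longrightarrow> norm y < 2 * 2 ^ k \<Longrightarrow> e y \<le> ennreal (c / (2 ^ k)\<^sup>2) * \<Lambda> (2 * 2 ^ k) y"
    and grow: "\<And>k. m \<le> k \<Longrightarrow> (\<integral>\<^sup>+y. \<Lambda> (2 * 2 ^ k) y \<partial>lebesgue) \<le> ennreal (K * (2 * 2 ^ k)\<^sup>2)"
  shows "(\<integral>\<^sup>+y. e y \<partial>lebesgue) \<le> ennreal (real N * (4 * c * K))"
proof -
  define B where "B k = {y :: 'a. 2 ^ k < norm y \<and> norm y < 2 * 2 ^ k}" for k :: nat
  have "open (B k)" for k unfolding B_def by (intro open_Collect_conj open_Collect_less continuous_intros)
  then have Bm: "B k \<in> sets lebesgue" for k by simp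
  then have em: "(\<lambda>y. e y * indicator (B k) y) \<in> borel_measurable lebesgue" for k
    by (intro borel_measurable_times_ennreal borel_measurable_indicator e)
  have "(\<integral>\<^sup>+y. e y \<partial>lebesgue) \<le> (\<integral>\<^sup>+y. (\<Sum>k\<in>{m..<m + N}. e y * indicator (B k) y) \<partial>lebesgue)"
  proof (rule nn_integral_mono)
    fix y
    show "e y \<le> (\<Sum>k\<in>{m..<m + N}. e y * indicator (B k) y)"
    proof (cases "e y = 0")
      case False
      then obtain k where k: "k \<in> {m..<m + N}" "y \<in> B k" using cover[of y] unfolding B_def by blast
      then have "e y = e y * indicator (B k) y" by simp
      also have "\<dots> \<le> (\<Sum>k\<in>{m..<m + N}. e y * indicator (B k) y)"
        using k(1) by (intro member_le_sum) auto
      finally show ?thesis .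
    qed simp
  qed
  also have "\<dots> = (\<Sum>k\<in>{m..<m + N}. \<integral>\<^sup>+y. e y * indicator (B k) y \<partial>lebesgue)"
    by (rule nn_integral_sum) (rule em)
  also have "\<dots> \<le> (\<Sum>k\<in>{m..<m + N}. ennreal (4 * c * K))"
  proof (rule sum_mono)
    fix k assume "k \<in> {m..<m + N}"
    then have k: "m \<le> k" by simp
    have "(\<integral>\<^sup>+y. e y * indicator (B k) y \<partial>lebesgue) \<le> ennreal (c / (2 ^ k)\<^sup>2) * (\<integral>\<^sup>+y. \<Lambda> (2 * 2 ^ k) y \<partial>lebesgue)"
    proof (rule nn_integral_le_cmult[OF em])
      show "0 < c / (2 ^ k)\<^sup>2" using c by simp
      show "e y * indicator (B k) y \<le> ennreal (c / (2 ^ k)\<^sup>2) * \<Lambda> (2 * 2 ^ k) y" for y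
        using le[OF k, of y] by (cases "y \<in> B k") (auto simp: B_def)
    qed
    also have "\<dots> \<le> ennreal (c / (2 ^ k)\<^sup>2) * ennreal (K * (2 * 2 ^ k)\<^sup>2)"
      by (intro mult_left_mono grow k) simp
    also have "\<dots> = ennreal (c / (2 ^ k)\<^sup>2 * (K * (2 * 2 ^ k)\<^sup>2))"
      using c K by (intro ennreal_mult'[symmetric]) auto
    also have "c / (2 ^ k)\<^sup>2 * (K * (2 * 2 ^ k)\<^sup>2) = 4 * c * K" by (simp add: power_mult_distrib)
    finally show "(\<integral>\<^sup>+y. e y * indicator (B k) y \<partial>lebesgue) \<le> ennreal (4 * c * K)" .
  qed
  also have "\<dots> = ennreal (real N * (4 * c * K))"
    using c K by (simp add: ennreal_of_nat_eq_real_of_nat ennreal_mult)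
  finally show ?thesis .
qed

text \<open>
  Both deformations by \<open>\<plusminus>t \<psi> e_n\<close> are competitors, and their energies add up to at most twice the energy of
  \<open>u\<close> plus \<open>\<epsilon>\<close>.  As one of them is at least the energy of \<open>u\<close>, the other exceeds it by at most \<open>\<epsilon>\<close>.
\<close>

lemma almost_translation:
  fixes F :: "'m::finite integrand"
  assumes op: "open (cylinder U)" and A: "assumption_A U F" and B: "assumption_B U F" and C1: "C1_on (cylinder U) u"
    and min: "e_n_minimizer U F u" and M: "M > 0"
    and growth: "\<forall>\<^sub>F R in at_top.
           (\<integral>\<^sup>+x\<in>cylinder U \<inter> ball 0 R.
              ennreal (onorm (F_pp F (grad u x) (u x) (fst x)) * (norm (grad u x))\<^sup>2) \<partial>lebesgue)
           \<le> ennreal (M * R\<^sup>2)"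
    and \<epsilon>: "\<epsilon> > 0"
  shows "\<exists>R w. r < R \<and> 0 < R \<and> lipschitz_deformation U R u w \<and> C1_on (cylinder U) w \<and>
    (\<forall>x\<in>ball 0 r. w x = u (x + t *\<^sub>R e_n)) \<and>
    finite_energy U F R w \<and>
    (real_energy U F R w)
      \<le> (real_energy U F R u) + \<epsilon>"
proof -
  obtain C where C: "C > 0" and BC: "\<And>z x' p q. x' \<in> U \<Longrightarrow> norm q \<le> \<bar>snd p\<bar> / 2 \<Longrightarrow>
      onorm (F_pp F (p + q) z x') \<le> C * onorm (F_pp F p z x')"
    using B unfolding assumption_B_def by blast
  define \<Lambda> where "\<Lambda> R x = ennreal (onorm (F_pp F (grad u x) (u x) (fst x)) * (norm (grad u x))\<^sup>2)
      * indicator (cylinder U \<inter> ball 0 R) x" for R x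
  obtain R0 where R0: "\<And>R. R \<ge> R0 \<Longrightarrow> (\<integral>\<^sup>+x. \<Lambda> R x \<partial>lebesgue) \<le> ennreal (M * R\<^sup>2)"
    using growth unfolding eventually_at_top_linorder \<Lambda>_def by blast
  \<comment> \<open>\<open>4/3 C\<close> comes from the second difference and \<open>32\<close> from the cutoff; adding \<open>1\<close> keeps \<open>c\<close> positive for \<open>t = 0\<close>.\<close>
  define c where "c = 4 / 3 * C * (32 * (\<bar>t\<bar> + 1))\<^sup>2"
  have c: "c > 0" using C by (simp add: c_def)
  \<comment> \<open>The second difference will be at most \<open>4 c M / N\<close>.\<close>
  obtain N0 :: nat where N0: "4 * c * M / \<epsilon> < N0" using reals_Archimedean2 by blast
  define N where "N = Suc N0"
  have N: "N > 0" "4 * c * M / \<epsilon> < N" using N0 by (auto simp: N_def)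
  \<comment> \<open>On the scale \<open>2 ^ k0\<close> the plateau contains the translated ball, the growth bound holds, and the gradient of \<open>t \<psi>\<close> is at most \<open>1/4\<close>.\<close>
  obtain k0 where "max (r + \<bar>t\<bar>) (max R0 (128 * \<bar>t\<bar>)) < 2 ^ k0" using real_arch_pow[of 2 "max (r + \<bar>t\<bar>) (max R0 (128 * \<bar>t\<bar>))"] by auto
  then have k0: "r + \<bar>t\<bar> < 2 ^ k0" "R0 < 2 ^ k0" "128 * \<bar>t\<bar> < 2 ^ k0" by auto
  obtain \<psi> :: "'m pt \<Rightarrow> real" and D where
    der: "\<And>y. GDERIV \<psi> y :> D y" and contD: "continuous_on UNIV D"
    and out: "\<And>y. y \<notin> cball 0 (2 * 2 ^ (k0 + N)) \<Longrightarrow> \<psi> y = 0" and one: "\<And>y. y \<in> cball 0 (2 ^ k0) \<Longrightarrow> \<psi> y = 1"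
    and ann: "\<And>y. D y \<noteq> 0 \<Longrightarrow> \<exists>k\<in>{k0..<k0 + N}. 2 ^ k < norm y \<and> norm y < 2 * 2 ^ k \<and> norm (D y) \<le> 16 / (real N * 2 ^ k)"
    using log_cutoff_exists[OF N(1), of k0, where 'a = "'m pt"] by metis
  have pow: "(2::real) ^ k0 \<le> 2 ^ k" if "k0 \<le> k" for k using that by (intro power_increasing) auto
  \<comment> \<open>In terms of \<open>|y|\<close> the bound does not refer to the annulus, so it can be used on each of them.\<close>
  have Dle: "norm (D y) \<le> 32 / (real N * norm y)" for y
  proof (cases "D y = 0")
    case False
    then obtain k where k: "2 ^ k < norm y" "norm y < 2 * 2 ^ k" "norm (D y) \<le> 16 / (real N * 2 ^ k)"
      using ann by blast
    have "(0::real) < 2 ^ k" by simp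
    then have y: "0 < norm y" using k(1) by linarith
    have "16 / (real N * 2 ^ k) = 32 / (real N * (2 * 2 ^ k))" by simp
    also have "\<dots> \<le> 32 / (real N * norm y)"
      using y k N(1) by (intro divide_left_mono mult_left_mono mult_pos_pos) auto
    finally show ?thesis using k(3) by linarith
  qed simp
  define \<eta> where "\<eta> y = t * \<psi> y" for y
  define D\<eta> where "D\<eta> y = t *\<^sub>R D y" for y
  have small: "norm (D\<eta> y) \<le> 1/4" for y
  proof (cases "D y = 0")
    case False
    then obtain k where k: "k0 \<le> k" "norm (D y) \<le> 16 / (real N * 2 ^ k)" using ann[of y] by auto
    have "16 / (real N * 2 ^ k) \<le> 16 / (1 * 2 ^ k0)"
      using N(1) pow[OF k(1)] by (intro divide_left_mono mult_mono) auto
    then have "norm (D\<eta> y) \<le> \<bar>t\<bar> * (16 / 2 ^ k0)"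
      using k(2) unfolding D\<eta>_def norm_scaleR by (intro mult_left_mono) auto
    also have "\<dots> \<le> 1/4" using k0(3) by (simp add: field_simps)
    finally show ?thesis .
  qed (simp add: D\<eta>_def)
  let ?r = "2 * 2 ^ (k0 + N) :: real"
  interpret p: vertical_shift \<eta> D\<eta> ?r
  proof
    show "GDERIV \<eta> y :> D\<eta> y" for y
      using der[of y] unfolding gderiv_def \<eta>_def D\<eta>_def by (auto intro!: derivative_eq_intros)
    show "continuous_on UNIV D\<eta>" unfolding D\<eta>_def using contD by (intro continuous_intros)
  qed (use small out in \<open>auto simp: \<eta>_def\<close>)
  interpret m: vertical_shift "\<lambda>y. - \<eta> y" "\<lambda>y. - D\<eta> y" ?r
  proof
    show "GDERIV (\<lambda>y. - \<eta> y) y :> - D\<eta> y" for y using p.der by (rule GDERIV_minus)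
    show "continuous_on UNIV (\<lambda>y. - D\<eta> y)" using p.cont_der by (intro continuous_intros)
  qed (use small p.supp in auto)
  define R where "R = ?r + 1"
  have rR: "?r < R" by (simp add: R_def)
  have R: "r < R" "0 < R"
  proof -
    show "0 < R" by (simp add: R_def add_pos_pos)
    have "(2::real) ^ k0 \<le> 2 ^ (k0 + N)" by (rule pow) simp
    moreover have "(0::real) < 2 ^ (k0 + N)" by simp
    ultimately show "r < R" using k0(1) unfolding R_def by linarith
  qed
  let ?A = "cylinder U \<inter> ball (0 :: 'm pt) R"
  let ?w = "\<lambda>x. u (p.shift x)" and ?w' = "\<lambda>x. u (m.shift x)"
  define f where "f y = indicator ?A y *\<^sub>R lagrangian F u y" for y
  define f1 where "f1 y = indicator ?A y *\<^sub>R p.shifted_lagrangian F u y" for y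
  define f2 where "f2 y = indicator ?A y *\<^sub>R m.shifted_lagrangian F u y" for y
  have f: "integrable lebesgue f"
    using minimizer_integrable[OF op A C1 min R(2)] unfolding set_integrable_def f_def .
  have f1m: "f1 \<in> borel_measurable lborel" and f2m: "f2 \<in> borel_measurable lborel"
    unfolding f1_def f2_def
    using p.borel_measurable_shifted_lagrangian[OF op A C1] m.borel_measurable_shifted_lagrangian[OF op A C1] by simp_all
  note f1l = measurable_completion[OF f1m] and f2l = measurable_completion[OF f2m]
  have lip: "lipschitz_deformation U R u ?w" "lipschitz_deformation U R u ?w'"
    using p.comp_shift_lipschitz_deformation[OF rR] m.comp_shift_lipschitz_deformation[OF rR] by blast+
  have C1w: "C1_on (cylinder U) ?w" "C1_on (cylinder U) ?w'"
    using p.C1_on_comp_shift[OF C1] m.C1_on_comp_shift[OF C1] by blast+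
  note mem = C1_deformation_mem[OF op C1w(1) lip(1)] C1_deformation_mem[OF op C1w(2) lip(2)]
  have e1: "energy_pos U F R ?w = (\<integral>\<^sup>+y. ennreal (f1 y) \<partial>lebesgue)" "energy_neg U F R ?w = (\<integral>\<^sup>+y. ennreal (- f1 y) \<partial>lebesgue)"
    using p.energy_comp_shift[OF op A C1 rR] unfolding f1_def by (simp_all add: nn_integral_completion)
  have e2: "energy_pos U F R ?w' = (\<integral>\<^sup>+y. ennreal (f2 y) \<partial>lebesgue)" "energy_neg U F R ?w' = (\<integral>\<^sup>+y. ennreal (- f2 y) \<partial>lebesgue)"
    using m.energy_comp_shift[OF op A C1 rR] unfolding f2_def by (simp_all add: nn_integral_completion)
  have second: "f1 y + f2 y - 2 * f y \<le> max 0 (4 / 3 * C * (norm (D\<eta> y))\<^sup>2 *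
      (onorm (F_pp F (grad u y) (u y) (fst y)) * (norm (grad u y))\<^sup>2))" if "y \<in> ?A" for y
  proof -
    have y: "fst y \<in> U" using that by (simp add: mem_cylinder)
    have "norm (D\<eta> y) \<le> 1/4" by (rule small)
    from symmetric_shift_second_order[OF A y C BC[OF y] this, of "grad u y" "u y"]
    show ?thesis using that
      unfolding f1_def f2_def f_def p.shifted_lagrangian_def m.shifted_lagrangian_def p.jac_def m.jac_def lagrangian_def
      by simp
  qed
  have "(\<integral>\<^sup>+y. ennreal (f1 y + f2 y - 2 * f y) \<partial>lebesgue) \<le> ennreal (real N * (4 * (c / (real N)\<^sup>2) * M))"
  proof (rule nn_integral_dyadic_annuli[where \<Lambda> = \<Lambda> and m = k0])
    show "(\<lambda>y. ennreal (f1 y + f2 y - 2 * f y)) \<in> borel_measurable lebesgue"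
      using f1l f2l borel_measurable_integrable[OF f] by measurable
    show "0 < c / (real N)\<^sup>2" "0 \<le> M" using c N M by auto
    show "\<exists>k\<in>{k0..<k0 + N}. 2 ^ k < norm y \<and> norm y < 2 * 2 ^ k" if "ennreal (f1 y + f2 y - 2 * f y) \<noteq> 0" for y
    proof -
      have y: "y \<in> ?A" using that by (rule_tac ccontr) (simp add: f1_def f2_def f_def)
      have "D y \<noteq> 0"
      proof
        assume "D y = 0"
        then have "f1 y + f2 y - 2 * f y \<le> 0" using second[OF y] by (simp add: D\<eta>_def)
        then show False using that by (simp add: ennreal_neg)
      qed
      then show ?thesis using ann by blast
    qed
    show "ennreal (f1 y + f2 y - 2 * f y) \<le> ennreal (c / (real N)\<^sup>2 / (2 ^ k)\<^sup>2) * \<Lambda> (2 * 2 ^ k) y"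
      if k: "k0 \<le> k" "2 ^ k < norm y" "norm y < 2 * 2 ^ k" for k y
    proof (cases "y \<in> ?A")
      case True
      let ?L = "onorm (F_pp F (grad u y) (u y) (fst y)) * (norm (grad u y))\<^sup>2"
      have "ennreal (f1 y + f2 y - 2 * f y) \<le> ennreal (max 0 (4 / 3 * C * (norm (D\<eta> y))\<^sup>2 * ?L))"
        by (rule ennreal_leI[OF second[OF True]])
      also have "\<dots> = ennreal (4 / 3 * C * (norm (D\<eta> y))\<^sup>2 * ?L)" by (simp add: max_def ennreal_neg)
      also have "\<dots> = ennreal (4 / 3 * C * (norm (D\<eta> y))\<^sup>2) * ennreal ?L"
        using C by (intro ennreal_mult') simp
      also have "\<dots> \<le> ennreal (c / (real N)\<^sup>2 / (2 ^ k)\<^sup>2) * ennreal ?L"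
      proof (intro mult_right_mono ennreal_leI)
        have "0 < norm y" using k(2) by (meson less_trans zero_less_numeral zero_less_power)
        then have "norm (D y) \<le> 32 / (real N * 2 ^ k)"
          using Dle[of y] k(2) N(1)
          by (elim order_trans) (intro divide_left_mono mult_left_mono mult_pos_pos; simp)
        then have "norm (D\<eta> y) \<le> (\<bar>t\<bar> + 1) * (32 / (real N * 2 ^ k))"
          unfolding D\<eta>_def norm_scaleR by (intro mult_mono) auto
        then have "(norm (D\<eta> y))\<^sup>2 \<le> ((\<bar>t\<bar> + 1) * (32 / (real N * 2 ^ k)))\<^sup>2" by (intro power_mono) auto
        then have "4 / 3 * C * (norm (D\<eta> y))\<^sup>2 \<le> 4 / 3 * C * ((\<bar>t\<bar> + 1) * (32 / (real N * 2 ^ k)))\<^sup>2"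
          using C by (intro mult_left_mono) auto
        also have "\<dots> = c / (real N)\<^sup>2 / (2 ^ k)\<^sup>2"
          unfolding c_def power_mult_distrib power_divide by (simp add: mult_ac)
        finally show "4 / 3 * C * (norm (D\<eta> y))\<^sup>2 \<le> c / (real N)\<^sup>2 / (2 ^ k)\<^sup>2" .
      qed simp
      also have "ennreal ?L = \<Lambda> (2 * 2 ^ k) y" using True k(3) by (simp add: \<Lambda>_def)
      finally show ?thesis .
    qed (simp add: f1_def f2_def f_def)
    show "(\<integral>\<^sup>+y. \<Lambda> (2 * 2 ^ k) y \<partial>lebesgue) \<le> ennreal (M * (2 * 2 ^ k)\<^sup>2)" if "k0 \<le> k" for k
    proof (rule R0)
      have "(0::real) < 2 ^ k" by simp
      then show "R0 \<le> 2 * 2 ^ k" using k0(2) pow[OF that] by linarith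
    qed
  qed
  also have "\<dots> \<le> ennreal \<epsilon>"
    using N \<epsilon> by (intro ennreal_leI) (simp add: field_simps power2_eq_square)
  finally have sd: "(\<integral>\<^sup>+y. ennreal (f1 y + f2 y - 2 * f y) \<partial>lebesgue) \<le> ennreal \<epsilon>" .
  have n1: "(\<integral>\<^sup>+y. ennreal (- f1 y) \<partial>lebesgue) < \<infinity>" "(\<integral>\<^sup>+y. ennreal (- f2 y) \<partial>lebesgue) < \<infinity>"
    using minimizer_energy_neg_finite[OF min R(2) mem(1)] minimizer_energy_neg_finite[OF min R(2) mem(2)]
    unfolding e1 e2 .
  note pair = integrable_pair_of_second_difference[OF f f1l f2l n1 less_imp_le[OF \<epsilon>] sd]
  have wm: "(\<lambda>x. indicator ?A x *\<^sub>R lagrangian F w x) \<in> borel_measurable lebesgue" if "C1_on (cylinder U) w" for w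
    by (rule measurable_completion) (use borel_measurable_lagrangian[OF op A that] in simp)
  note w1 = real_energy_eqI[OF wm[OF C1w(1)] e1 pair(1)] and w2 = real_energy_eqI[OF wm[OF C1w(2)] e2 pair(2)]
  have fu: "(LINT x:?A|lebesgue. lagrangian F u x) = integral\<^sup>L lebesgue f"
    unfolding set_lebesgue_integral_def f_def ..
  have "(LINT x:?A|lebesgue. lagrangian F u x) \<le> (LINT x:?A|lebesgue. lagrangian F ?w' x)"
    by (rule minimizer_integral_le[OF op A C1 min R(2) mem(2) w2(1)])
  then have le: "(LINT x:?A|lebesgue. lagrangian F ?w x) \<le> (LINT x:?A|lebesgue. lagrangian F u x) + \<epsilon>"
    using pair(3) w1(2) w2(2) fu by linarith
  have "?w x = u (x + t *\<^sub>R e_n)" if "x \<in> ball 0 r" for x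
  proof -
    have "norm (x + t *\<^sub>R e_n) \<le> norm x + \<bar>t\<bar>" by (rule order_trans[OF norm_triangle_ineq]) simp
    then have "\<psi> (x + t *\<^sub>R e_n) = 1" using that k0(1) by (intro one) simp
    then have "p.shift x = x + t *\<^sub>R e_n" by (intro p.shift_unique) (simp add: \<eta>_def)
    then show ?thesis by simp
  qed
  with R lip(1) C1w(1) w1(1) le show ?thesis by blast
qed

section \<open>Minimum and maximum of two functions\<close>

lemma set_integral_off_negligible:
  fixes L h :: "'a::euclidean_space \<Rightarrow> real"
  assumes h: "integrable lebesgue h" and N: "negligible N" and eq: "\<And>x. x \<notin> N \<Longrightarrow> indicator A x *\<^sub>R L x = h x"
  shows "set_integrable lebesgue A L" "(LINT x:A|lebesgue. L x) = integral\<^sup>L lebesgue h"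
proof -
  have hm: "h \<in> borel_measurable lebesgue" using h by (rule borel_measurable_integrable)
  have Lm: "(\<lambda>x. indicator A x *\<^sub>R L x) \<in> borel_measurable lebesgue"
    using hm N eq by (rule lebesgue_measurable_off_negligible)
  have "AE x in lebesgue. x \<notin> N" using N by (simp add: negligible_iff_null_sets AE_not_in)
  then have ae: "AE x in lebesgue. indicator A x *\<^sub>R L x = h x" by (rule eventually_mono) (rule eq)
  show "set_integrable lebesgue A L"
    unfolding set_integrable_def using integrable_cong_AE[OF Lm hm ae] h by simp
  show "(LINT x:A|lebesgue. L x) = integral\<^sup>L lebesgue h"
    unfolding set_lebesgue_integral_def using integral_cong_AE[OF Lm hm ae] .
qed

lemma negligible_equal_values_distinct_gradients:
  fixes f g :: "'a::euclidean_space \<Rightarrow> real"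
  assumes "\<And>x. x \<in> S \<Longrightarrow> GDERIV f x :> Df x" "\<And>x. x \<in> S \<Longrightarrow> GDERIV g x :> Dg x"
  shows "negligible {x \<in> S. f x = g x \<and> Df x \<noteq> Dg x}"
proof (rule negligible_zeros_with_nonzero_gradient[where g = "\<lambda>x. f x - g x"])
  fix x assume "x \<in> {x \<in> S. f x = g x \<and> Df x \<noteq> Dg x}"
  then show "\<exists>D. D \<noteq> 0 \<and> GDERIV (\<lambda>x. f x - g x) x :> D"
    using GDERIV_diff[OF assms(1)[of x] assms(2)[of x]] by (intro exI[of _ "Df x - Dg x"]) auto
qed simp

lemma GDERIV_max:
  fixes f g :: "'a::real_inner \<Rightarrow> real"
  assumes f: "GDERIV f x :> A" and g: "GDERIV g x :> B" and eq: "f x = g x \<Longrightarrow> A = B"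
  shows "GDERIV (\<lambda>y. max (f y) (g y)) x :> (if f x \<le> g x then B else A)"
proof -
  have "max (f y) (g y) = f y + g y - min (f y) (g y)" for y by (simp add: max_def min_def)
  moreover have "(if f x \<le> g x then B else A) = A + B - (if f x \<le> g x then A else B)" by simp
  ultimately show ?thesis using GDERIV_diff[OF GDERIV_add[OF f g] GDERIV_min[OF f g eq]] by simp
qed

text \<open>
  Up to a null set the domain splits into the parts \<open>u \<le> w\<close> and \<open>w < u\<close>, on which minimum and maximum are
  \<open>u\<close> and \<open>w\<close> with their gradients, in one order or the other.
\<close>

lemma min_max_energy:
  fixes F :: "'m::finite integrand"
  assumes op: "open (cylinder U)" and u: "C1_on (cylinder U) u" and w: "C1_on (cylinder U) w"
    and iu: "finite_energy U F R u"
    and iw: "finite_energy U F R w"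
  shows "finite_energy U F R (\<lambda>x. min (u x) (w x))"
    and "finite_energy U F R (\<lambda>x. max (u x) (w x))"
    and "(real_energy U F R (\<lambda>x. min (u x) (w x)))
       + (real_energy U F R (\<lambda>x. max (u x) (w x)))
      = (real_energy U F R u)
       + (real_energy U F R w)"
proof -
  let ?A = "cylinder U \<inter> ball (0 :: 'm pt) R"
  define W where "W = cylinder U \<inter> (\<lambda>x. u x - w x) -` {0<..}"
  have "open W" unfolding W_def
    using C1_on_continuous[OF u] C1_on_continuous[OF w]
    by (intro continuous_open_preimage op continuous_intros) auto
  then have Wm: "W \<in> sets lebesgue" "- W \<in> sets lebesgue" by auto
  define N where "N = {x \<in> cylinder U. u x = w x \<and> grad u x \<noteq> grad w x}"
  have N: "negligible N" unfolding N_def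
    using C1_on_GDERIV[OF u] C1_on_GDERIV[OF w] by (rule negligible_equal_values_distinct_gradients)
  define fu where "fu x = indicator ?A x *\<^sub>R lagrangian F u x" for x
  define fw where "fw x = indicator ?A x *\<^sub>R lagrangian F w x" for x
  have i: "integrable lebesgue fu" "integrable lebesgue fw"
    using iu iw unfolding set_integrable_def fu_def fw_def by simp_all
  define h where "h x = indicator (- W) x *\<^sub>R fu x + indicator W x *\<^sub>R fw x" for x
  define k where "k x = indicator (- W) x *\<^sub>R fw x + indicator W x *\<^sub>R fu x" for x
  have hi: "integrable lebesgue h" and ki: "integrable lebesgue k"
    unfolding h_def k_def using Wm i by (intro Bochner_Integration.integrable_add integrable_mult_indicator; simp)+
  have grads: "grad (\<lambda>x. min (u x) (w x)) x = (if x \<in> W then grad w x else grad u x)"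
    "grad (\<lambda>x. max (u x) (w x)) x = (if x \<in> W then grad u x else grad w x)" if "x \<in> cylinder U" "x \<notin> N" for x
  proof -
    have "u x = w x \<Longrightarrow> grad u x = grad w x" using that by (auto simp: N_def)
    from grad_eq[OF GDERIV_min[OF C1_on_GDERIV[OF u that(1)] C1_on_GDERIV[OF w that(1)] this]]
      grad_eq[OF GDERIV_max[OF C1_on_GDERIV[OF u that(1)] C1_on_GDERIV[OF w that(1)] this]]
    show "grad (\<lambda>x. min (u x) (w x)) x = (if x \<in> W then grad w x else grad u x)"
      "grad (\<lambda>x. max (u x) (w x)) x = (if x \<in> W then grad u x else grad w x)"
      using that by (auto simp: W_def)
  qed
  have eqs: "indicator ?A x *\<^sub>R lagrangian F (\<lambda>x. min (u x) (w x)) x = h x"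
    "indicator ?A x *\<^sub>R lagrangian F (\<lambda>x. max (u x) (w x)) x = k x" if "x \<notin> N" for x
  proof -
    have "min (u x) (w x) = (if x \<in> W then w x else u x) \<and> max (u x) (w x) = (if x \<in> W then u x else w x)"
      if "x \<in> cylinder U" using that by (auto simp: W_def)
    with grads[OF _ that] show "indicator ?A x *\<^sub>R lagrangian F (\<lambda>x. min (u x) (w x)) x = h x"
      "indicator ?A x *\<^sub>R lagrangian F (\<lambda>x. max (u x) (w x)) x = k x"
      by (cases "x \<in> ?A"; cases "x \<in> W"; simp add: h_def k_def fu_def fw_def lagrangian_def)+
  qed
  note H = set_integral_off_negligible[OF hi N eqs(1)] and K = set_integral_off_negligible[OF ki N eqs(2)]
  show "set_integrable lebesgue ?A (lagrangian F (\<lambda>x. min (u x) (w x)))" by (rule H(1))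
  show "set_integrable lebesgue ?A (lagrangian F (\<lambda>x. max (u x) (w x)))" by (rule K(1))
  have "integral\<^sup>L lebesgue h + integral\<^sup>L lebesgue k = (\<integral>x. h x + k x \<partial>lebesgue)"
    using hi ki by simp
  also have "\<dots> = (\<integral>x. fu x + fw x \<partial>lebesgue)"
    by (intro Bochner_Integration.integral_cong) (auto simp: h_def k_def indicator_def)
  also have "\<dots> = integral\<^sup>L lebesgue fu + integral\<^sup>L lebesgue fw" using i by simp
  finally show "(LINT x:?A|lebesgue. lagrangian F (\<lambda>x. min (u x) (w x)) x)
       + (LINT x:?A|lebesgue. lagrangian F (\<lambda>x. max (u x) (w x)) x)
      = (LINT x:?A|lebesgue. lagrangian F u x) + (LINT x:?A|lebesgue. lagrangian F w x)"
    using H(2) K(2) unfolding set_lebesgue_integral_def fu_def fw_def by linarith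
qed

section \<open>Cutting off an edge\<close>

lemma measure_open_bounded_pos:
  fixes D :: "'a::euclidean_space set"
  assumes "open D" "bounded D" "D \<noteq> {}"
  shows "D \<in> lmeasurable" "0 < measure lebesgue D"
proof -
  show l: "D \<in> lmeasurable" using assms by (intro bounded_set_imp_lmeasurable) auto
  have "\<not> negligible D" using assms by (intro open_not_negligible)
  then have "measure lebesgue D \<noteq> 0" using l by (metis negligible_iff_measure)
  then show "0 < measure lebesgue D" using measure_nonneg[of lebesgue D] by linarith
qed

lemma abs_min_diff_le:
  fixes a b c d e :: real
  shows "\<bar>a - c\<bar> \<le> e \<Longrightarrow> \<bar>b - d\<bar> \<le> e \<Longrightarrow> \<bar>min a b - min c d\<bar> \<le> e"
  by (simp add: min_def abs_le_iff)

text \<open>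
  On \<open>D\<close> the minimum of \<open>u\<close> and \<open>w\<close> is replaced by the smaller function \<open>ut\<close>.  Subtracting the affine function
  \<open>a + \<zeta> \<bullet> p\<close> from the integrand does not affect the difference of the energies, because the two functions
  agree outside \<open>D\<close> and so the integral of the difference of the gradients vanishes.  After the subtraction the
  integrand is at most \<open>\<gamma>/4\<close> for \<open>ut\<close> and at least \<open>3\<gamma>/4\<close> for \<open>u\<close> and \<open>w\<close>.  The upper bound \<open>\<Gamma>\<close>
  makes the difference of the integrands integrable.
\<close>

lemma cut_corner_energy:
  fixes F :: "'m::finite integrand" and u w ut :: "'m pt \<Rightarrow> real"
  assumes op: "open (cylinder U)" and A: "assumption_A U F"
    and u: "C1_on (cylinder U) u" and w: "C1_on (cylinder U) w"
    and im: "finite_energy U F R (\<lambda>x. min (u x) (w x))"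
    and N0: "negligible N0" and gt: "\<And>x. x \<in> cylinder U \<Longrightarrow> x \<notin> N0 \<Longrightarrow> GDERIV ut x :> Gt x"
    and V: "continuous_on V Gt" and cont: "continuous_on (cylinder U) ut"
    and D_def: "D = {x \<in> cylinder U. ut x < min (u x) (w x)}"
    and D: "D \<subseteq> V" "D \<noteq> {}" "D \<subseteq> ball c r" and r: "r > 0" "ball c (2 * r) \<subseteq> cylinder U" "ball c r \<subseteq> ball 0 R"
    and lip: "L-lipschitz_on (ball c (2 * r)) u" "L-lipschitz_on (ball c (2 * r)) w" "L-lipschitz_on (ball c (2 * r)) ut"
    and \<gamma>: "\<gamma> > 0"
    and est: "\<And>x. x \<in> D \<Longrightarrow> \<bar>F (Gt x) (ut x) (fst x) - a - \<zeta> \<bullet> Gt x\<bar> \<le> \<gamma> / 4"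
    and estu: "\<And>x. x \<in> D \<Longrightarrow> F (grad u x) (u x) (fst x) - a - \<zeta> \<bullet> grad u x \<in> {3 * \<gamma> / 4 .. \<Gamma>}"
    and estw: "\<And>x. x \<in> D \<Longrightarrow> F (grad w x) (w x) (fst x) - a - \<zeta> \<bullet> grad w x \<in> {3 * \<gamma> / 4 .. \<Gamma>}"
  shows "finite_energy U F R (\<lambda>x. min (ut x) (min (u x) (w x)))"
    and "(real_energy U F R (\<lambda>x. min (ut x) (min (u x) (w x))))
      \<le> (real_energy U F R (\<lambda>x. min (u x) (w x))) - \<gamma> / 2 * measure lebesgue D"
proof -
  let ?S = "cylinder U" and ?A = "cylinder U \<inter> ball (0 :: 'm pt) R"
  define m where "m x = min (u x) (w x)" for x
  define v where "v x = min (ut x) (m x)" for x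
  define Gm where "Gm x = (if u x \<le> w x then grad u x else grad w x)" for x
  define N1 where "N1 = {x \<in> ?S. u x = w x \<and> grad u x \<noteq> grad w x}"
  have N1: "negligible N1" unfolding N1_def
    using C1_on_GDERIV[OF u] C1_on_GDERIV[OF w] by (rule negligible_equal_values_distinct_gradients)
  have gm: "GDERIV m x :> Gm x" if "x \<in> ?S" "x \<notin> N1" for x
    unfolding m_def Gm_def using that
    by (intro GDERIV_min C1_on_GDERIV[OF u] C1_on_GDERIV[OF w]) (auto simp: N1_def)
  define N2 where "N2 = {x \<in> ?S - N0 - N1. ut x = m x \<and> Gt x \<noteq> Gm x}"
  have N2: "negligible N2" unfolding N2_def
    using gt gm by (intro negligible_equal_values_distinct_gradients) auto
  define N where "N = N0 \<union> N1 \<union> N2"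
  have N: "negligible N" unfolding N_def using N0 N1 N2 by (intro negligible_Un)
  have mcont: "continuous_on ?S m"
    unfolding m_def using C1_on_continuous[OF u] C1_on_continuous[OF w] by (intro continuous_intros)
  have "D = ?S \<inter> (\<lambda>x. m x - ut x) -` {0<..}" unfolding D_def m_def by auto
  also have "open \<dots>" using mcont cont by (intro continuous_open_preimage op continuous_intros) auto
  finally have Dop: "open D" .
  have DS: "D \<subseteq> ?S" unfolding D_def by auto
  have "bounded D" using D(3) bounded_subset[OF bounded_ball] by blast
  with Dop D(2) have Dl: "D \<in> lmeasurable" by (intro measure_open_bounded_pos)

  \<comment> \<open>The new function minus the old one, extended by zero.\<close>
  define f where "f x = (if x \<in> ?S then min 0 (ut x - m x) else 0)" for x
  define g where "g x = (if x \<in> D \<and> x \<notin> N then Gt x - Gm x else 0)" for x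
  have f0: "f x = 0" if "x \<notin> D" for x using that by (auto simp: f_def D_def m_def)
  have fder: "GDERIV f x :> g x" if "x \<notin> N" for x
  proof (cases "x \<in> ?S")
    case True
    have x: "x \<notin> N0" "x \<notin> N1" "x \<notin> N2" using that by (auto simp: N_def)
    have "GDERIV (\<lambda>y. ut y - m y) x :> Gt x - Gm x"
      using gt[OF True x(1)] gm[OF True x(2)] by (rule GDERIV_diff)
    moreover have "0 = ut x - m x \<Longrightarrow> 0 = Gt x - Gm x" using x True by (auto simp: N2_def)
    ultimately have "GDERIV (\<lambda>y. min 0 (ut y - m y)) x :> (if 0 \<le> ut x - m x then 0 else Gt x - Gm x)"
      by (intro GDERIV_min GDERIV_const)
    also have "(if 0 \<le> ut x - m x then 0 else Gt x - Gm x) = g x"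
      using True that by (auto simp: g_def D_def m_def)
    finally show ?thesis unfolding gderiv_def
      by (rule has_derivative_transform_within_open[OF _ op True]) (simp add: f_def)
  next
    case False
    then have "x \<notin> D" using DS by blast
    have "cball c r \<subseteq> ball c (2 * r)" using r(1) by auto
    then have "x \<in> - cball c r" using False r(2) by blast
    moreover have "((\<lambda>_. 0 :: real) has_derivative (\<lambda>h. h \<bullet> 0)) (at x)" by simp
    moreover have "0 = f y" if "y \<in> - cball c r" for y
    proof -
      have "y \<notin> D" using that D(3) by auto
      then show ?thesis using f0 by simp
    qed
    ultimately have "GDERIV f x :> 0" unfolding gderiv_def
      using has_derivative_transform_within_open[of "\<lambda>_. 0" "\<lambda>h. h \<bullet> 0" x UNIV "- cball c r" f] by auto
    then show ?thesis using \<open>x \<notin> D\<close> by (simp add: g_def)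
  qed
  have L0: "0 \<le> L" using lip(1) by (rule lipschitz_on_nonneg)
  have flip: "\<bar>f y - f x\<bar> \<le> (2 * L) * norm (y - x)" if "norm (y - x) < r" for x y
  proof (cases "x \<in> ball c (2 * r) \<and> y \<in> ball c (2 * r)")
    case True
    then have S: "x \<in> ?S" "y \<in> ?S" using r(2) by auto
    have "\<bar>u y - u x\<bar> \<le> L * norm (y - x)" "\<bar>w y - w x\<bar> \<le> L * norm (y - x)" "\<bar>ut y - ut x\<bar> \<le> L * norm (y - x)"
      using lipschitz_onD[OF lip(1)] lipschitz_onD[OF lip(2)] lipschitz_onD[OF lip(3)] True by (auto simp: dist_norm)
    then have "\<bar>m y - m x\<bar> \<le> L * norm (y - x)" and ut: "\<bar>ut y - ut x\<bar> \<le> L * norm (y - x)"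
      unfolding m_def by (auto intro: abs_min_diff_le)
    then have "\<bar>(ut y - m y) - (ut x - m x)\<bar> \<le> (2 * L) * norm (y - x)" by linarith
    moreover have "\<bar>0 - 0 :: real\<bar> \<le> (2 * L) * norm (y - x)" using L0 by simp
    ultimately have "\<bar>min 0 (ut y - m y) - min 0 (ut x - m x)\<bar> \<le> (2 * L) * norm (y - x)"
      by (intro abs_min_diff_le)
    then show ?thesis using S by (simp add: f_def)
  next
    case False
    have "x \<notin> ball c r \<and> y \<notin> ball c r"
    proof -
      have "dist x y < r" using that by (simp add: dist_norm norm_minus_commute)
      moreover have "dist c x \<le> dist c y + dist x y" "dist c y \<le> dist c x + dist x y"
        using dist_triangle[of c x y] dist_triangle[of c y x] by (simp_all add: dist_commute)
      moreover have "\<not> (dist c x < 2 * r \<and> dist c y < 2 * r)" using False by simp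
      ultimately have "\<not> dist c x < r \<and> \<not> dist c y < r" by linarith
      then show ?thesis by simp
    qed
    then have "x \<notin> D" "y \<notin> D" using D(3) by auto
    then show ?thesis using f0 L0 by simp
  qed
  have supp: "f x = 0" if "x \<notin> ball c r" for x using that D(3) f0 by blast
  have gN: "g x = 0" if "x \<in> N" for x using that by (simp add: g_def)
  note zero = integral_gradient_eq_0[where f = f and N = N and g = g and \<zeta> = \<zeta>, OF r(1) flip supp N fder gN]

  \<comment> \<open>The integrands of the three functions after subtraction of the affine function.\<close>
  define P where "P x = F (Gt x) (ut x) (fst x) - a - \<zeta> \<bullet> Gt x" for x
  define Qu where "Qu x = F (grad u x) (u x) (fst x) - a - \<zeta> \<bullet> grad u x" for x
  define Qw where "Qw x = F (grad w x) (w x) (fst x) - a - \<zeta> \<bullet> grad w x" for x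
  define W where "W = ?S \<inter> (\<lambda>x. u x - w x) -` {0<..}"
  have Wop: "open W" unfolding W_def
    using C1_on_continuous[OF u] C1_on_continuous[OF w]
    by (intro continuous_open_preimage op continuous_intros) auto
  define \<beta> where "\<beta> x = indicator D x *\<^sub>R P x - (indicator (D - W) x *\<^sub>R Qu x + indicator (D \<inter> W) x *\<^sub>R Qw x)" for x
  have Fc: "continuous_on (UNIV \<times> UNIV \<times> U) (\<lambda>(p, z, x'). F p z x')" using A unfolding assumption_A_def by blast
  have Pc: "continuous_on D P"
  proof -
    have "continuous_on D (\<lambda>x. (Gt x, ut x, fst x))"
      using continuous_on_subset[OF V D(1)] continuous_on_subset[OF cont DS] by (intro continuous_intros)
    then have "continuous_on D (\<lambda>x. (\<lambda>(p, z, x'). F p z x') (Gt x, ut x, fst x))"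
      by (rule continuous_on_compose2[OF Fc]) (use DS in \<open>auto simp: mem_cylinder\<close>)
    then show ?thesis unfolding P_def using continuous_on_subset[OF V D(1)] by (intro continuous_intros) auto
  qed
  have Qc: "continuous_on ?S Qu" "continuous_on ?S Qw"
    using continuous_on_lagrangian[OF A u] continuous_on_lagrangian[OF A w] u w
    unfolding Qu_def Qw_def lagrangian_def C1_on_def by (intro continuous_intros; simp)+
  have "(\<lambda>x. indicator D x *\<^sub>R P x) \<in> borel_measurable borel"
    "(\<lambda>x. indicator (D - W) x *\<^sub>R Qu x) \<in> borel_measurable borel"
    "(\<lambda>x. indicator (D \<inter> W) x *\<^sub>R Qw x) \<in> borel_measurable borel"
    using Dop Wop DS Pc Qc
    by (intro borel_measurable_continuous_on_indicator; auto intro: continuous_on_subset)+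
  then have "\<beta> \<in> borel_measurable borel" unfolding \<beta>_def by (intro borel_measurable_diff borel_measurable_add)
  then have \<beta>m: "\<beta> \<in> borel_measurable lebesgue" by (intro measurable_completion) simp
  have \<beta>D: "\<beta> x \<le> - \<gamma> / 2" "\<beta> x \<ge> - \<Gamma> - \<gamma>" if "x \<in> D" for x
    using est[OF that] estu[OF that] estw[OF that] that \<gamma>
    by (cases "x \<in> W"; simp add: \<beta>_def P_def Qu_def Qw_def; linarith)+
  have \<beta>0: "\<beta> x = 0" if "x \<notin> D" for x using that by (simp add: \<beta>_def)
  have \<beta>i: "integrable lebesgue \<beta>"
  proof (rule integrableI_bounded_set[where A = D and B = "\<bar>\<Gamma>\<bar> + \<gamma>"])
    show "AE x in lebesgue. x \<in> D \<longrightarrow> norm (\<beta> x) \<le> \<bar>\<Gamma>\<bar> + \<gamma>"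
    proof (intro AE_I2 impI)
      fix x assume "x \<in> D"
      from \<beta>D[OF this] \<gamma> show "norm (\<beta> x) \<le> \<bar>\<Gamma>\<bar> + \<gamma>" unfolding real_norm_def by linarith
    qed
  qed (use Dl \<beta>m \<beta>0 fmeasurableD2[OF Dl] in \<open>auto simp: less_top\<close>)
  have "integral\<^sup>L lebesgue \<beta> \<le> (\<integral>x. (- \<gamma> / 2) * indicator D x \<partial>lebesgue)"
  proof (rule integral_mono[OF \<beta>i])
    show "integrable lebesgue (\<lambda>x. - \<gamma> / 2 * indicator D x)"
      using Dl fmeasurableD2[OF Dl] by (intro integrable_mult_right integrable_real_indicator) (auto simp: less_top)
    show "\<beta> x \<le> - \<gamma> / 2 * indicator D x" for x using \<beta>D(1)[of x] \<beta>0[of x] by (cases "x \<in> D") auto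
  qed
  then have \<beta>le: "integral\<^sup>L lebesgue \<beta> \<le> - \<gamma> / 2 * measure lebesgue D" by simp

  define h where "h x = indicator ?A x *\<^sub>R lagrangian F m x + \<beta> x + \<zeta> \<bullet> g x" for x
  have mi: "integrable lebesgue (\<lambda>x. indicator ?A x *\<^sub>R lagrangian F m x)"
    using im unfolding set_integrable_def m_def .
  have hi: "integrable lebesgue h" unfolding h_def using mi \<beta>i zero(1) by simp
  have heq: "indicator ?A x *\<^sub>R lagrangian F v x = h x" if x: "x \<notin> N" for x
  proof (cases "x \<in> ?S")
    case False
    then show ?thesis using DS \<beta>0[of x] by (auto simp: h_def g_def)
  next
    case True
    have xN: "x \<notin> N1" using x by (simp add: N_def)
    have "GDERIV (\<lambda>y. m y + f y) x :> Gm x + g x" using gm[OF True xN] fder[OF x] by (rule GDERIV_add)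
    then have "GDERIV v x :> Gm x + g x" unfolding gderiv_def
      by (rule has_derivative_transform_within_open[OF _ op True]) (auto simp: f_def v_def)
    then have gv: "grad v x = Gm x + g x" by (rule grad_eq)
    have gmx: "grad m x = Gm x" using gm[OF True xN] by (rule grad_eq)
    show ?thesis
    proof (cases "x \<in> D")
      case False
      then have "v x = m x" using True by (auto simp: v_def D_def m_def)
      then show ?thesis using False \<beta>0[of x] gv gmx by (simp add: h_def g_def lagrangian_def)
    next
      case xD: True
      then have vx: "v x = ut x" by (auto simp: v_def D_def m_def)
      have gx: "g x = Gt x - Gm x" using xD x by (simp add: g_def)
      have xA: "x \<in> ?A" using xD D(3) r(3) True by auto
      have "\<beta> x = P x - (F (Gm x) (m x) (fst x) - a - \<zeta> \<bullet> Gm x)"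
        using xD True by (auto simp: \<beta>_def Qu_def Qw_def Gm_def m_def W_def min_def)
      then show ?thesis using xA vx gx gv gmx
        by (simp add: h_def lagrangian_def P_def inner_diff_right)
    qed
  qed
  note I = set_integral_off_negligible[OF hi N heq]
  show "set_integrable lebesgue ?A (lagrangian F (\<lambda>x. min (ut x) (min (u x) (w x))))"
    using I(1) unfolding v_def m_def .
  have "integral\<^sup>L lebesgue h = (LINT x:?A|lebesgue. lagrangian F m x) + integral\<^sup>L lebesgue \<beta>"
    unfolding h_def set_lebesgue_integral_def using mi \<beta>i zero by simp
  then have "(LINT x:?A|lebesgue. lagrangian F v x) \<le> (LINT x:?A|lebesgue. lagrangian F m x) - \<gamma> / 2 * measure lebesgue D"
    using I(2) \<beta>le by simp
  then show "(LINT x:?A|lebesgue. lagrangian F (\<lambda>x. min (ut x) (min (u x) (w x))) x)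
      \<le> (LINT x:?A|lebesgue. lagrangian F (\<lambda>x. min (u x) (w x)) x) - \<gamma> / 2 * measure lebesgue D"
    unfolding v_def m_def .
qed

section \<open>The deformation below the edge\<close>

lemma C01_on_deform:
  assumes u: "C01_on (cylinder U) u" and \<phi>: "K-lipschitz_on UNIV \<phi>"
  shows "C01_on (cylinder U) (\<lambda>x. u (x + \<phi> x *\<^sub>R e_n))"
  unfolding C01_on_def
proof
  fix x assume x: "x \<in> cylinder U"
  define T where "T y = y + \<phi> y *\<^sub>R e_n" for y
  have K0: "0 \<le> K" using \<phi> by (rule lipschitz_on_nonneg)
  have TS: "T y \<in> cylinder U \<longleftrightarrow> y \<in> cylinder U" for y by (simp add: T_def mem_cylinder)
  have Tl: "dist (T y) (T z) \<le> (1 + K) * dist y z" for y z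
  proof -
    have "dist (T y) (T z) = norm ((y - z) + (\<phi> y - \<phi> z) *\<^sub>R e_n)"
      by (simp add: T_def dist_norm algebra_simps)
    also have "\<dots> \<le> norm (y - z) + \<bar>\<phi> y - \<phi> z\<bar>" by (rule order_trans[OF norm_triangle_ineq]) simp
    also have "\<bar>\<phi> y - \<phi> z\<bar> \<le> K * dist y z" using lipschitz_onD[OF \<phi>, of y z] by (simp add: dist_norm)
    finally show ?thesis by (simp add: dist_norm algebra_simps)
  qed
  have "T x \<in> cylinder U" using x TS by simp
  then obtain r L where r: "r > 0" and L: "L-lipschitz_on (ball (T x) r \<inter> cylinder U) u"
    using u unfolding C01_on_def by blast
  have "(L * (1 + K))-lipschitz_on (ball x (r / (1 + K)) \<inter> cylinder U) (\<lambda>x. u (T x))"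
    unfolding lipschitz_on_def
  proof (intro conjI ballI)
    show "0 \<le> L * (1 + K)" using lipschitz_on_nonneg[OF L] K0 by simp
    have mem: "T y \<in> ball (T x) r \<inter> cylinder U" if "y \<in> ball x (r / (1 + K)) \<inter> cylinder U" for y
    proof -
      have "(1 + K) * dist x y < (1 + K) * (r / (1 + K))" using that K0 by (intro mult_strict_left_mono) auto
      also have "(1 + K) * (r / (1 + K)) = r" using K0 by simp
      finally have "dist (T x) (T y) < r" using Tl[of x y] by linarith
      then show ?thesis using that TS by simp
    qed
    fix y z assume yz: "y \<in> ball x (r / (1 + K)) \<inter> cylinder U" "z \<in> ball x (r / (1 + K)) \<inter> cylinder U"
    have "dist (u (T y)) (u (T z)) \<le> L * dist (T y) (T z)"
      by (rule lipschitz_onD[OF L mem[OF yz(1)] mem[OF yz(2)]])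
    also have "\<dots> \<le> L * ((1 + K) * dist y z)" by (intro mult_left_mono Tl lipschitz_on_nonneg[OF L])
    finally show "dist (u (T y)) (u (T z)) \<le> L * (1 + K) * dist y z" by (simp add: mult.assoc)
  qed
  then show "\<exists>r>0. \<exists>L. L-lipschitz_on (ball x r \<inter> cylinder U) (\<lambda>x. u (x + \<phi> x *\<^sub>R e_n))"
    unfolding T_def[abs_def] using r K0 by (intro exI[of _ "r / (1 + K)"]) auto
qed

text \<open>
  The paraboloid \<open>b (|x - c|\<^sup>2 - s\<^sup>2)\<close>, replaced by zero outside the ball of radius \<open>s\<close>.  Truncating the norm
  rather than the value makes the Lipschitz constant evident and works for either sign of \<open>b\<close>.
\<close>

definition well :: "'a::euclidean_space \<Rightarrow> real \<Rightarrow> real \<Rightarrow> 'a \<Rightarrow> real" where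
  "well c s b x = b * ((min (norm (x - c)) s)\<^sup>2 - s\<^sup>2)"

lemma well_lipschitz:
  assumes "s > 0"
  shows "(2 * \<bar>b\<bar> * s)-lipschitz_on UNIV (well c s b)"
  unfolding lipschitz_on_def
proof (intro conjI ballI)
  show "0 \<le> 2 * \<bar>b\<bar> * s" using assms by simp
  fix x y :: 'a
  define X where "X = min (norm (x - c)) s"
  define Y where "Y = min (norm (y - c)) s"
  have "\<bar>norm (x - c) - norm (y - c)\<bar> \<le> norm (x - y)" using norm_triangle_ineq3[of "x - c" "y - c"] by simp
  then have XY: "\<bar>X - Y\<bar> \<le> norm (x - y)" unfolding X_def Y_def by (intro abs_min_diff_le) auto
  have b: "0 \<le> X" "X \<le> s" "0 \<le> Y" "Y \<le> s" using assms by (auto simp: X_def Y_def)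
  have "dist (well c s b x) (well c s b y) = \<bar>b\<bar> * (\<bar>X - Y\<bar> * \<bar>X + Y\<bar>)"
    unfolding dist_real_def well_def X_def[symmetric] Y_def[symmetric] abs_mult[symmetric]
    by (simp add: power2_eq_square algebra_simps)
  also have "\<dots> \<le> \<bar>b\<bar> * (norm (x - y) * (2 * s))"
    using XY b by (intro mult_left_mono mult_mono) auto
  finally show "dist (well c s b x) (well c s b y) \<le> 2 * \<bar>b\<bar> * s * dist x y"
    by (simp add: dist_norm mult_ac)
qed

lemma well_outside: "x \<notin> ball c s \<Longrightarrow> well c s b x = 0"
  by (simp add: well_def dist_norm norm_minus_commute min_absorb2)

lemma well_inside: "x \<in> ball c s \<Longrightarrow> well c s b x = b * ((norm (x - c))\<^sup>2 - s\<^sup>2)"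
  by (simp add: well_def dist_norm norm_minus_commute min_absorb1)

lemma abs_well_le:
  assumes "s > 0"
  shows "\<bar>well c s b x\<bar> \<le> \<bar>b\<bar> * s\<^sup>2"
proof -
  have "(min (norm (x - c)) s)\<^sup>2 \<le> s\<^sup>2" using assms by (intro power_mono) auto
  then have "\<bar>(min (norm (x - c)) s)\<^sup>2 - s\<^sup>2\<bar> \<le> s\<^sup>2" using zero_le_power2[of "min (norm (x - c)) s"] by linarith
  then show ?thesis unfolding well_def abs_mult by (rule mult_left_mono) simp
qed

lemma GDERIV_well:
  assumes "x \<notin> sphere c s"
  shows "GDERIV (well c s b) x :> (if x \<in> ball c s then (2 * b) *\<^sub>R (x - c) else 0)"
proof (cases "x \<in> ball c s")
  case True
  have "((\<lambda>x. b * ((x - c) \<bullet> (x - c) - s\<^sup>2)) has_derivative (\<lambda>h. h \<bullet> ((2 * b) *\<^sub>R (x - c)))) (at x)"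
    by (auto intro!: derivative_eq_intros simp: inner_commute algebra_simps)
  then have "(well c s b has_derivative (\<lambda>h. h \<bullet> ((2 * b) *\<^sub>R (x - c)))) (at x)"
    by (rule has_derivative_transform_within_open[OF _ open_ball True])
      (simp only: well_inside power2_norm_eq_inner)
  then show ?thesis using True by (simp add: gderiv_def)
next
  case False
  then have x: "x \<in> - cball c s" using assms by auto
  have "((\<lambda>_. 0 :: real) has_derivative (\<lambda>h. h \<bullet> 0)) (at x)" by simp
  then have "(well c s b has_derivative (\<lambda>h. h \<bullet> 0)) (at x)"
    by (rule has_derivative_transform_within_open[OF _ _ x]) (auto simp: well_outside)
  then show ?thesis using False by (simp add: gderiv_def)
qed

lemma continuous_well_gradient:
  fixes c :: "'a::euclidean_space"
  shows "continuous_on (- sphere c s) (\<lambda>x. if x \<in> ball c s then (2 * b) *\<^sub>R (x - c) else 0)"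
proof -
  have "continuous_on (ball c s) (\<lambda>x. if x \<in> ball c s then (2 * b) *\<^sub>R (x - c) else 0)"
  proof (rule continuous_on_eq)
    show "continuous_on (ball c s) (\<lambda>x. (2 * b) *\<^sub>R (x - c))" by (intro continuous_intros)
  qed simp
  moreover have "continuous_on (- cball c s) (\<lambda>x. if x \<in> ball c s then (2 * b) *\<^sub>R (x - c) else 0)"
    by (rule continuous_on_eq[where f = "\<lambda>x. 0"]) auto
  ultimately have "continuous_on (ball c s \<union> - cball c s) (\<lambda>x. if x \<in> ball c s then (2 * b) *\<^sub>R (x - c) else 0)"
    by (intro continuous_on_open_Un) auto
  moreover have "- sphere c s = ball c s \<union> - cball c s" by auto
  ultimately show ?thesis by simp
qed

lemma affine_approximation:
  fixes f :: "'a::euclidean_space \<Rightarrow> real"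
  assumes "\<And>y. y \<in> ball x0 r \<Longrightarrow> GDERIV f y :> D y" "\<And>y. y \<in> ball x0 r \<Longrightarrow> norm (D y - p) \<le> \<tau>"
    and y: "y \<in> ball x0 r"
  shows "\<bar>f y - f x0 - p \<bullet> (y - x0)\<bar> \<le> \<tau> * norm (y - x0)"
proof -
  have "0 < r" using y by (metis ball_eq_empty empty_iff not_le)
  have "\<bar>(f y - y \<bullet> p) - (f x0 - x0 \<bullet> p)\<bar> \<le> \<tau> * norm (y - x0)"
  proof (rule GDERIV_lipschitz_convex[of "ball x0 r" _ "\<lambda>z. D z - p"])
    show "GDERIV (\<lambda>z. f z - z \<bullet> p) z :> D z - p" if "z \<in> ball x0 r" for z
      by (rule GDERIV_diff[OF assms(1)[OF that]]) (simp add: gderiv_def bounded_linear_imp_has_derivative bounded_linear_inner_left)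
  qed (use assms y \<open>0 < r\<close> in auto)
  then show ?thesis by (simp add: inner_diff_right inner_commute algebra_simps)
qed

lemma integrand_near:
  fixes F :: "'m::finite integrand"
  assumes A: "assumption_A U F" and x: "x0 \<in> U" and e: "e > 0"
  shows "\<exists>\<sigma>>0. \<forall>y z x'. x' \<in> U \<longrightarrow> norm (y - p) < \<sigma> \<longrightarrow> \<bar>z - z0\<bar> < \<sigma> \<longrightarrow> norm (x' - x0) < \<sigma> \<longrightarrow>
    \<bar>(F y z x' - a - \<zeta> \<bullet> y) - (F p z0 x0 - a - \<zeta> \<bullet> p)\<bar> < e"
proof -
  let ?H = "\<lambda>P :: 'm pt \<times> real \<times> (real^'m). (\<lambda>(p, z, x'). F p z x') P - a - \<zeta> \<bullet> fst P"
  have "continuous_on (UNIV \<times> UNIV \<times> U) (\<lambda>(p, z, x'). F p z x')" using A unfolding assumption_A_def by blast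
  then have "continuous_on (UNIV \<times> UNIV \<times> U) ?H" by (intro continuous_intros)
  then obtain d where d: "d > 0" "\<And>P. P \<in> UNIV \<times> UNIV \<times> U \<Longrightarrow> dist P (p, z0, x0) < d \<Longrightarrow> dist (?H P) (?H (p, z0, x0)) < e"
    using x e unfolding continuous_on_iff by (metis (no_types, lifting) SigmaI UNIV_I)
  show ?thesis
  proof (intro exI[of _ "d / 3"] conjI allI impI)
    fix y z x' assume h: "x' \<in> U" "norm (y - p) < d / 3" "\<bar>z - z0\<bar> < d / 3" "norm (x' - x0) < d / 3"
    have "dist (y, z, x') (p, z0, x0) = norm (y - p, z - z0, x' - x0)" by (simp add: dist_norm)
    also have "\<dots> \<le> norm (y - p) + norm (z - z0, x' - x0)" by (rule norm_Pair_le)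
    also have "\<dots> \<le> norm (y - p) + (norm (z - z0) + norm (x' - x0))" by (intro add_left_mono norm_Pair_le)
    also have "\<dots> < d" using h by simp
    finally have "dist (?H (y, z, x')) (?H (p, z0, x0)) < e" using h by (intro d(2)) auto
    then show "\<bar>(F y z x' - a - \<zeta> \<bullet> y) - (F p z0 x0 - a - \<zeta> \<bullet> p)\<bar> < e" by (simp add: dist_real_def)
  qed (use d in simp)
qed

lemma eventually_dist_less_of_continuous_on:
  fixes f :: "'a::metric_space \<Rightarrow> 'b::metric_space"
  assumes "continuous_on S f" "open S" "x \<in> S" "e > 0"
  shows "\<forall>\<^sub>F y in nhds x. dist (f y) (f x) < e"
proof -
  have "isCont f x" using assms(1-3) continuous_on_eq_continuous_at by blast
  then have "(f \<longlongrightarrow> f x) (nhds x)" unfolding isCont_def tendsto_at_iff_tendsto_nhds .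
  then show ?thesis using assms(4) by (rule tendstoD)
qed

text \<open>
  In coordinates centred at \<open>x0\<close>, the displacement \<open>\<phi>\<close> is chosen such that \<open>p_n \<phi>\<close> is the minimum of \<open>0\<close> and
  \<open>\<mu>(\<xi>) = \<kappa> |\<xi>|\<^sup>2 / \<rho> - \<kappa> \<rho> - e \<bullet> \<xi>\<close> with \<open>e = \<theta> (p - q)\<close>.  To first order the deformed function is then
  \<open>p \<bullet> \<xi> + \<mu>(\<xi>)\<close>, of slope close to \<open>r0 = p - e\<close> where \<open>\<mu> < 0\<close> and \<open>|\<xi>| < 2 \<rho>\<close>.  Although \<open>\<mu>\<close> may be negative on a
  much larger ball, the deformed function is below both \<open>u\<close> and the translate only for \<open>|\<xi>| < 2 \<rho>\<close>: a convex
  combination of \<open>\<mu> < 0\<close> and \<open>(p - q) \<bullet> \<xi> + \<mu> < 0\<close> eliminates the linear term and leaves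
  \<open>|\<xi>|\<^sup>2 < \<rho>\<^sup>2\<close>, up to the error made by linearizing \<open>u\<close>.
\<close>

lemma corner_gain:
  fixes F :: "'m::finite integrand"
  assumes op: "open (cylinder U)" and A: "assumption_A U F" and C1: "C1_on (cylinder U) u"
    and x0: "x0 \<in> cylinder U" and level: "u (x0 + t *\<^sub>R e_n) = u x0"
    and p: "p = grad u x0" "snd p \<noteq> 0" and q: "q = grad u (x0 + t *\<^sub>R e_n)" and pq: "snd p * snd q \<le> 0"
  shows "\<exists>r \<delta> ut. \<delta> > 0 \<and> C01_on (cylinder U) ut \<and>
    (\<forall>R w. r < R \<longrightarrow> C1_on (cylinder U) w \<longrightarrow> (\<forall>x\<in>ball 0 r. w x = u (x + t *\<^sub>R e_n)) \<longrightarrow>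
       finite_energy U F R (\<lambda>x. min (u x) (w x)) \<longrightarrow>
       lipschitz_deformation U R u ut \<and>
       finite_energy U F R (\<lambda>x. min (ut x) (min (u x) (w x))) \<and>
       (real_energy U F R (\<lambda>x. min (ut x) (min (u x) (w x))))
         \<le> (real_energy U F R (\<lambda>x. min (u x) (w x))) - \<delta>)"
proof -
  let ?S = "cylinder U"
  have tS: "y + a *\<^sub>R e_n \<in> ?S \<longleftrightarrow> y \<in> ?S" for y a by (simp add: mem_cylinder)
  have C01u: "C01_on ?S u" using op C1 by (rule C1_on_locally_lipschitz)
  define pn where "pn = snd p"
  define z0 where "z0 = u x0"
  define x0' where "x0' = fst x0"
  have pn0: "pn \<noteq> 0" "0 < \<bar>pn\<bar>" using p(2) by (auto simp: pn_def)
  have x0'U: "x0' \<in> U" using x0 by (simp add: x0'_def mem_cylinder)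
  define d where "d = p - q"
  have pnd: "\<bar>pn\<bar> \<le> norm d"
  proof -
    have "\<bar>pn\<bar> * \<bar>pn\<bar> \<le> pn * (pn - snd q)" using pq by (simp add: pn_def algebra_simps)
    also have "\<dots> \<le> \<bar>pn\<bar> * \<bar>pn - snd q\<bar>" unfolding abs_mult[symmetric] by (rule abs_ge_self)
    finally have "\<bar>pn\<bar> \<le> \<bar>pn - snd q\<bar>" using pn0(2) by (rule mult_left_le_imp_le)
    then have "\<bar>pn\<bar> \<le> \<bar>snd d\<bar>" by (simp add: d_def pn_def)
    then show ?thesis using abs_snd_le_norm[of d] by linarith
  qed
  \<comment> \<open>Since \<open>p_n\<close> and \<open>q_n\<close> do not have the same sign, \<open>\<theta> \<le> 1/4\<close>; moreover \<open>|e| = |p_n|/4\<close> keeps the vertical component of \<open>r0\<close> nonzero.\<close>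
  define \<theta> where "\<theta> = \<bar>pn\<bar> / (4 * norm d)"
  have nd: "norm d > 0" using pnd pn0 by linarith
  have \<theta>: "0 < \<theta>" "\<theta> \<le> 1/4" using pnd pn0 nd by (auto simp: \<theta>_def field_simps)
  define e where "e = \<theta> *\<^sub>R d"
  have ne: "norm e = \<bar>pn\<bar> / 4" using nd pn0 \<theta> by (simp add: e_def) (simp add: \<theta>_def)
  define r0 where "r0 = p - e"
  have r0n: "snd r0 \<noteq> 0"
  proof
    assume "snd r0 = 0"
    then have "\<bar>snd e\<bar> = \<bar>pn\<bar>" by (simp add: r0_def pn_def)
    then show False using abs_snd_le_norm[of e] ne pn0 by simp
  qed
  have pr: "p \<noteq> r0" using ne pn0 by (auto simp: r0_def)
  have qr: "q \<noteq> r0"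
  proof
    assume "q = r0"
    then have "d = e" by (simp add: r0_def d_def)
    then show False using ne pnd pn0 by simp
  qed

  \<comment> \<open>The tangent plane of the integrand at \<open>r0\<close> is \<open>a + \<zeta> \<bullet> y\<close>.\<close>
  define f where "f y = F y z0 x0'" for y
  define \<zeta> where "\<zeta> = grad f r0"
  define a where "a = f r0 - \<zeta> \<bullet> r0"
  have above: "f y - a - \<zeta> \<bullet> y > 0" if "y \<noteq> r0" for y
  proof -
    have S: "open {p :: 'm pt. snd p \<noteq> 0}" by (intro open_Collect_neq continuous_intros)
    have "C2_on {p. snd p \<noteq> 0} f" "convex_on UNIV f" "uniformly_convex_at f r0"
      using A x0'U r0n unfolding assumption_A_def f_def[abs_def] by blast+
    from convex_strictly_above_tangent[OF S this(1,2) _ this(3) that] r0n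
    have "f r0 + (y - r0) \<bullet> \<zeta> < f y" by (simp add: \<zeta>_def)
    then show ?thesis by (simp add: a_def inner_diff_left inner_diff_right inner_commute)
  qed
  define Gp where "Gp = f p - a - \<zeta> \<bullet> p"
  define Gq where "Gq = f q - a - \<zeta> \<bullet> q"
  define \<gamma> where "\<gamma> = min Gp Gq"
  define \<Gamma> where "\<Gamma> = max Gp Gq + \<gamma> / 4"
  have \<gamma>: "\<gamma> > 0" "\<gamma> / 4 > 0" using above[OF pr] above[OF qr] by (auto simp: \<gamma>_def Gp_def Gq_def)
  define H where "H y z x' = F y z x' - a - \<zeta> \<bullet> y" for y z x'
  obtain \<sigma>1 where \<sigma>1: "\<sigma>1 > 0" "\<And>y z x'. x' \<in> U \<Longrightarrow> norm (y - p) < \<sigma>1 \<Longrightarrow> \<bar>z - z0\<bar> < \<sigma>1 \<Longrightarrow> norm (x' - x0') < \<sigma>1 \<Longrightarrow>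
      \<bar>H y z x' - Gp\<bar> < \<gamma> / 4"
    using integrand_near[OF A x0'U \<gamma>(2), of p z0 a \<zeta>] unfolding H_def Gp_def f_def by blast
  obtain \<sigma>2 where \<sigma>2: "\<sigma>2 > 0" "\<And>y z x'. x' \<in> U \<Longrightarrow> norm (y - q) < \<sigma>2 \<Longrightarrow> \<bar>z - z0\<bar> < \<sigma>2 \<Longrightarrow> norm (x' - x0') < \<sigma>2 \<Longrightarrow>
      \<bar>H y z x' - Gq\<bar> < \<gamma> / 4"
    using integrand_near[OF A x0'U \<gamma>(2), of q z0 a \<zeta>] unfolding H_def Gq_def f_def by blast
  have Gr: "F r0 z0 x0' - a - \<zeta> \<bullet> r0 = 0" by (simp add: a_def f_def)
  obtain \<sigma>3 where \<sigma>3: "\<sigma>3 > 0" "\<And>y z x'. x' \<in> U \<Longrightarrow> norm (y - r0) < \<sigma>3 \<Longrightarrow> \<bar>z - z0\<bar> < \<sigma>3 \<Longrightarrow> norm (x' - x0') < \<sigma>3 \<Longrightarrow>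
      \<bar>H y z x'\<bar> < \<gamma> / 4"
    using integrand_near[OF A x0'U \<gamma>(2), of r0 z0 a \<zeta>] unfolding H_def Gr by auto
  define \<sigma> where "\<sigma> = min \<sigma>1 (min \<sigma>2 \<sigma>3)"
  have \<sigma>: "\<sigma> > 0" "\<sigma> \<le> \<sigma>1" "\<sigma> \<le> \<sigma>2" "\<sigma> \<le> \<sigma>3" using \<sigma>1(1) \<sigma>2(1) \<sigma>3(1) by (auto simp: \<sigma>_def)

  \<comment> \<open>\<open>\<kappa>\<close> keeps the slope of \<open>\<mu>\<close> near \<open>-e\<close> for \<open>|\<xi>| < 2 \<rho>\<close>, \<open>\<tau>\<close> bounds the oscillation of the gradients on the ball of
      radius \<open>r1\<close>, and \<open>K \<rho>\<close> bounds the radius \<open>s\<close> of the support of \<open>\<phi>\<close>, so that \<open>\<rho>\<close> has to be small compared to \<open>r1\<close>.\<close>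
  define \<kappa> where "\<kappa> = min (\<bar>pn\<bar> / 8) (\<sigma> / 32)"
  have \<kappa>: "\<kappa> > 0" "\<kappa> \<le> \<bar>pn\<bar> / 8" "\<kappa> \<le> \<sigma> / 32" using pn0 \<sigma> by (auto simp: \<kappa>_def)
  define K where "K = 1 + norm e / (2 * \<kappa>)"
  have K: "K \<ge> 1" using \<kappa> by (simp add: K_def)
  define \<tau> where "\<tau> = min (min (\<sigma> / 16) (\<bar>pn\<bar> / 2)) (\<kappa> / (5 * K))"
  have \<tau>: "\<tau> > 0" "\<tau> \<le> \<sigma> / 16" "\<tau> \<le> \<bar>pn\<bar> / 2" "\<tau> \<le> \<kappa> / (5 * K)" 
  proof -
    have "0 < \<kappa> / (5 * K)" using \<kappa>(1) K by simp
    then show "\<tau> > 0" using pn0(2) \<sigma>(1) by (simp add: \<tau>_def)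
  qed (simp_all add: \<tau>_def)
  have \<tau>K: "5 * \<tau> * K \<le> \<kappa>" using \<tau>(4) K by (simp add: pos_le_divide_eq mult_ac)
  have gc: "continuous_on ?S (grad u)" and uc: "continuous_on ?S u"
    using C1 C1_on_continuous[OF C1] by (auto simp: C1_on_def)
  have shc: "continuous_on ?S (\<lambda>y. y + t *\<^sub>R e_n)" by (intro continuous_intros)
  have gc': "continuous_on ?S (\<lambda>y. grad u (y + t *\<^sub>R e_n))" and uc': "continuous_on ?S (\<lambda>y. u (y + t *\<^sub>R e_n))"
    using tS by (auto intro!: continuous_on_compose2[OF gc shc] continuous_on_compose2[OF uc shc])
  have fc: "continuous_on ?S fst" by (intro continuous_intros)
  have "\<forall>\<^sub>F y in nhds x0. y \<in> ?S \<and> dist (grad u y) (grad u x0) < \<tau> \<and>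
      dist (grad u (y + t *\<^sub>R e_n)) (grad u (x0 + t *\<^sub>R e_n)) < \<tau> \<and>
      dist (u y) (u x0) < \<sigma> \<and> dist (u (y + t *\<^sub>R e_n)) (u (x0 + t *\<^sub>R e_n)) < \<sigma> \<and> dist (fst y) (fst x0) < \<sigma>"
    by (intro eventually_conj eventually_nhds_in_open[OF op x0]
        eventually_dist_less_of_continuous_on[OF gc op x0 \<tau>(1)] eventually_dist_less_of_continuous_on[OF gc' op x0 \<tau>(1)]
        eventually_dist_less_of_continuous_on[OF uc op x0 \<sigma>(1)] eventually_dist_less_of_continuous_on[OF uc' op x0 \<sigma>(1)]
        eventually_dist_less_of_continuous_on[OF fc op x0 \<sigma>(1)])
  then obtain r1 where r1: "r1 > 0" and near: "\<And>y. y \<in> ball x0 r1 \<Longrightarrow> y \<in> ?S \<and> dist (grad u y) (grad u x0) < \<tau> \<and>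
      dist (grad u (y + t *\<^sub>R e_n)) (grad u (x0 + t *\<^sub>R e_n)) < \<tau> \<and>
      dist (u y) (u x0) < \<sigma> \<and> dist (u (y + t *\<^sub>R e_n)) (u (x0 + t *\<^sub>R e_n)) < \<sigma> \<and> dist (fst y) (fst x0) < \<sigma>"
    unfolding eventually_nhds_metric by (auto simp: dist_commute)
  have ball: "y \<in> ?S" "norm (grad u y - p) < \<tau>" "norm (grad u (y + t *\<^sub>R e_n) - q) < \<tau>"
     "\<bar>u y - z0\<bar> < \<sigma>" "\<bar>u (y + t *\<^sub>R e_n) - z0\<bar> < \<sigma>" "norm (fst y - x0') < \<sigma>" if "y \<in> ball x0 r1" for y
    using near[OF that] level by (auto simp: p(1) q z0_def x0'_def dist_norm)
  have gu: "GDERIV u y :> grad u y" if "y \<in> ball x0 r1" for y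
    by (rule C1_on_GDERIV[OF C1 ball(1)[OF that]])
  have gu': "GDERIV (\<lambda>y. u (y + t *\<^sub>R e_n)) y :> grad u (y + t *\<^sub>R e_n)" if "y \<in> ?S" for y
  proof -
    have "y + t *\<^sub>R e_n \<in> ?S" using that tS by simp
    then have "(u has_derivative (\<lambda>h. h \<bullet> grad u (y + t *\<^sub>R e_n))) (at (y + t *\<^sub>R e_n))"
      using C1_on_GDERIV[OF C1] by (simp add: gderiv_def)
    moreover have "((\<lambda>y. y + t *\<^sub>R e_n) has_derivative (\<lambda>h. h)) (at y)" by (auto intro!: derivative_eq_intros)
    ultimately show ?thesis unfolding gderiv_def using has_derivative_compose by blast
  qed
  have lin: "\<bar>u y - z0 - p \<bullet> (y - x0)\<bar> \<le> \<tau> * norm (y - x0)" if "y \<in> ball x0 r1" for y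
    unfolding z0_def by (rule affine_approximation[OF gu less_imp_le[OF ball(2)] that])
  have lin': "\<bar>u (y + t *\<^sub>R e_n) - z0 - q \<bullet> (y - x0)\<bar> \<le> \<tau> * norm (y - x0)" if "y \<in> ball x0 r1" for y
    unfolding z0_def level[symmetric]
    by (rule affine_approximation[OF gu'[OF ball(1)] less_imp_le[OF ball(3)] that])

  \<comment> \<open>Completing the square in \<open>\<mu>\<close> gives a paraboloid centred at \<open>x0 + c\<close> that is negative in the ball of radius \<open>s\<close>.\<close>
  define \<rho> where "\<rho> = r1 / (5 * K)"
  have \<rho>: "\<rho> > 0" using r1 K by (simp add: \<rho>_def)
  define c where "c = (\<rho> / (2 * \<kappa>)) *\<^sub>R e"
  define s where "s = sqrt ((norm c)\<^sup>2 + \<rho>\<^sup>2)"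
  have s2: "s\<^sup>2 = (norm c)\<^sup>2 + \<rho>\<^sup>2" by (simp add: s_def)
  have s: "s > 0" "norm c < s" "s \<le> K * \<rho>"
  proof -
    show "s > 0" using \<rho> by (simp add: s_def add_nonneg_pos)
    show "norm c < s" unfolding s_def using \<rho> by (intro real_less_rsqrt) simp
    have "s \<le> norm c + \<rho>" unfolding s_def using \<rho> by (intro sqrt_sum_squares_le_sum) auto
    also have "\<dots> = K * \<rho>" using \<rho> \<kappa> by (simp add: c_def K_def algebra_simps)
    finally show "s \<le> K * \<rho>" .
  qed
  have s5: "5 * s \<le> r1" using s(3) K unfolding \<rho>_def by (simp add: field_simps)
  define x1 where "x1 = x0 + c"
  define b where "b = \<kappa> / (\<rho> * pn)"
  have b: "2 * \<bar>b\<bar> * s \<le> 1/2"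
  proof -
    have "2 * \<bar>b\<bar> * s \<le> 2 * \<bar>b\<bar> * (K * \<rho>)" using s by (intro mult_left_mono) auto
    also have "\<dots> = (2 * \<kappa> + norm e) / \<bar>pn\<bar>" using \<kappa>(1) \<rho> pn0 by (simp add: b_def K_def abs_mult field_simps)
    also have "\<dots> \<le> 1/2" using ne \<kappa>(2) pn0 by (simp add: field_simps)
    finally show ?thesis .
  qed
  define \<phi> where "\<phi> = well x1 s b"
  define g\<phi> where "g\<phi> x = (if x \<in> ball x1 s then (2 * b) *\<^sub>R (x - x1) else 0)" for x
  define T where "T x = x + \<phi> x *\<^sub>R e_n" for x
  define ut where "ut x = u (T x)" for x
  define Gt where "Gt x = grad u (T x) + snd (grad u (T x)) *\<^sub>R g\<phi> x" for x
  have \<phi>lip: "(1/2)-lipschitz_on UNIV \<phi>"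
    using lipschitz_on_le[OF well_lipschitz[OF s(1)] b] by (simp add: \<phi>_def)
  have \<phi>le: "\<bar>\<phi> x\<bar> \<le> s / 4" for x
  proof -
    have "\<bar>\<phi> x\<bar> \<le> \<bar>b\<bar> * s\<^sup>2" unfolding \<phi>_def by (rule abs_well_le[OF s(1)])
    also have "\<dots> = (2 * \<bar>b\<bar> * s) * (s / 2)" by (simp add: power2_eq_square)
    also have "\<dots> \<le> (1/2) * (s / 2)" using b s by (intro mult_right_mono) auto
    finally show ?thesis by simp
  qed
  have g\<phi>le: "norm (g\<phi> x) \<le> 1/2" for x
  proof (cases "x \<in> ball x1 s")
    case True
    then have "norm (g\<phi> x) \<le> 2 * \<bar>b\<bar> * s"
      by (simp add: g\<phi>_def dist_norm norm_minus_commute abs_mult mult_left_mono)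
    then show ?thesis using b by linarith
  qed (simp add: g\<phi>_def)
  have TS: "T x \<in> ?S \<longleftrightarrow> x \<in> ?S" for x unfolding T_def by (rule tS)
  have Tdist: "norm (T x - x0) \<le> norm (x - x0) + s / 4" for x
  proof -
    have "norm (T x - x0) = norm ((x - x0) + \<phi> x *\<^sub>R e_n)" by (simp add: T_def algebra_simps)
    also have "\<dots> \<le> norm (x - x0) + \<bar>\<phi> x\<bar>" by (rule order_trans[OF norm_triangle_ineq]) simp
    finally show ?thesis using \<phi>le[of x] by linarith
  qed
  have Tball: "T x \<in> ball x0 r1" if "norm (x - x0) < 4 * s" for x
    using Tdist[of x] that s s5 by (simp add: dist_norm norm_minus_commute)
  have inball: "x \<in> ball x0 r1" if "norm (x - x0) < 4 * s" for x
    using that s s5 by (simp add: dist_norm norm_minus_commute)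
  have V2: "norm (x - x0) < 2 * s" if "x \<in> ball x1 s" for x
  proof -
    have "norm (x - x0) = norm ((x - x1) + c)" by (simp add: x1_def)
    also have "\<dots> \<le> norm (x - x1) + norm c" by (rule norm_triangle_ineq)
    finally show ?thesis using that s by (simp add: dist_norm norm_minus_commute)
  qed
  have gT: "GDERIV ut x :> Gt x" if "x \<in> ?S" "x \<notin> sphere x1 s" for x
  proof -
    have "(\<phi> has_derivative (\<lambda>h. h \<bullet> g\<phi> x)) (at x)"
      using GDERIV_well[OF that(2), of b] unfolding gderiv_def \<phi>_def g\<phi>_def .
    then have "(T has_derivative (\<lambda>h. h + (h \<bullet> g\<phi> x) *\<^sub>R e_n)) (at x)"
      unfolding T_def by (auto intro!: derivative_eq_intros)
    moreover have "(u has_derivative (\<lambda>h. h \<bullet> grad u (T x))) (at (T x))"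
      using C1_on_GDERIV[OF C1, of "T x"] TS that by (simp add: gderiv_def)
    ultimately have "(ut has_derivative (\<lambda>h. (h + (h \<bullet> g\<phi> x) *\<^sub>R e_n) \<bullet> grad u (T x))) (at x)"
      unfolding ut_def by (rule has_derivative_compose)
    then show ?thesis unfolding gderiv_def Gt_def
      by (simp add: inner_add_left inner_add_right algebra_simps)
  qed
  have Tc: "continuous_on X T" for X
    unfolding T_def using lipschitz_on_continuous_on[OF \<phi>lip]
    by (intro continuous_intros) (auto intro: continuous_on_subset)
  have VS: "ball x1 s \<subseteq> ?S"
  proof
    fix x assume "x \<in> ball x1 s"
    then have "x \<in> ball x0 r1" using V2[of x] s by (intro inball) linarith
    then show "x \<in> ?S" by (rule ball(1))
  qed
  have utc: "continuous_on ?S ut"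
    unfolding ut_def using TS by (intro continuous_on_compose2[OF uc Tc]) auto
  have Gtc: "continuous_on (ball x1 s) Gt"
  proof -
    have "continuous_on (ball x1 s) g\<phi>"
    proof (rule continuous_on_eq)
      show "continuous_on (ball x1 s) (\<lambda>x. (2 * b) *\<^sub>R (x - x1))" by (intro continuous_intros)
    qed (simp add: g\<phi>_def)
    moreover have "continuous_on (ball x1 s) (\<lambda>x. grad u (T x))"
      using TS VS by (intro continuous_on_compose2[OF gc Tc]) auto
    ultimately show ?thesis unfolding Gt_def by (intro continuous_intros)
  qed
  define \<mu> where "\<mu> x = \<kappa> * (norm (x - x0))\<^sup>2 / \<rho> - e \<bullet> (x - x0) - \<kappa> * \<rho>" for x
  have pn\<phi>: "pn * \<phi> x = \<mu> x" if "x \<in> ball x1 s" for x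
  proof -
    have "(norm (x - x1))\<^sup>2 = (norm (x - x0))\<^sup>2 - 2 * (c \<bullet> (x - x0)) + (norm c)\<^sup>2"
      unfolding x1_def power2_norm_eq_inner by (simp add: inner_commute algebra_simps)
    moreover have "2 * (c \<bullet> (x - x0)) = \<rho> / \<kappa> * (e \<bullet> (x - x0))" by (simp add: c_def)
    ultimately have "\<phi> x = b * ((norm (x - x0))\<^sup>2 - \<rho> / \<kappa> * (e \<bullet> (x - x0)) - \<rho>\<^sup>2)"
      unfolding \<phi>_def well_inside[OF that] s2 by simp
    moreover have "pn * b = \<kappa> / \<rho>" using pn0 by (simp add: b_def)
    ultimately have "pn * \<phi> x = \<kappa> / \<rho> * ((norm (x - x0))\<^sup>2 - \<rho> / \<kappa> * (e \<bullet> (x - x0)) - \<rho>\<^sup>2)"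
      by (simp add: mult.assoc[symmetric])
    then show ?thesis
      using \<rho> \<kappa>(1) by (simp add: \<mu>_def right_diff_distrib power2_eq_square)
  qed
  have \<mu>neg: "\<mu> x < 0" if "x \<in> ball x1 s" for x
  proof -
    have "norm (x - x1) < s" using that by (simp add: dist_norm norm_minus_commute)
    then have "(norm (x - x1))\<^sup>2 < s\<^sup>2" by (intro power_strict_mono) auto
    moreover have "pn * \<phi> x = (\<kappa> / \<rho>) * ((norm (x - x1))\<^sup>2 - s\<^sup>2)"
      unfolding \<phi>_def well_inside[OF that] b_def using pn0 by simp
    moreover have "\<kappa> / \<rho> > 0" using \<kappa> \<rho> by simp
    ultimately show ?thesis unfolding pn\<phi>[OF that, symmetric] by (simp only: mult_pos_neg diff_less_0_iff_less)
  qed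

  define D where "D = {x \<in> ?S. ut x < min (u x) (u (x + t *\<^sub>R e_n))}"
  have DV: "D \<subseteq> ball x1 s"
  proof
    fix x assume x: "x \<in> D"
    show "x \<in> ball x1 s"
    proof (rule ccontr)
      assume "x \<notin> ball x1 s"
      then have "ut x = u x" by (simp add: ut_def T_def \<phi>_def well_outside)
      then show False using x by (simp add: D_def)
    qed
  qed
  \<comment> \<open>The point where \<open>\<tau>\<close> has to be small compared to \<open>\<kappa>\<close>: the linearization error is at most \<open>5 \<tau> s \<le> \<kappa> \<rho>\<close>.\<close>
  have loc: "norm (x - x0) < 2 * \<rho>" if "x \<in> D" for x
  proof -
    have xV: "x \<in> ball x1 s" using that DV by blast
    define \<xi> where "\<xi> = x - x0"
    have \<xi>2: "norm \<xi> < 2 * s" using V2[OF xV] by (simp add: \<xi>_def)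
    have "norm (x - x0) < 4 * s" using \<xi>2 s(1) unfolding \<xi>_def by linarith
    note xb = inball[OF this] Tball[OF this]
    have Tx: "T x - x0 = \<xi> + \<phi> x *\<^sub>R e_n" by (simp add: T_def \<xi>_def)
    have "p \<bullet> (T x - x0) = p \<bullet> \<xi> + \<mu> x" using pn\<phi>[OF xV] by (simp add: Tx inner_add_right pn_def mult.commute)
    moreover have "norm (T x - x0) \<le> 3 * s" using Tdist[of x] \<xi>2 s by (simp add: \<xi>_def)
    then have "\<tau> * norm (T x - x0) \<le> \<tau> * (3 * s)" using \<tau> by (intro mult_left_mono) auto
    moreover have "\<tau> * norm \<xi> \<le> \<tau> * (2 * s)" using \<tau> \<xi>2 by (intro mult_left_mono) auto
    moreover have "ut x < u (x + t *\<^sub>R e_n)" using that by (simp add: D_def)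
    ultimately have "p \<bullet> \<xi> + \<mu> x - q \<bullet> \<xi> < 5 * \<tau> * s"
      using lin[OF xb(2)] lin'[OF xb(1)] unfolding ut_def \<xi>_def by linarith
    then have "\<theta> * (d \<bullet> \<xi> + \<mu> x) < \<theta> * (5 * \<tau> * s)" using \<theta> by (simp add: d_def inner_diff_left)
    moreover have "(1 - \<theta>) * \<mu> x \<le> 0" using \<theta> \<mu>neg[OF xV] by (intro mult_nonneg_nonpos) auto
    moreover have "\<theta> * (5 * \<tau> * s) \<le> 1 * (5 * \<tau> * s)" using \<theta> \<tau> s by (intro mult_right_mono) auto
    moreover have "e \<bullet> \<xi> = \<theta> * (d \<bullet> \<xi>)" by (simp add: e_def)
    ultimately have "e \<bullet> \<xi> + \<mu> x < 5 * \<tau> * s" by (simp add: algebra_simps)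
    also have "\<dots> \<le> 5 * \<tau> * (K * \<rho>)" using \<tau> s by (intro mult_left_mono) auto
    also have "\<dots> = (5 * \<tau> * K) * \<rho>" by simp
    also have "\<dots> \<le> \<kappa> * \<rho>" using \<tau>K \<rho> by (intro mult_right_mono) auto
    finally have "\<kappa> * (norm \<xi>)\<^sup>2 / \<rho> < 2 * \<kappa> * \<rho>" by (simp add: \<mu>_def \<xi>_def)
    then have "(norm \<xi>)\<^sup>2 < 2 * \<rho>\<^sup>2" using \<kappa>(1) \<rho> by (simp add: field_simps power2_eq_square)
    also have "\<dots> \<le> (2 * \<rho>)\<^sup>2" by (simp add: power_mult_distrib)
    finally show ?thesis using \<rho> power2_less_imp_less[of "norm \<xi>" "2 * \<rho>"] by (simp add: \<xi>_def)
  qed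
  have Dne: "x0 \<in> D"
  proof -
    have x0V: "x0 \<in> ball x1 s" using s by (simp add: x1_def dist_norm)
    have \<phi>0: "pn * \<phi> x0 = - \<kappa> * \<rho>" using pn\<phi>[OF x0V] by (simp add: \<mu>_def)
    then have "\<bar>pn\<bar> * \<bar>\<phi> x0\<bar> = \<kappa> * \<rho>" using \<kappa>(1) \<rho> by (simp flip: abs_mult)
    moreover have "\<tau> * \<bar>\<phi> x0\<bar> \<le> \<bar>pn\<bar> / 2 * \<bar>\<phi> x0\<bar>" using \<tau> by (intro mult_right_mono) auto
    ultimately have half: "\<tau> * \<bar>\<phi> x0\<bar> \<le> \<kappa> * \<rho> / 2" by simp
    have "T x0 \<in> ball x0 r1" using s by (intro Tball) simp
    from lin[OF this] have "\<bar>ut x0 - z0 - pn * \<phi> x0\<bar> \<le> \<tau> * \<bar>\<phi> x0\<bar>"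
      by (simp add: T_def ut_def pn_def mult.commute)
    moreover have "0 < \<kappa> * \<rho>" using \<kappa>(1) \<rho> by simp
    ultimately have "ut x0 < z0" using half \<phi>0 by linarith
    then show ?thesis using x0 level by (simp add: D_def z0_def)
  qed
  have est: "\<bar>H (Gt x) (ut x) (fst x)\<bar> \<le> \<gamma> / 4" if "x \<in> D" for x
  proof -
    have xV: "x \<in> ball x1 s" using that DV by blast
    have "norm (x - x0) < 4 * s" using V2[OF xV] s(1) by linarith
    note xb = inball[OF this] Tball[OF this]
    have "Gt x - r0 = (grad u (T x) - p) + snd (grad u (T x) - p) *\<^sub>R g\<phi> x + (pn *\<^sub>R g\<phi> x + e)"
      by (simp add: Gt_def r0_def pn_def algebra_simps)
    moreover have "pn *\<^sub>R g\<phi> x + e = (2 * \<kappa> / \<rho>) *\<^sub>R (x - x0)"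
    proof -
      have "pn *\<^sub>R g\<phi> x = (2 * \<kappa> / \<rho>) *\<^sub>R (x - x0 - c)" using xV pn0 by (simp add: g\<phi>_def b_def x1_def algebra_simps)
      moreover have "(2 * \<kappa> / \<rho>) *\<^sub>R c = e" using \<kappa>(1) \<rho> by (simp add: c_def)
      ultimately show ?thesis by (simp add: algebra_simps)
    qed
    ultimately have "norm (Gt x - r0) \<le> norm (grad u (T x) - p) + norm (snd (grad u (T x) - p) *\<^sub>R g\<phi> x) + norm ((2 * \<kappa> / \<rho>) *\<^sub>R (x - x0))"
      by (metis norm_triangle_ineq norm_triangle_le add_mono order_refl)
    moreover have "norm (snd (grad u (T x) - p) *\<^sub>R g\<phi> x) \<le> \<tau> * (1/2)"
      unfolding norm_scaleR using ball(2)[OF xb(2)] abs_snd_le_norm[of "grad u (T x) - p"] g\<phi>le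
      by (intro mult_mono) (auto simp del: snd_diff)
    moreover have "norm ((2 * \<kappa> / \<rho>) *\<^sub>R (x - x0)) \<le> (2 * \<kappa> / \<rho>) * (2 * \<rho>)"
    proof -
      have "0 \<le> 2 * \<kappa> / \<rho>" using \<kappa>(1) \<rho> by simp
      then show ?thesis unfolding norm_scaleR
        using loc[OF that] by (simp only: real_norm_def abs_of_nonneg) (rule mult_left_mono[OF less_imp_le])
    qed
    moreover have "(2 * \<kappa> / \<rho>) * (2 * \<rho>) = 4 * \<kappa>" using \<rho> by simp
    ultimately have "norm (Gt x - r0) < \<sigma>" using ball(2)[OF xb(2)] \<tau>(2) \<kappa>(3) \<sigma>(1) by linarith
    moreover have "\<bar>ut x - z0\<bar> < \<sigma>" using ball(4)[OF xb(2)] by (simp add: ut_def)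
    moreover have "norm (fst x - x0') < \<sigma>" by (rule ball(6)[OF xb(1)])
    moreover have "fst x \<in> U" using ball(1)[OF xb(1)] by (simp add: mem_cylinder)
    ultimately have "\<bar>H (Gt x) (ut x) (fst x)\<bar> < \<gamma> / 4" using \<sigma>(4) by (intro \<sigma>3(2)) auto
    then show ?thesis by simp
  qed
  have estu: "H (grad u x) (u x) (fst x) \<in> {3 * \<gamma> / 4 .. \<Gamma>}"
    and estw: "H (grad u (x + t *\<^sub>R e_n)) (u (x + t *\<^sub>R e_n)) (fst x) \<in> {3 * \<gamma> / 4 .. \<Gamma>}" if "x \<in> D" for x
  proof -
    have "x \<in> ball x1 s" using that DV by blast
    then have "norm (x - x0) < 4 * s" using V2[of x] s(1) by linarith
    note xb = inball[OF this]
    have U: "fst x \<in> U" using ball(1)[OF xb] by (simp add: mem_cylinder)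
    have "\<tau> < \<sigma>" using \<tau>(2) \<sigma>(1) by linarith
    then have "\<bar>H (grad u x) (u x) (fst x) - Gp\<bar> < \<gamma> / 4"
      "\<bar>H (grad u (x + t *\<^sub>R e_n)) (u (x + t *\<^sub>R e_n)) (fst x) - Gq\<bar> < \<gamma> / 4"
      using ball(2-6)[OF xb] \<sigma> U by (intro \<sigma>1(2) \<sigma>2(2); linarith)+
    moreover have "\<gamma> \<le> Gp" "\<gamma> \<le> Gq" "Gp + \<gamma> / 4 \<le> \<Gamma>" "Gq + \<gamma> / 4 \<le> \<Gamma>" by (auto simp: \<gamma>_def \<Gamma>_def)
    ultimately show "H (grad u x) (u x) (fst x) \<in> {3 * \<gamma> / 4 .. \<Gamma>}"
      "H (grad u (x + t *\<^sub>R e_n)) (u (x + t *\<^sub>R e_n)) (fst x) \<in> {3 * \<gamma> / 4 .. \<Gamma>}"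
      unfolding atLeastAtMost_iff by (intro conjI; linarith)+
  qed

  have gbd: "norm (grad u y) \<le> norm p + \<tau>" "norm (grad u (y + t *\<^sub>R e_n)) \<le> norm q + \<tau>" if "y \<in> ball x0 r1" for y
    using ball(2,3)[OF that] norm_triangle_sub[of "grad u y" p] norm_triangle_sub[of "grad u (y + t *\<^sub>R e_n)" q] by linarith+
  have lu: "\<bar>u x - u y\<bar> \<le> (norm p + \<tau>) * norm (x - y)" if "x \<in> ball x0 r1" "y \<in> ball x0 r1" for x y
    by (rule GDERIV_lipschitz_convex[OF convex_ball gu gbd(1) that])
  have lw: "\<bar>u (x + t *\<^sub>R e_n) - u (y + t *\<^sub>R e_n)\<bar> \<le> (norm q + \<tau>) * norm (x - y)" if "x \<in> ball x0 r1" "y \<in> ball x0 r1" for x y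
    by (rule GDERIV_lipschitz_convex[OF convex_ball gu'[OF ball(1)] gbd(2) that])
  have Tlip: "norm (T x - T y) \<le> 3/2 * norm (x - y)" for x y
  proof -
    have "norm (T x - T y) = norm ((x - y) + (\<phi> x - \<phi> y) *\<^sub>R e_n)" by (simp add: T_def algebra_simps)
    also have "\<dots> \<le> norm (x - y) + \<bar>\<phi> x - \<phi> y\<bar>" by (rule order_trans[OF norm_triangle_ineq]) simp
    also have "\<bar>\<phi> x - \<phi> y\<bar> \<le> 1/2 * norm (x - y)" using lipschitz_onD[OF \<phi>lip, of x y] by (simp add: dist_norm)
    finally show ?thesis by simp
  qed
  have b4: "x \<in> ball x0 r1" "T x \<in> ball x0 r1" if "x \<in> ball x0 (2 * (2 * s))" for x
  proof -
    have "norm (x - x0) < 4 * s" using that by (simp add: dist_norm norm_minus_commute)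
    then show "x \<in> ball x0 r1" "T x \<in> ball x0 r1" by (rule inball, rule Tball)
  qed
  define L where "L = 2 * (norm p + norm q + \<tau>)"
  have lipI: "L-lipschitz_on (ball x0 (2 * (2 * s))) v"
    if "\<And>x y. x \<in> ball x0 (2 * (2 * s)) \<Longrightarrow> y \<in> ball x0 (2 * (2 * s)) \<Longrightarrow> \<bar>v x - v y\<bar> \<le> l * norm (x - y)" "l \<le> L" for v l
    unfolding lipschitz_on_def
  proof (intro conjI ballI)
    show "0 \<le> L" using \<tau> by (simp add: L_def)
    fix x y assume xy: "x \<in> ball x0 (2 * (2 * s))" "y \<in> ball x0 (2 * (2 * s))"
    have "l * norm (x - y) \<le> L * norm (x - y)" using that(2) by (rule mult_right_mono) simp
    then show "dist (v x) (v y) \<le> L * dist x y" using that(1)[OF xy] by (simp add: dist_norm)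
  qed
  have lipu: "L-lipschitz_on (ball x0 (2 * (2 * s))) u"
    by (rule lipI[OF lu[OF b4(1) b4(1)]]) (use \<tau> in \<open>simp_all add: L_def\<close>)
  have lipw: "L-lipschitz_on (ball x0 (2 * (2 * s))) (\<lambda>x. u (x + t *\<^sub>R e_n))"
    by (rule lipI[OF lw[OF b4(1) b4(1)]]) (use \<tau> in \<open>simp_all add: L_def\<close>)
  have lipt: "L-lipschitz_on (ball x0 (2 * (2 * s))) ut"
  proof (rule lipI)
    fix x y assume xy: "x \<in> ball x0 (2 * (2 * s))" "y \<in> ball x0 (2 * (2 * s))"
    have "\<bar>ut x - ut y\<bar> \<le> (norm p + \<tau>) * norm (T x - T y)" unfolding ut_def by (rule lu[OF b4(2) b4(2), OF xy])
    also have "\<dots> \<le> (norm p + \<tau>) * (3/2 * norm (x - y))" using \<tau> by (intro mult_left_mono Tlip) auto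
    finally show "\<bar>ut x - ut y\<bar> \<le> ((norm p + \<tau>) * (3/2)) * norm (x - y)" by (simp only: mult.assoc)
  qed (use \<tau> in \<open>simp add: L_def\<close>)

  define r where "r = norm x0 + r1"
  have br: "ball x0 r1 \<subseteq> ball 0 r"
  proof
    fix y assume "y \<in> ball x0 r1"
    then show "y \<in> ball 0 r" using norm_triangle_sub[of y x0] by (simp add: r_def dist_norm norm_minus_commute)
  qed
  have "C01_on ?S ut" unfolding ut_def T_def by (rule C01_on_deform[OF C01u \<phi>lip])
  moreover have "lipschitz_deformation U R u ut \<and>
       finite_energy U F R (\<lambda>x. min (ut x) (min (u x) (w x))) \<and>
       (real_energy U F R (\<lambda>x. min (ut x) (min (u x) (w x))))
         \<le> (real_energy U F R (\<lambda>x. min (u x) (w x))) - \<gamma> / 2 * measure lebesgue D"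
    if R: "r < R" and Cw: "C1_on ?S w" and w: "\<forall>x\<in>ball 0 r. w x = u (x + t *\<^sub>R e_n)"
      and im: "finite_energy U F R (\<lambda>x. min (u x) (w x))" for R w
  proof -
    have bR: "ball x0 r1 \<subseteq> ball 0 R" using br R by (auto intro: less_trans)
    have ws: "w x = u (x + t *\<^sub>R e_n)" if "x \<in> ball x0 r1" for x using w br that by blast
    have gw: "grad w x = grad u (x + t *\<^sub>R e_n)" if x: "x \<in> ball x0 r1" for x
    proof (rule grad_eq)
      have "((\<lambda>y. u (y + t *\<^sub>R e_n)) has_derivative (\<lambda>h. h \<bullet> grad u (x + t *\<^sub>R e_n))) (at x)"
        using gu'[OF ball(1)[OF x]] by (simp add: gderiv_def)
      then show "GDERIV w x :> grad u (x + t *\<^sub>R e_n)" unfolding gderiv_def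
        by (rule has_derivative_transform_within_open[OF _ open_ball x]) (simp add: ws)
    qed
    have V1: "ball x1 s \<subseteq> ball x0 r1"
    proof
      fix x assume "x \<in> ball x1 s"
      then show "x \<in> ball x0 r1" using V2[of x] s by (intro inball) linarith
    qed
    have Dw: "D = {x \<in> ?S. ut x < min (u x) (w x)}"
    proof -
      have "x \<in> ball x1 s" if "x \<in> ?S" "ut x < min (u x) (w x)" for x
      proof (rule ccontr)
        assume "x \<notin> ball x1 s"
        then have "ut x = u x" by (simp add: ut_def T_def \<phi>_def well_outside)
        then show False using that by simp
      qed
      note in_well = this
      show ?thesis
      proof (rule set_eqI)
        fix x
        show "x \<in> D \<longleftrightarrow> x \<in> {x \<in> ?S. ut x < min (u x) (w x)}"
        proof (cases "x \<in> ball x1 s")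
          case True
          then have "w x = u (x + t *\<^sub>R e_n)" using V1 ws by blast
          then show ?thesis by (simp only: D_def mem_Collect_eq)
        next
          case False
          then have "x \<notin> D" using DV by blast
          moreover have "x \<notin> {x \<in> ?S. ut x < min (u x) (w x)}" using False in_well[of x] by blast
          ultimately show ?thesis by blast
        qed
      qed
    qed
    have deform: "lipschitz_deformation U R u ut"
    proof (rule lipschitz_deformationI[where \<psi> = \<phi> and N = "sphere x1 s" and D = g\<phi> and b = "1/2" and c = x1 and r = s])
      show "(1/2)-lipschitz_on UNIV \<phi>" by (rule \<phi>lip)
      show "x \<in> cball x1 s" if "\<phi> x \<noteq> 0" for x
        using that well_outside[of x x1 s b] by (auto simp: \<phi>_def intro: less_imp_le)
      show "cball x1 s \<subseteq> ball 0 R"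
      proof
        fix x assume "x \<in> cball x1 s"
        then have "norm (x - x1) \<le> s" by (simp add: dist_norm norm_minus_commute)
        moreover have "norm (x - x0) \<le> norm (x - x1) + norm c"
          using norm_triangle_ineq[of "x - x1" c] by (simp add: x1_def)
        ultimately have "x \<in> ball x0 r1" using s by (intro inball) linarith
        then show "x \<in> ball 0 R" using bR by blast
      qed
      show "negligible (sphere x1 s)" by (rule negligible_sphere)
      show "continuous_on (- sphere x1 s) g\<phi>" unfolding g\<phi>_def by (rule continuous_well_gradient)
      show "GDERIV \<phi> x :> g\<phi> x" if "x \<notin> sphere x1 s" for x
        unfolding \<phi>_def g\<phi>_def by (rule GDERIV_well[OF that])
      show "\<bar>snd (g\<phi> x)\<bar> \<le> 1/2" for x using abs_snd_le_norm[of "g\<phi> x"] g\<phi>le[of x] by linarith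
    qed (auto simp: ut_def T_def)
    have D2: "D \<subseteq> ball x0 (2 * s)"
    proof
      fix x assume "x \<in> D"
      then show "x \<in> ball x0 (2 * s)" using DV V2[of x] by (auto simp: dist_norm norm_minus_commute)
    qed
    have B4: "ball x0 (2 * (2 * s)) \<subseteq> ball x0 r1" using s s5 by (intro subset_ball) simp
    have B2: "ball x0 (2 * s) \<subseteq> ball 0 R" using s s5 bR subset_ball[of "2 * s" r1 x0] by auto
    have lipw': "L-lipschitz_on (ball x0 (2 * (2 * s))) w"
      by (rule lipschitz_on_transform[OF lipw]) (use ws B4 in auto)
    have xD: "x \<in> ball x0 r1" if "x \<in> D" for x using that DV V1 by blast
    have BS: "ball x0 (2 * (2 * s)) \<subseteq> ?S" using B4 ball(1) by blast
    have s20: "0 < 2 * s" "D \<noteq> {}" using s Dne by auto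
    note cut = cut_corner_energy[OF op A C1 Cw im negligible_sphere gT Gtc utc Dw DV s20(2) D2 s20(1) BS B2 lipu lipw' lipt \<gamma>(1)
        est[unfolded H_def] estu[unfolded H_def]]
    have "F (grad w x) (w x) (fst x) - a - \<zeta> \<bullet> grad w x \<in> {3 * \<gamma> / 4 .. \<Gamma>}" if "x \<in> D" for x
      using estw[OF that] unfolding H_def ws[OF xD[OF that]] gw[OF xD[OF that]] .
    from cut[OF _ _ _ _ this] deform show ?thesis by blast
  qed
  moreover have "0 < \<gamma> / 2 * measure lebesgue D"
  proof -
    have "D = ?S \<inter> (\<lambda>x. min (u x) (u (x + t *\<^sub>R e_n)) - ut x) -` {0<..}" by (auto simp: D_def)
    also have "open \<dots>" using uc uc' utc by (intro continuous_open_preimage op continuous_intros) auto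
    finally have "open D" .
    moreover have "bounded D" using DV bounded_subset[OF bounded_ball] by blast
    moreover have "D \<noteq> {}" using Dne by blast
    ultimately have "0 < measure lebesgue D" by (rule measure_open_bounded_pos(2))
    then show ?thesis using \<gamma>(1) by simp
  qed
  ultimately show ?thesis by blast
qed

section \<open>Monotonicity on vertical lines\<close>

theorem theorem2p5:
  fixes U :: "(real^'m::finite) set"
    and F :: "'m integrand"
    and u :: "'m pt \<Rightarrow> real"
  assumes "is_domain (cylinder U)"
    and "assumption_A U F"
    and "assumption_B U F"
    and "C1_on (cylinder U) u"
    and "e_n_minimizer U F u"
    and "\<exists>C>0. \<forall>\<^sub>F R in at_top.
           (\<integral>\<^sup>+x\<in>cylinder U \<inter> ball 0 R.
              ennreal (onorm (F_pp F (grad u x) (u x) (fst x)) * (norm (grad u x))\<^sup>2) \<partial>lebesgue)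
           \<le> ennreal (C * R\<^sup>2)"
  shows "\<forall>xb\<in>cylinder U.
           (\<forall>t. partial_n u (xb + t *\<^sub>R e_n) \<ge> 0) \<or> (\<forall>t. partial_n u (xb + t *\<^sub>R e_n) \<le> 0)"
proof (rule ccontr)
  assume "\<not> ?thesis"
  then obtain xb a b where xb: "xb \<in> cylinder U" and a: "\<not> partial_n u (xb + a *\<^sub>R e_n) \<le> 0"
    and b: "\<not> partial_n u (xb + b *\<^sub>R e_n) \<ge> 0" by blast
  have op: "open (cylinder U)" using assms(1) by (simp add: is_domain_def)
  note A = assms(2) and B = assms(3) and C1 = assms(4) and min = assms(5)
  have S: "xb + s *\<^sub>R e_n \<in> cylinder U" for s using xb by (simp add: mem_cylinder)
  define h' where "h' s = snd (grad u (xb + s *\<^sub>R e_n))" for s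
  have pn: "partial_n u (xb + s *\<^sub>R e_n) = h' s" for s
    unfolding h'_def by (rule partial_n_eq[OF C1_on_GDERIV[OF C1 S]])
  have "((\<lambda>s. u (xb + s *\<^sub>R e_n)) has_real_derivative h' s) (at s)" for s
  proof -
    have "(u has_derivative (\<lambda>h. h \<bullet> grad u (xb + s *\<^sub>R e_n))) (at (xb + s *\<^sub>R e_n))"
      using C1_on_GDERIV[OF C1 S] by (simp add: gderiv_def)
    moreover have "((\<lambda>s. xb + s *\<^sub>R e_n) has_derivative (\<lambda>h. h *\<^sub>R e_n)) (at s)"
      by (auto intro!: derivative_eq_intros)
    ultimately have "((\<lambda>s. u (xb + s *\<^sub>R e_n)) has_derivative (\<lambda>h. (h *\<^sub>R e_n) \<bullet> grad u (xb + s *\<^sub>R e_n))) (at s)"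
      using has_derivative_compose by blast
    then show ?thesis unfolding has_field_derivative_def h'_def by (simp add: mult_commute_abs)
  qed
  from line_crossing[of "\<lambda>s. u (xb + s *\<^sub>R e_n)" h' a b, OF this] a b
  obtain s s' where s: "u (xb + s *\<^sub>R e_n) = u (xb + s' *\<^sub>R e_n)" "h' s \<noteq> 0" "h' s * h' s' \<le> 0"
    unfolding pn by auto
  define x0 where "x0 = xb + s *\<^sub>R e_n"
  define t where "t = s' - s"
  have x0: "x0 \<in> cylinder U" unfolding x0_def by (rule S)
  have x0t: "x0 + t *\<^sub>R e_n = xb + s' *\<^sub>R e_n" by (simp add: x0_def t_def algebra_simps)
  have lvl: "u (x0 + t *\<^sub>R e_n) = u x0" unfolding x0t using s(1) by (simp add: x0_def)
  have g: "snd (grad u x0) \<noteq> 0" "snd (grad u x0) * snd (grad u (x0 + t *\<^sub>R e_n)) \<le> 0"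
    using s(2,3) unfolding x0t by (simp_all add: h'_def x0_def)
  obtain r \<delta> ut where \<delta>: "\<delta> > 0" and ut: "C01_on (cylinder U) ut"
    and gain: "\<And>R w. r < R \<Longrightarrow> C1_on (cylinder U) w \<Longrightarrow> (\<forall>x\<in>ball 0 r. w x = u (x + t *\<^sub>R e_n)) \<Longrightarrow>
       finite_energy U F R (\<lambda>x. min (u x) (w x)) \<Longrightarrow>
       lipschitz_deformation U R u ut \<and>
       finite_energy U F R (\<lambda>x. min (ut x) (min (u x) (w x))) \<and>
       (real_energy U F R (\<lambda>x. min (ut x) (min (u x) (w x))))
         \<le> (real_energy U F R (\<lambda>x. min (u x) (w x))) - \<delta>"
    using corner_gain[OF op A C1 x0 lvl refl g(1) refl g(2)] by blast
  obtain M where M: "M > 0" "\<forall>\<^sub>F R in at_top.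
           (\<integral>\<^sup>+x\<in>cylinder U \<inter> ball 0 R.
              ennreal (onorm (F_pp F (grad u x) (u x) (fst x)) * (norm (grad u x))\<^sup>2) \<partial>lebesgue)
           \<le> ennreal (M * R\<^sup>2)" using assms(6) by blast
  have \<delta>2: "\<delta> / 2 > 0" using \<delta> by simp
  obtain R w where R: "r < R" "0 < R" and w: "lipschitz_deformation U R u w" "C1_on (cylinder U) w"
      "\<forall>x\<in>ball 0 r. w x = u (x + t *\<^sub>R e_n)"
      "finite_energy U F R w"
    and le: "(real_energy U F R w)
      \<le> (real_energy U F R u) + \<delta> / 2"
    using almost_translation[OF op A B C1 min M \<delta>2, of r t] by blast
  let ?E = "real_energy U F R"
  let ?m = "\<lambda>x. min (u x) (w x)" and ?M = "\<lambda>x. max (u x) (w x)"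
  let ?v = "\<lambda>x. min (ut x) (min (u x) (w x))"
  have iu: "finite_energy U F R u"
    by (rule minimizer_integrable[OF op A C1 min R(2)])
  note mm = min_max_energy[OF op C1 w(2) iu w(4)]
  note gn = gain[OF R(1) w(2,3) mm(1)]
  have Cu: "C01_on (cylinder U) u" and Cw: "C01_on (cylinder U) w"
    using C1_on_locally_lipschitz[OF op] C1 w(2) by auto
  have "?M \<in> piecewise_deformations U R u"
    unfolding piecewise_deformations_def
    using C01_on_max[OF Cu Cw] self_deformation[OF R(2)] w(1)
    by (intro CollectI conjI exI[of _ "{u, w}"]) (auto simp: max_def)
  then have 1: "?E u \<le> ?E ?M" by (rule minimizer_integral_le[OF op A C1 min R(2) _ mm(2)])
  have "?v \<in> piecewise_deformations U R u"
    unfolding piecewise_deformations_def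
    using C01_on_min[OF ut C01_on_min[OF Cu Cw]] self_deformation[OF R(2)] w(1) gn
    by (intro CollectI conjI exI[of _ "{ut, u, w}"]) (auto simp: min_def)
  then have 2: "?E u \<le> ?E ?v" by (rule minimizer_integral_le[OF op A C1 min R(2)]) (use gn in blast)
  have 3: "?E ?v \<le> ?E ?m - \<delta>" using gn by blast
  show False using 1 2 3 mm(3) le \<delta> by linarith
qed

end
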